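(* \textsc{Token Sliding}, parameterized by $k$, admits a kernel with $\mathcal{O}(k^2\Delta^5)$ vertices on bipartite graphs of maximum degree $\Delta$. Moreover, on such graphs the problem can be solved in time $\mathcal{O}^\star(k^{2k}\Delta^{5k})$.
   Context: \textsc{Token Sliding}: given a graph $G$ and two independent sets $S,T$ of $G$ with $|S|=|T|=k\ge1$, decide whether there is a sequence $S=S_0,\dots,S_\ell=T$ of independent sets of size $k$ such that each $S_{i+1}$ is obtained from $S_i$ by replacing one vertex $u\in S_i$ by a vertex $w\notin S_i$ with $uw\in E(G)$ (a token slides along an edge), every intermediate set being independent. A kernel with at most $f$ vertices is a polynomial-time algorithm producing an equivalent instance whose graph has at most $f$ vertices. $\mathcal{O}^\star$ hides factors polynomial in the input size. *)

theory Defs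
  imports
    "Graph_Theory.Pair_Digraph"
    "HOL-Computational_Algebra.Polynomial"
    "HOL-Library.Log_Nat"
begin

section \<open>Token sliding\<close>

text \<open>
  Finite simple undirected graphs are the symmetric loop-free digraphs without parallel arcs of
  the locale \<^locale>\<open>pair_graph\<close>: an edge \<open>uw\<close> is represented by the two arcs \<open>(u, w)\<close> and \<open>(w, u)\<close>,
  so the degree of a vertex is its out-degree.
\<close>

definition max_degree_le :: "'a pair_pre_digraph \<Rightarrow> nat \<Rightarrow> bool" where
  "max_degree_le G \<Delta> \<longleftrightarrow> (\<forall>v \<in> pverts G. out_degree (with_proj G) v \<le> \<Delta>)"

definition bipartite :: "'a pair_pre_digraph \<Rightarrow> bool" where
  "bipartite G \<longleftrightarrow> (\<exists>A B. A \<union> B = pverts G \<and> A \<inter> B = {} \<and>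
     (\<forall>(u, w) \<in> parcs G. (u \<in> A \<and> w \<in> B) \<or> (u \<in> B \<and> w \<in> A)))"

definition independent_set :: "'a pair_pre_digraph \<Rightarrow> 'a set \<Rightarrow> bool" where
  "independent_set G S \<longleftrightarrow> S \<subseteq> pverts G \<and> (\<forall>u \<in> S. \<forall>w \<in> S. (u, w) \<notin> parcs G)"

definition slide :: "'a pair_pre_digraph \<Rightarrow> 'a set \<Rightarrow> 'a set \<Rightarrow> bool" where
  "slide G A B \<longleftrightarrow> (\<exists>u w. u \<in> A \<and> w \<notin> A \<and> (u, w) \<in> parcs G \<and> B = insert w (A - {u}))"

definition reconfigurable :: "'a pair_pre_digraph \<Rightarrow> 'a set \<Rightarrow> 'a set \<Rightarrow> bool" where
  "reconfigurable G S T \<longleftrightarrow> (\<exists>(\<sigma> :: nat \<Rightarrow> 'a set) l. \<sigma> 0 = S \<and> \<sigma> l = T \<and>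
     (\<forall>i \<le> l. independent_set G (\<sigma> i) \<and> card (\<sigma> i) = card S) \<and>
     (\<forall>i < l. slide G (\<sigma> i) (\<sigma> (Suc i))))"

record ts_instance =
  ts_graph :: "nat pair_pre_digraph"
  ts_source :: "nat set"
  ts_target :: "nat set"

definition num_vertices :: "ts_instance \<Rightarrow> nat" where
  "num_vertices I = card (pverts (ts_graph I))"

definition num_tokens :: "ts_instance \<Rightarrow> nat" where
  "num_tokens I = card (ts_source I)"

text \<open>As algorithms receive graphs in encoded form, the \<open>n\<close> vertices are numbered \<open>0, \<dots>, n - 1\<close>.\<close>

definition ts_instance_wf :: "ts_instance \<Rightarrow> bool" where
  "ts_instance_wf I \<longleftrightarrow>
     pair_graph (ts_graph I) \<and> pverts (ts_graph I) = {..<num_vertices I} \<and>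
     independent_set (ts_graph I) (ts_source I) \<and> independent_set (ts_graph I) (ts_target I) \<and>
     card (ts_source I) = card (ts_target I) \<and> num_tokens I \<ge> 1"

definition ts_bipartite_instance :: "nat \<Rightarrow> ts_instance \<Rightarrow> bool" where
  "ts_bipartite_instance \<Delta> I \<longleftrightarrow>
     ts_instance_wf I \<and> bipartite (ts_graph I) \<and> max_degree_le (ts_graph I) \<Delta>"

definition ts_yes :: "ts_instance \<Rightarrow> bool" where
  "ts_yes I \<longleftrightarrow> reconfigurable (ts_graph I) (ts_source I) (ts_target I)"

text \<open>
  Number of vertices, adjacency matrix (row by row), and characteristic vectors of the two
  independent sets.  The length \<open>1 + n\<^sup>2 + 2 n\<close> of this list is polynomially
  related to the number of bits of the instance and serves as input size.
\<close>

definition encode :: "ts_instance \<Rightarrow> nat list" where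
  "encode I = (let n = num_vertices I in
     n # [of_bool ((u, v) \<in> parcs (ts_graph I)). u \<leftarrow> [0..<n], v \<leftarrow> [0..<n]]
       @ [of_bool (v \<in> ts_source I). v \<leftarrow> [0..<n]]
       @ [of_bool (v \<in> ts_target I). v \<leftarrow> [0..<n]])"

definition input_size :: "ts_instance \<Rightarrow> nat" where
  "input_size I = length (encode I)"


section \<open>Random access machines with logarithmic cost\<close>

text \<open>
  Algorithms are random access machine programs, written as structured while programs
  instead of with jumps.  The store consists of registers and of
  arrays; a program names its registers and arrays explicitly, so it uses a fixed
  finite number of them, and only array indices are computed at run time.  Running
  times follow the logarithmic cost criterion: an operation pays for the bit lengths of its
  operands (including addresses) and of its result.  Thus large numbers cannot be exploited to
  perform superpolynomial work in polynomial time.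
\<close>

record store =
  reg :: "nat \<Rightarrow> nat"
  arr :: "nat \<Rightarrow> nat \<Rightarrow> nat"

datatype aexp =
    Const nat
  | Reg nat
  | Arr nat aexp
  | Add aexp aexp
  | Sub aexp aexp
  | Mul aexp aexp
  | Div aexp aexp
  | Less aexp aexp

primrec aval :: "aexp \<Rightarrow> store \<Rightarrow> nat" where
  "aval (Const m) s = m"
| "aval (Reg x) s = reg s x"
| "aval (Arr a e) s = arr s a (aval e s)"
| "aval (Add e f) s = aval e s + aval f s"
| "aval (Sub e f) s = aval e s - aval f s"
| "aval (Mul e f) s = aval e s * aval f s"
| "aval (Div e f) s = aval e s div aval f s"
| "aval (Less e f) s = of_bool (aval e s < aval f s)"

text \<open>
  Every subexpression is charged one plus the bit length \<open>floorlog 2\<close> of its value, so that the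
  operands of an operation are paid for when they are evaluated.
\<close>

primrec acost :: "aexp \<Rightarrow> store \<Rightarrow> nat" where
  "acost (Const m) s = 1 + floorlog 2 m"
| "acost (Reg x) s = 1 + floorlog 2 (aval (Reg x) s)"
| "acost (Arr a e) s = acost e s + 1 + floorlog 2 (aval (Arr a e) s)"
| "acost (Add e f) s = acost e s + acost f s + 1 + floorlog 2 (aval (Add e f) s)"
| "acost (Sub e f) s = acost e s + acost f s + 1 + floorlog 2 (aval (Sub e f) s)"
| "acost (Mul e f) s = acost e s + acost f s + 1 + floorlog 2 (aval (Mul e f) s)"
| "acost (Div e f) s = acost e s + acost f s + 1 + floorlog 2 (aval (Div e f) s)"
| "acost (Less e f) s = acost e s + acost f s + 1 + floorlog 2 (aval (Less e f) s)"

datatype com =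
    Skip
  | Assign nat aexp
  | Store nat aexp aexp
  | Seq com com
  | If aexp com com
  | While aexp com

text \<open>\<open>exec c s t s'\<close>: started in \<open>s\<close>, program \<open>c\<close> halts in \<open>s'\<close> at total cost \<open>t\<close>; a test succeeds
  iff its value is nonzero.\<close>

inductive exec :: "com \<Rightarrow> store \<Rightarrow> nat \<Rightarrow> store \<Rightarrow> bool" where
  Skip: "exec Skip s 1 s"
| Assign: "exec (Assign x e) s (1 + acost e s) (s\<lparr>reg := (reg s)(x := aval e s)\<rparr>)"
| Store: "exec (Store a i e) s (1 + acost i s + acost e s)
    (s\<lparr>arr := (arr s)(a := (arr s a)(aval i s := aval e s))\<rparr>)"
| Seq: "exec c s t s' \<Longrightarrow> exec d s' t' s'' \<Longrightarrow> exec (Seq c d) s (t + t') s''"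
| IfTrue: "aval b s \<noteq> 0 \<Longrightarrow> exec c s t s' \<Longrightarrow> exec (If b c d) s (1 + acost b s + t) s'"
| IfFalse: "aval b s = 0 \<Longrightarrow> exec d s t s' \<Longrightarrow> exec (If b c d) s (1 + acost b s + t) s'"
| WhileFalse: "aval b s = 0 \<Longrightarrow> exec (While b c) s (1 + acost b s) s"
| WhileTrue: "aval b s \<noteq> 0 \<Longrightarrow> exec c s t s' \<Longrightarrow> exec (While b c) s' t' s'' \<Longrightarrow>
    exec (While b c) s (1 + acost b s + t + t') s''"

text \<open>
  The input is placed in array 0, with its length in register 0; all other cells are 0.  The
  output is read from array 1, with its length in register 0.
\<close>

definition initial_store :: "nat list \<Rightarrow> store" where
  "initial_store xs = \<lparr>
     reg = (\<lambda>x. if x = 0 then length xs else 0),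
     arr = (\<lambda>a i. if a = 0 \<and> i < length xs then xs ! i else 0)\<rparr>"

definition output_of :: "store \<Rightarrow> nat list" where
  "output_of s = map (arr s 1) [0..<reg s 0]"

definition computes_within :: "com \<Rightarrow> nat list \<Rightarrow> nat list \<Rightarrow> nat \<Rightarrow> bool" where
  "computes_within c xs ys b \<longleftrightarrow>
     (\<exists>t s. exec c (initial_store xs) t s \<and> t \<le> b \<and> output_of s = ys)"


section \<open>Kernels and parameterized running times\<close>

text \<open>
  \<open>\<Delta>\<close> is any positive upper bound on the maximum degree.  The programs, the polynomials and the
  constants below do not depend on it.  The instance produced by a kernel
  again belongs to the restricted problem.
\<close>

definition is_kernel :: "com \<Rightarrow> (nat \<Rightarrow> nat \<Rightarrow> nat) \<Rightarrow> bool" where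
  "is_kernel c f \<longleftrightarrow> (\<exists>p :: nat poly. \<forall>\<Delta> \<ge> 1. \<forall>I. ts_bipartite_instance \<Delta> I \<longrightarrow>
     (\<exists>J. computes_within c (encode I) (encode J) (poly p (input_size I)) \<and>
          ts_bipartite_instance \<Delta> J \<and> (ts_yes J \<longleftrightarrow> ts_yes I) \<and>
          num_vertices J \<le> f (num_tokens I) \<Delta>))"

definition solves_in_ostar_time :: "com \<Rightarrow> (nat \<Rightarrow> nat \<Rightarrow> nat) \<Rightarrow> bool" where
  "solves_in_ostar_time c g \<longleftrightarrow> (\<exists>p :: nat poly. \<forall>\<Delta> \<ge> 1. \<forall>I. ts_bipartite_instance \<Delta> I \<longrightarrow>
     computes_within c (encode I) [of_bool (ts_yes I)]
       (poly p (input_size I) * g (num_tokens I) \<Delta>))"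

end

theory Submission
  imports Defs "HOL-Library.Nat_Bijection"
begin

text \<open>
  Let \<open>X\<close> be the closed neighbourhood of the \<open>2 k\<close> given vertices. A large component \<open>H\<close> of the graph
  without \<open>X\<close> behaves like a reservoir: tokens inside \<open>H\<close> that are pairwise at distance at least three
  can be moved to any other such position, so that a token next to \<open>H\<close> can always be hidden in \<open>H\<close>, and
  a token can leave \<open>H\<close> wherever this is not blocked from outside. Only the adjacencies between \<open>X\<close> and
  \<open>H\<close> matter for this, and hence \<open>H\<close> may be replaced by a path with \<open>O(k \<Delta>\<^sup>3)\<close> vertices. As there are at
  most \<open>2 k \<Delta>\<^sup>2\<close> components next to \<open>X\<close>, this yields the kernel. Breadth-first search through the
  independent sets of size \<open>k\<close> of the kernel visits at most \<open>(36 k\<^sup>2 \<Delta>\<^sup>5)\<^sup>k / k!\<close> sets, and \<open>36\<^sup>k / k!\<close>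
  is bounded.
\<close>

section \<open>Polynomial-time subprograms\<close>

text \<open>For a token in a large component only the component is remembered, not its position;
  this is sound because tokens at pairwise distance at least three can be rearranged by
  \<open>jump\<close>. The argument is needed in the original graph and in the reduced one, so it is
  proved once, for abstract connected \<open>holes\<close> with enough room, and used in both
  directions. The replacement must also respect the degree bound: an inner vertex of a path has
  degree two, or three with an attached vertex, and an edge count (\<open>degree_large\<close>)
  shows that \<open>D\<close> is large enough whenever this happens. The program is not given
  \<open>\<Delta>\<close>; it uses the maximum degree \<open>D\<close> of its input, or 1. Each of
  the at most \<open>2 k D^2\<close> components keeps at most \<open>16 k D^3\<close> vertices,
  which makes \<open>32 k^2 D^5\<close>; another \<open>4 k^2 D^5\<close> pays for \<open>X\<close>.
  The kernel program is not written by hand: its output is a formula over the input array, and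
  closure lemmas for \<open>pt\<close> turn such formulas into programs. The division by
  \<open>k!\<close> in the running time matters because \<open>36^k\<close> is not polynomially
  bounded in the input size.\<close>

lemma while_exec:
  assumes body: "\<And>j s. I j s \<Longrightarrow> aval g s \<noteq> 0 \<Longrightarrow>
      j < J \<and> (\<exists>t s'. exec c s t s' \<and> t \<le> \<tau> \<and> I (Suc j) s')"
    and guard: "\<And>j s. I j s \<Longrightarrow> acost g s \<le> \<kappa>"
    and "I j s" "j \<le> J"
  shows "\<exists>t s' j'. exec (While g c) s t s' \<and> aval g s' = 0 \<and> I j' s' \<and>
           t \<le> (J - j) * (1 + \<kappa> + \<tau>) + 1 + \<kappa>"
  using assms(3,4)
proof (induction "J - j" arbitrary: j s rule: less_induct)
  case less
  show ?case
  proof (cases "aval g s = 0")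
    case True
    then have "exec (While g c) s (1 + acost g s) s" by (rule WhileFalse)
    moreover have "acost g s \<le> \<kappa>" using guard less.prems by blast
    ultimately show ?thesis using True less.prems(1) by (intro exI[of _ "1 + acost g s"] exI[of _ s] exI[of _ j]) auto
  next
    case False
    with body[OF less.prems(1)] obtain t s' where j: "j < J" and e: "exec c s t s'" "t \<le> \<tau>" "I (Suc j) s'"
      by blast
    from less.hyps[of "Suc j" s'] j e(3) obtain t' s'' j' where
      w: "exec (While g c) s' t' s''" "aval g s'' = 0" "I j' s''" "t' \<le> (J - Suc j) * (1 + \<kappa> + \<tau>) + 1 + \<kappa>"
      by (metis Suc_leI diff_less_mono2 lessI)
    have "exec (While g c) s (1 + acost g s + t + t') s''"
      using False e(1) w(1) by (rule WhileTrue)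
    moreover have "1 + acost g s + t + t' \<le> (J - j) * (1 + \<kappa> + \<tau>) + 1 + \<kappa>"
    proof -
      have "J - j = Suc (J - Suc j)" using j by simp
      then show ?thesis using guard[OF less.prems(1)] e(2) w(4) by simp
    qed
    ultimately show ?thesis using w by blast
  qed
qed

text \<open>
  Running times are bounded by powers of a number \<open>b\<close> that dominates the bit lengths of all operands
  and the number of vertices, which is stored at index 0 of the input \<open>i\<close>. As values may have \<open>b\<^sup>m\<close>
  bits, polynomial-time functions can be composed.
\<close>

definition fits :: "nat \<Rightarrow> (nat \<Rightarrow> nat) \<Rightarrow> (nat \<Rightarrow> nat) \<Rightarrow> nat \<Rightarrow> bool" where
  "fits q e i b \<longleftrightarrow> 2 \<le> b \<and> i 0 \<le> b \<and> (\<forall>x<q. e x < 2 ^ b) \<and> (\<forall>j. i j < 2 ^ b)"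

text \<open>Stack discipline: the result goes to register \<open>r\<close>, everything below
  \<open>r\<close> survives, and registers and arrays from \<open>r\<close> on are scratch space.
  The input array 0 survives because programs are only requested for \<open>r\<close> at least
  1.\<close>

definition computes :: "nat \<Rightarrow> com \<Rightarrow> nat \<Rightarrow> ((nat \<Rightarrow> nat) \<Rightarrow> (nat \<Rightarrow> nat) \<Rightarrow> nat) \<Rightarrow> bool" where
  "computes r c m f \<longleftrightarrow> (\<forall>s b. fits r (reg s) (arr s 0) b \<longrightarrow>
     (\<exists>t s'. exec c s t s' \<and> t \<le> b ^ m \<and> reg s' r = f (reg s) (arr s 0) \<and>
        (\<forall>x<r. reg s' x = reg s x) \<and> (\<forall>a<r. arr s' a = arr s a)))"

text \<open>The free variables of a formula live in the registers below \<open>q\<close>. A bound on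
  the bit length belongs to the notion because the value of one function is an operand of the next,
  and a program for every large \<open>r\<close> leaves room for intermediate results.\<close>

definition pt :: "nat \<Rightarrow> ((nat \<Rightarrow> nat) \<Rightarrow> (nat \<Rightarrow> nat) \<Rightarrow> nat) \<Rightarrow> bool" where
  "pt q f \<longleftrightarrow> (\<forall>e e' i. (\<forall>x<q. e x = e' x) \<longrightarrow> f e i = f e' i) \<and>
     (\<exists>m. \<forall>e i b. fits q e i b \<longrightarrow> f e i < 2 ^ (b ^ m)) \<and>
     (\<forall>r \<ge> max q 1. \<exists>c m. computes r c m f)"

abbreviation ptb :: "nat \<Rightarrow> ((nat \<Rightarrow> nat) \<Rightarrow> (nat \<Rightarrow> nat) \<Rightarrow> bool) \<Rightarrow> bool" where
  "ptb q P \<equiv> pt q (\<lambda>e i. of_bool (P e i))"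

lemma pt_cong_regs: "pt q f \<Longrightarrow> (\<And>x. x < q \<Longrightarrow> e x = e' x) \<Longrightarrow> f e i = f e' i"
  unfolding pt_def by blast

lemma pt_value: "pt q f \<Longrightarrow> \<exists>m. \<forall>e i b. fits q e i b \<longrightarrow> f e i < 2 ^ (b ^ m)"
  unfolding pt_def by blast

lemma pt_computes: "pt q f \<Longrightarrow> q \<le> r \<Longrightarrow> 1 \<le> r \<Longrightarrow> \<exists>c m. computes r c m f"
  unfolding pt_def by simp

lemma computesD:
  assumes "computes r c m f" "fits r (reg s) (arr s 0) b"
  obtains t s' where "exec c s t s'" "t \<le> b ^ m" "reg s' r = f (reg s) (arr s 0)"
    "\<And>x. x < r \<Longrightarrow> reg s' x = reg s x" "\<And>a. a < r \<Longrightarrow> arr s' a = arr s a"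
  using assms unfolding computes_def by blast

lemma fits_mono: "fits q' e i b \<Longrightarrow> q \<le> q' \<Longrightarrow> fits q e i b"
  unfolding fits_def by auto

lemma fits_weaken:
  assumes "fits q e i b" "b \<le> b'" shows "fits q e i b'"
proof -
  have "(2::nat) ^ b \<le> 2 ^ b'" using assms(2) by (rule power_increasing) simp
  then show ?thesis using assms unfolding fits_def by (auto intro: less_le_trans)
qed

lemma pt_mono:
  assumes "pt q f" "q \<le> q'"
  shows "pt q' f"
proof -
  have "\<exists>m. \<forall>e i b. fits q' e i b \<longrightarrow> f e i < 2 ^ (b ^ m)"
    using pt_value[OF assms(1)] fits_mono[OF _ assms(2)] by blast
  then show ?thesis using assms unfolding pt_def by auto
qed

lemma floorlog_le_pow: "x < 2 ^ b \<Longrightarrow> floorlog 2 x \<le> b"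
  by (rule floorlog_leI) auto

lemma nat_le_pow2: "2 \<le> b \<Longrightarrow> (c::nat) \<le> b ^ c"
  using less_exp[of c] power_mono[of 2 b c] by linarith

lemma nat_less_pow2: "c \<le> b \<Longrightarrow> (c::nat) < 2 ^ b"
  by (rule le_less_trans[of _ b]) (auto simp: less_exp)

text \<open>As \<open>b\<close> is at least 2, constant factors and summands can be absorbed into
  the exponent; most cost estimates below end this way.\<close>

lemma poly_bound:
  assumes "2 \<le> b" shows "c * b ^ m + d \<le> (b::nat) ^ (c + d + m)"
proof -
  have "d \<le> d * b ^ m" using assms by simp
  then have "c * b ^ m + d \<le> (c + d) * b ^ m" by (simp add: algebra_simps)
  also have "\<dots> \<le> b ^ (c + d) * b ^ m" using nat_le_pow2[OF assms] by (rule mult_right_mono) simp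
  finally show ?thesis by (simp add: power_add)
qed

lemma ptI:
  assumes "\<And>e e' i. (\<And>x. x < q \<Longrightarrow> e x = e' x) \<Longrightarrow> f e i = f e' i"
    and "\<exists>m. \<forall>e i b. fits q e i b \<longrightarrow> f e i < 2 ^ (b ^ m)"
    and "\<And>r. q \<le> r \<Longrightarrow> 1 \<le> r \<Longrightarrow> \<exists>c m. computes r c m f"
  shows "pt q f"
  unfolding pt_def
proof (intro conjI allI impI)
  show "f e i = f e' i" if "\<forall>x<q. e x = e' x" for e e' i using that by (intro assms(1)) simp
  show "\<exists>c m. computes r c m f" if "max q 1 \<le> r" for r using that by (intro assms(3)) simp_all
qed (rule assms(2))

lemma run_witness:
  assumes "exec c s t s'" "t \<le> B" "reg s' r = v" "\<And>x. x < r \<Longrightarrow> reg s' x = reg s x"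
    "\<And>a. a < r \<Longrightarrow> arr s' a = arr s a"
  shows "\<exists>t s'. exec c s t s' \<and> t \<le> B \<and> reg s' r = v \<and>
    (\<forall>x<r. reg s' x = reg s x) \<and> (\<forall>a<r. arr s' a = arr s a)"
  using assms by blast

lemma pow_mono_exp: "2 \<le> b \<Longrightarrow> m \<le> m' \<Longrightarrow> b ^ m \<le> (b::nat) ^ m'"
  by (rule power_increasing) auto

section \<open>Closure of polynomial time under elementary operations\<close>

lemma pt_var:
  assumes "x < q" shows "pt q (\<lambda>e i. e x)"
proof (rule ptI)
  show "\<exists>m. \<forall>e i b. fits q e i b \<longrightarrow> e x < 2 ^ (b ^ m)"
    using assms by (intro exI[of _ 1]) (auto simp: fits_def)
  fix r assume "q \<le> r"
  have "computes r (Assign r (Reg x)) 4 (\<lambda>e i. e x)"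
    unfolding computes_def
  proof (intro allI impI)
    fix s :: store and b assume f: "fits r (reg s) (arr s 0) b"
    then have "reg s x < 2 ^ b" using \<open>q \<le> r\<close> assms by (auto simp: fits_def)
    then have "floorlog 2 (reg s x) \<le> b" by (rule floorlog_le_pow)
    then have "1 + acost (Reg x) s \<le> b + 2" by simp
    also have "\<dots> \<le> b ^ 4"
      using poly_bound[of b 1 1 2] f by (simp add: fits_def numeral_eq_Suc)
    finally have le: "1 + acost (Reg x) s \<le> b ^ 4" .
    show "\<exists>t s'. exec (Assign r (Reg x)) s t s' \<and> t \<le> b ^ 4 \<and> reg s' r = reg s x \<and>
        (\<forall>x<r. reg s' x = reg s x) \<and> (\<forall>a<r. arr s' a = arr s a)"
      by (rule run_witness[OF exec.Assign le]) auto
  qed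
  then show "\<exists>c m. computes r c m (\<lambda>e i. e x)" by blast
qed (use assms in auto)

lemma pt_const: "pt q (\<lambda>e i. c)"
proof (rule ptI)
  have "c < 2 ^ (b ^ c)" if "fits q e i b" for e i b
    using that nat_le_pow2[of b c] by (intro nat_less_pow2) (auto simp: fits_def)
  then show "\<exists>m. \<forall>e i b. fits q e i b \<longrightarrow> c < 2 ^ (b ^ m)" by blast
  fix r
  have "computes r (Assign r (Const c)) (c + 2) (\<lambda>e i. c)"
    unfolding computes_def
  proof (intro allI impI)
    fix s :: store and b assume f: "fits r (reg s) (arr s 0) b"
    have "floorlog 2 c \<le> c" by (intro floorlog_le_pow less_exp)
    then have le: "1 + acost (Const c) s \<le> b ^ (c + 2)"
      using nat_le_pow2[of b "c+2"] f by (simp add: fits_def)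
    show "\<exists>t s'. exec (Assign r (Const c)) s t s' \<and> t \<le> b ^ (c + 2) \<and> reg s' r = c \<and>
        (\<forall>x<r. reg s' x = reg s x) \<and> (\<forall>a<r. arr s' a = arr s a)"
      by (rule run_witness[OF exec.Assign le]) auto
  qed
  then show "\<exists>c' m. computes r c' m (\<lambda>e i. c)" by blast
qed auto

lemma pt_read:
  assumes f: "pt q f"
  shows "pt q (\<lambda>e i. i (f e i))"
proof (rule ptI)
  show "i (f e i) = i (f e' i)" if "\<And>x. x < q \<Longrightarrow> e x = e' x" for e e' i
    using pt_cong_regs[OF f, of e e'] that by simp
  show "\<exists>m. \<forall>e i b. fits q e i b \<longrightarrow> i (f e i) < 2 ^ (b ^ m)"
    by (intro exI[of _ 1]) (auto simp: fits_def)
  fix r assume r: "q \<le> r" "1 \<le> r"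
  from pt_value[OF f] obtain mv where mv: "\<And>e i b. fits q e i b \<Longrightarrow> f e i < 2 ^ (b ^ mv)" by blast
  from pt_computes[OF f r] obtain c m where c: "computes r c m f" by blast
  let ?c = "Seq c (Assign r (Arr 0 (Reg r)))"
  have "computes r ?c (3 + 3 + (m + mv + 1)) (\<lambda>e i. i (f e i))"
    unfolding computes_def
  proof (intro allI impI)
    fix s :: store and b assume fit: "fits r (reg s) (arr s 0) b"
    then have b: "2 \<le> b" by (simp add: fits_def)
    from computesD[OF c fit] obtain t s' where e: "exec c s t s'" "t \<le> b ^ m"
      "reg s' r = f (reg s) (arr s 0)" "\<And>x. x < r \<Longrightarrow> reg s' x = reg s x"
      "\<And>a. a < r \<Longrightarrow> arr s' a = arr s a" by metis
    have "reg s' r < 2 ^ (b ^ mv)" using e(3) mv fits_mono[OF fit r(1)] by simp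
    then have l1: "floorlog 2 (reg s' r) \<le> b ^ mv" by (rule floorlog_le_pow)
    have "arr s' 0 (reg s' r) < 2 ^ b" using e(5)[of 0] r fit by (auto simp: fits_def)
    then have l2: "floorlog 2 (arr s' 0 (reg s' r)) \<le> b" by (rule floorlog_le_pow)
    have p: "b ^ m \<le> b ^ (m + mv + 1)" "b ^ mv \<le> b ^ (m + mv + 1)" "b \<le> b ^ (m + mv + 1)"
      using pow_mono_exp[OF b, of 1 "m + mv + 1"] by (auto intro: pow_mono_exp[OF b] simp del: power_Suc)
    have "t + (1 + acost (Arr 0 (Reg r)) s') \<le> 3 * b ^ (m + mv + 1) + 3"
      using e(2) l1 l2 p unfolding acost.simps aval.simps by linarith
    also have "\<dots> \<le> b ^ (3 + 3 + (m + mv + 1))" by (rule poly_bound[OF b])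
    finally have le: "t + (1 + acost (Arr 0 (Reg r)) s') \<le> b ^ (3 + 3 + (m + mv + 1))" .
    show "\<exists>t s'. exec ?c s t s' \<and> t \<le> b ^ (3 + 3 + (m + mv + 1)) \<and>
        reg s' r = arr s 0 (f (reg s) (arr s 0)) \<and> (\<forall>x<r. reg s' x = reg s x) \<and> (\<forall>a<r. arr s' a = arr s a)"
      by (rule run_witness[OF exec.Seq[OF e(1) exec.Assign] le]) (use e(3-5) r in auto)
  qed
  then show "\<exists>c m. computes r c m (\<lambda>e i. i (f e i))" by blast
qed

text \<open>The second conjunct makes bit lengths at most additive. Even a product of
  \<open>i 0\<close> factors then has polynomially many bits, which \<open>pt_fold\<close>
  exploits.\<close>

definition binop :: "(aexp \<Rightarrow> aexp \<Rightarrow> aexp) \<Rightarrow> (nat \<Rightarrow> nat \<Rightarrow> nat) \<Rightarrow> bool" where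
  "binop F op \<longleftrightarrow> (\<forall>e f s. aval (F e f) s = op (aval e s) (aval f s) \<and>
      acost (F e f) s = acost e s + acost f s + 1 + floorlog 2 (aval (F e f) s)) \<and>
    (\<forall>x y a b. x < 2 ^ a \<longrightarrow> y < 2 ^ b \<longrightarrow> 1 \<le> a \<longrightarrow> 1 \<le> b \<longrightarrow> op x y < 2 ^ (a + b))"

lemma pt_binop:
  assumes F: "binop F op" and f: "pt q f" and g: "pt q g"
  shows "pt q (\<lambda>e i. op (f e i) (g e i))"
proof (rule ptI)
  show "op (f e i) (g e i) = op (f e' i) (g e' i)" if "\<And>x. x < q \<Longrightarrow> e x = e' x" for e e' i
    using pt_cong_regs[OF f, of e e'] pt_cong_regs[OF g, of e e'] that by metis
  from pt_value[OF f] obtain mf where mf: "\<And>e i b. fits q e i b \<Longrightarrow> f e i < 2 ^ (b ^ mf)" by blast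
  from pt_value[OF g] obtain mg where mg: "\<And>e i b. fits q e i b \<Longrightarrow> g e i < 2 ^ (b ^ mg)" by blast
  define mv where "mv = mf + mg + 1"
  have val: "f e i < 2 ^ (b ^ mv)" "g e i < 2 ^ (b ^ mv)" "op (f e i) (g e i) < 2 ^ (2 * b ^ mv)"
    if fit: "fits q e i b" for e i b
  proof -
    have b: "2 \<le> b" using fit by (simp add: fits_def)
    have "b ^ mf \<le> b ^ mv" "b ^ mg \<le> b ^ mv"
      using b power_increasing[of mf mv b] power_increasing[of mg mv b] by (auto simp: mv_def)
    then have "(2::nat) ^ b ^ mf \<le> 2 ^ b ^ mv" "(2::nat) ^ b ^ mg \<le> 2 ^ b ^ mv" by auto
    then show x: "f e i < 2 ^ (b ^ mv)" and y: "g e i < 2 ^ (b ^ mv)"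
      using mf[OF fit] mg[OF fit] by (meson less_le_trans)+
    have one: "1 \<le> b ^ mv" using b by simp
    have "op (f e i) (g e i) < 2 ^ (b ^ mv + b ^ mv)" using F x y one unfolding binop_def by metis
    then show "op (f e i) (g e i) < 2 ^ (2 * b ^ mv)" by (simp add: mult_2)
  qed
  have "op (f e i) (g e i) < 2 ^ (b ^ Suc mv)" if fit: "fits q e i b" for e i b
  proof -
    have "2 * b ^ mv \<le> b ^ Suc mv" using fit by (auto simp: fits_def)
    then have "(2::nat) ^ (2 * b ^ mv) \<le> 2 ^ (b ^ Suc mv)" by auto
    then show ?thesis using val(3)[OF fit] by linarith
  qed
  then show "\<exists>m. \<forall>e i b. fits q e i b \<longrightarrow> op (f e i) (g e i) < 2 ^ (b ^ m)" by blast
  fix r assume r: "q \<le> r" "1 \<le> r"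
  from pt_computes[OF f r] obtain cf m1 where cf: "computes r cf m1 f" by blast
  from pt_computes[OF g, of "Suc r"] r obtain cg m2 where cg: "computes (Suc r) cg m2 g" by auto
  let ?c = "Seq cf (Seq cg (Assign r (F (Reg r) (Reg (Suc r)))))"
  let ?M = "m1 + mv * m2 + mv"
  have "computes r ?c (6 + 4 + ?M) (\<lambda>e i. op (f e i) (g e i))"
    unfolding computes_def
  proof (intro allI impI)
    fix s :: store and b assume fit: "fits r (reg s) (arr s 0) b"
    then have b: "2 \<le> b" by (simp add: fits_def)
    note fitq = fits_mono[OF fit r(1)]
    from computesD[OF cf fit] obtain t s1 where e1: "exec cf s t s1" "t \<le> b ^ m1"
      "reg s1 r = f (reg s) (arr s 0)" "\<And>x. x < r \<Longrightarrow> reg s1 x = reg s x"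
      "\<And>a. a < r \<Longrightarrow> arr s1 a = arr s a" by metis
    have arr0: "arr s1 0 = arr s 0" using e1(5) r by simp
    have bb: "b \<le> b ^ mv" using b by (auto simp: mv_def intro!: self_le_power)
    \<comment> \<open>The value of \<open>f\<close> now sits in register \<open>r\<close> and may
      have \<open>b ^ mv\<close> bits, so the program for \<open>g\<close> runs with this larger
      bound.\<close>
    have "fits (Suc r) (reg s1) (arr s1 0) (b ^ mv)"
      using fits_weaken[OF fit bb] e1(3,4) val(1)[OF fitq] arr0
      unfolding fits_def by (auto simp: less_Suc_eq)
    from computesD[OF cg this] obtain t' s2 where e2: "exec cg s1 t' s2" "t' \<le> (b ^ mv) ^ m2"
      "reg s2 (Suc r) = g (reg s1) (arr s1 0)" "\<And>x. x < Suc r \<Longrightarrow> reg s2 x = reg s1 x"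
      "\<And>a. a < Suc r \<Longrightarrow> arr s2 a = arr s1 a" by metis
    have geq: "g (reg s1) (arr s1 0) = g (reg s) (arr s 0)"
      unfolding arr0 using e1(4) r by (intro pt_cong_regs[OF g]) auto
    have res: "aval (F (Reg r) (Reg (Suc r))) s2 = op (f (reg s) (arr s 0)) (g (reg s) (arr s 0))"
      using F e2(3) e2(4)[of r] e1(3) geq unfolding binop_def by simp
    have l: "floorlog 2 (f (reg s) (arr s 0)) \<le> b ^ mv" "floorlog 2 (g (reg s) (arr s 0)) \<le> b ^ mv"
      "floorlog 2 (op (f (reg s) (arr s 0)) (g (reg s) (arr s 0))) \<le> 2 * b ^ mv"
      using val[OF fitq] by (auto intro: floorlog_le_pow)
    have co: "acost (F (Reg r) (Reg (Suc r))) s2 \<le> 4 * b ^ mv + 3"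
    proof -
      have a: "reg s2 r = f (reg s) (arr s 0)" "reg s2 (Suc r) = g (reg s) (arr s 0)"
        using e2(3,4) e1(3) geq by auto
      have "acost (F (Reg r) (Reg (Suc r))) s2 = acost (Reg r) s2 + acost (Reg (Suc r)) s2 + 1
          + floorlog 2 (op (f (reg s) (arr s 0)) (g (reg s) (arr s 0)))"
        using F res unfolding binop_def by metis
      then show ?thesis using l unfolding acost.simps aval.simps a by linarith
    qed
    have p: "b ^ m1 \<le> b ^ ?M" "(b ^ mv) ^ m2 \<le> b ^ ?M" "b ^ mv \<le> b ^ ?M"
      unfolding power_mult[symmetric] by (intro pow_mono_exp[OF b]; simp)+
    have "t + (t' + (1 + acost (F (Reg r) (Reg (Suc r))) s2)) \<le> 6 * b ^ ?M + 4"
      using e1(2) e2(2) co p by linarith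
    also have "\<dots> \<le> b ^ (6 + 4 + ?M)" by (rule poly_bound[OF b])
    finally have le: "t + (t' + (1 + acost (F (Reg r) (Reg (Suc r))) s2)) \<le> b ^ (6 + 4 + ?M)" .
    show "\<exists>t s'. exec ?c s t s' \<and> t \<le> b ^ (6 + 4 + ?M) \<and>
        reg s' r = op (f (reg s) (arr s 0)) (g (reg s) (arr s 0)) \<and>
        (\<forall>x<r. reg s' x = reg s x) \<and> (\<forall>a<r. arr s' a = arr s a)"
      by (rule run_witness[OF exec.Seq[OF e1(1) exec.Seq[OF e2(1) exec.Assign]] le])
        (use e1(4,5) e2(4,5) res r in auto)
  qed
  then show "\<exists>c m. computes r c m (\<lambda>e i. op (f e i) (g e i))" by blast
qed

lemma two_pow_add:
  assumes "x < 2 ^ a" "y < 2 ^ b" "1 \<le> a" "1 \<le> b"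
  shows "(x::nat) + y < 2 ^ (a + b)" "x * y < 2 ^ (a + b)" "x < 2 ^ (a + b)"
proof -
  have A: "(2::nat) \<le> 2 ^ a" "(2::nat) \<le> 2 ^ b" using assms by (auto intro: self_le_power)
  have "2 * 2 ^ b \<le> (2::nat) ^ a * 2 ^ b" "2 ^ a * 2 \<le> (2::nat) ^ a * 2 ^ b"
    using A by (intro mult_le_mono; simp)+
  then have "(2::nat) ^ a + 2 ^ b \<le> 2 ^ a * 2 ^ b" by linarith
  then show "x + y < 2 ^ (a + b)" using assms by (simp add: power_add)
  show "x * y < 2 ^ (a + b)" using mult_strict_mono'[OF assms(1,2)] by (simp add: power_add)
  have "(2::nat) ^ a \<le> 2 ^ (a + b)" by (rule power_increasing) auto
  then show "x < 2 ^ (a + b)" using assms by linarith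
qed

lemma binops:
  "binop Add (+)" "binop Sub (-)" "binop Mul (*)" "binop Div (div)"
  "binop Less (\<lambda>x y. of_bool (x < y))"
proof -
  have "of_bool P < (2::nat) ^ (a + b)" if "1 \<le> a" for P and a b :: nat
    using that one_less_power[of "2::nat" "a + b"] by auto
  then show "binop Add (+)" "binop Sub (-)" "binop Mul (*)" "binop Div (div)"
    "binop Less (\<lambda>x y. of_bool (x < y))"
    unfolding binop_def
    using two_pow_add le_less_trans[OF diff_le_self] le_less_trans[OF div_le_dividend]
    by (simp_all del: of_bool_less_iff)
qed

lemmas pt_add = pt_binop[OF binops(1)]
  and pt_diff = pt_binop[OF binops(2)]
  and pt_mult = pt_binop[OF binops(3)]
  and pt_div = pt_binop[OF binops(4)]
  and ptb_less = pt_binop[OF binops(5)]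

section \<open>Bounded primitive recursion\<close>

lemma loop_cost:
  fixes b n t x y P t' :: nat
  assumes "2 \<le> b" "n \<le> b" "t \<le> P \<and> 1 \<le> P" "x \<le> P" "y \<le> P"
    and t': "t' \<le> n * (1 + (3 * y + 5) + (x + 3 * y + 9)) + 1 + (3 * y + 5)"
  shows "t + (2 + t') \<le> b ^ 5 * (P * b)"
proof -
  have "n * (1 + (3 * y + 5) + (x + 3 * y + 9)) \<le> b * (22 * P)"
    using assms by (intro mult_le_mono) auto
  then have "t + (2 + t') \<le> b * (22 * P) + 12 * P" using assms by linarith
  also have "\<dots> \<le> b * (22 * P) + b * (6 * P)"
    using mult_le_mono1[OF assms(1), of "6 * P"] by simp
  also have "\<dots> \<le> 2 ^ 5 * (P * b)" by (simp add: algebra_simps)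
  also have "\<dots> \<le> b ^ 5 * (P * b)" using assms(1) by (intro mult_le_mono1 power_mono) auto
  finally show ?thesis .
qed

text \<open>The bound \<open>val\<close> has to be assumed: squaring \<open>i 0\<close> times is a
  polynomial-time step iterated often enough to produce exponentially many bits. The assumption on
  \<open>g\<close> ranges over all argument functions \<open>h\<close>, \<open>h'\<close> and all
  larger \<open>q'\<close>, so that the bound variables of a formula can be kept in any fresh
  registers.\<close>

lemma pt_rec:
  assumes f: "pt q f"
    and g: "\<And>q' h h'. q \<le> q' \<Longrightarrow> pt q' h \<Longrightarrow> pt q' h' \<Longrightarrow> pt q' (\<lambda>e i. g e i (h e i) (h' e i))"
    and val: "\<exists>m. \<forall>e i b j. fits q e i b \<longrightarrow> j \<le> i 0 \<longrightarrow> rec_nat (f e i) (g e i) j < 2 ^ (b ^ m)"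
  shows "pt q (\<lambda>e i. rec_nat (f e i) (g e i) (i 0))"
proof (rule ptI)
  have gdep: "g e i x v = g e' i x v" if "\<And>x. x < q \<Longrightarrow> e x = e' x" for e e' i x v
    using pt_cong_regs[OF g[OF order.refl pt_const pt_const], of e e'] that by simp
  have dep: "rec_nat (f e i) (g e i) j = rec_nat (f e' i) (g e' i) j"
    if "\<And>x. x < q \<Longrightarrow> e x = e' x" for e e' i j
    by (induction j) (use pt_cong_regs[OF f, of e e'] gdep[of e e'] that in auto)
  then show "rec_nat (f e i) (g e i) (i 0) = rec_nat (f e' i) (g e' i) (i 0)"
    if "\<And>x. x < q \<Longrightarrow> e x = e' x" for e e' i using that by blast
  from val obtain mv where mv:
    "\<And>e i b j. fits q e i b \<Longrightarrow> j \<le> i 0 \<Longrightarrow> rec_nat (f e i) (g e i) j < 2 ^ (b ^ mv)" by blast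
  then show "\<exists>m. \<forall>e i b. fits q e i b \<longrightarrow> rec_nat (f e i) (g e i) (i 0) < 2 ^ (b ^ m)" by blast
  fix r assume r: "q \<le> r" "1 \<le> r"
  from pt_computes[OF f r] obtain cf m1 where cf: "computes r cf m1 f" by blast
  \<comment> \<open>Register \<open>r\<close> holds the current value, \<open>r + 1\<close> the
    counter, and \<open>r + 2\<close> receives the next value.\<close>
  let ?G = "\<lambda>e i. g e i (e (r + 1)) (e r)"
  have "pt (r + 2) ?G" using r by (intro g pt_var) auto
  from pt_computes[OF this, of "r + 2"] obtain cg m2 where cg: "computes (r + 2) cg m2 ?G" by auto
  let ?guard = "Less (Reg (r + 1)) (Arr 0 (Const 0))"
  let ?A1 = "Assign r (Reg (r + 2))" and ?A2 = "Assign (r + 1) (Add (Reg (r + 1)) (Const 1))"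
  let ?body = "Seq cg (Seq ?A1 ?A2)"
  let ?c = "Seq cf (Seq (Assign (r + 1) (Const 0)) (While ?guard ?body))"
  define v where "v = Suc mv"
  let ?M = "m1 + (v * m2 + v)"
  have "computes r ?c (6 + ?M) (\<lambda>e i. rec_nat (f e i) (g e i) (i 0))"
    unfolding computes_def
  proof (intro allI impI)
    fix s :: store and b assume fit: "fits r (reg s) (arr s 0) b"
    then have b: "2 \<le> b" by (simp add: fits_def)
    note fitq = fits_mono[OF fit r(1)]
    define i where "i = arr s 0"
    define n where "n = i 0"
    define val where "val j = rec_nat (f (reg s) i) (g (reg s) i) j" for j
    have n: "n \<le> b" using fit by (simp add: fits_def n_def i_def)
    have bv: "b \<le> b ^ v" and vv: "b ^ mv \<le> b ^ v"
      using pow_mono_exp[OF b, of 1 v] pow_mono_exp[OF b, of mv v] by (simp_all add: v_def)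
    have val_less: "val j < 2 ^ (b ^ v)" if "j \<le> n" for j
    proof -
      have "val j < 2 ^ (b ^ mv)" using mv[OF fitq, of j] that by (simp add: val_def n_def i_def)
      also have "(2::nat) ^ (b ^ mv) \<le> 2 ^ (b ^ v)" using vv by auto
      finally show ?thesis .
    qed
    define I where "I j s' \<longleftrightarrow> j \<le> n \<and> reg s' (r + 1) = j \<and> reg s' r = val j \<and>
      (\<forall>x<r. reg s' x = reg s x) \<and> (\<forall>a<r. arr s' a = arr s a)" for j and s' :: store
    from computesD[OF cf fit] obtain t s1 where e1: "exec cf s t s1" "t \<le> b ^ m1"
      "reg s1 r = f (reg s) (arr s 0)" "\<And>x. x < r \<Longrightarrow> reg s1 x = reg s x"
      "\<And>a. a < r \<Longrightarrow> arr s1 a = arr s a" by metis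
    define s2 where "s2 = s1\<lparr>reg := (reg s1)(r + 1 := aval (Const 0) s1)\<rparr>"
    have "exec (Assign (r + 1) (Const 0)) s1 (1 + acost (Const 0) s1) s2"
      unfolding s2_def by (rule exec.Assign)
    then have e2: "exec (Assign (r + 1) (Const 0)) s1 2 s2" by (simp add: floorlog_def numeral_2_eq_2)
    have I0: "I 0 s2" using e1(3-5) by (auto simp: I_def s2_def val_def i_def)
    have guard: "acost ?guard s' \<le> 3 * b ^ v + 5" if I: "I j s'" for j and s' :: store
    proof -
      have "floorlog 2 (arr s' 0 0) \<le> b"
        using I r fit by (intro floorlog_le_pow) (auto simp: I_def fits_def)
      moreover have "floorlog 2 (reg s' (r + 1)) \<le> b"
        using I n by (intro floorlog_le_pow nat_less_pow2) (auto simp: I_def)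
      moreover have "floorlog 2 (aval ?guard s') \<le> 1" by (intro floorlog_le_pow) auto
      ultimately show ?thesis using bv by (simp add: floorlog_def[of 2 0])
    qed
    have body: "j < n \<and> (\<exists>t s''. exec ?body s' t s'' \<and> t \<le> b ^ (v * m2) + 3 * b ^ v + 9 \<and> I (Suc j) s'')"
      if I: "I j s'" and g: "aval ?guard s' \<noteq> 0" for j and s' :: store
    proof -
      have arr0: "arr s' 0 = i" using I r by (auto simp: I_def i_def)
      have j: "j < n" using g I arr0 by (auto simp: I_def n_def)
      have "reg s' x < 2 ^ b ^ v" if x: "x < r + 2" for x
      proof -
        consider "x < r" | "x = r" | "x = r + 1" using x by linarith
        then show ?thesis
        proof cases
          case 1 then show ?thesis using I fits_weaken[OF fit bv] by (auto simp: I_def fits_def)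
        next
          case 2 then show ?thesis using I val_less by (auto simp: I_def)
        next
          case 3 then show ?thesis using I bv n by (auto simp: I_def intro!: nat_less_pow2)
        qed
      qed
      then have "fits (r + 2) (reg s') (arr s' 0) (b ^ v)"
        using fits_weaken[OF fit bv] arr0 unfolding fits_def i_def by auto
      from computesD[OF cg this] obtain t' s3 where e3: "exec cg s' t' s3" "t' \<le> (b ^ v) ^ m2"
        "reg s3 (r + 2) = ?G (reg s') (arr s' 0)" "\<And>x. x < r + 2 \<Longrightarrow> reg s3 x = reg s' x"
        "\<And>a. a < r + 2 \<Longrightarrow> arr s3 a = arr s' a" by metis
      have res: "reg s3 (r + 2) = val (Suc j)"
      proof -
        have "?G (reg s') (arr s' 0) = g (reg s) i j (val j)"
          using I arr0 gdep[of "reg s'" "reg s"] r(1) by (auto simp: I_def)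
        then show ?thesis using e3(3) by (simp add: val_def)
      qed
      define s4 where "s4 = s3\<lparr>reg := (reg s3)(r := aval (Reg (r + 2)) s3)\<rparr>"
      define s5 where "s5 = s4\<lparr>reg := (reg s4)(r + 1 := aval (Add (Reg (r + 1)) (Const 1)) s4)\<rparr>"
      have e4: "exec ?A1 s3 (1 + acost (Reg (r + 2)) s3) s4"
        unfolding s4_def by (rule exec.Assign)
      have e5: "exec ?A2 s4 (1 + acost (Add (Reg (r + 1)) (Const 1)) s4) s5"
        unfolding s5_def by (rule exec.Assign)
      have c4: "acost (Reg (r + 2)) s3 \<le> 1 + b ^ v"
        using res val_less[of "Suc j"] j by (auto intro: floorlog_le_pow)
      have r1: "reg s4 (r + 1) = j" using e3(4)[of "r + 1"] I by (auto simp: I_def s4_def)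
      have "floorlog 2 (reg s4 (r + 1)) \<le> b" "floorlog 2 (Suc j) \<le> b"
        unfolding r1 using j n by (auto intro!: floorlog_le_pow nat_less_pow2)
      then have c5: "acost (Add (Reg (r + 1)) (Const 1)) s4 \<le> 2 * b ^ v + 4"
        using r1 bv floorlog_le_pow[of 1 1] by simp
      have "exec ?body s' (t' + ((1 + acost (Reg (r + 2)) s3) + (1 + acost (Add (Reg (r + 1)) (Const 1)) s4))) s5"
        using e3(1) e4 e5 by (intro exec.Seq)
      moreover have "t' + ((1 + acost (Reg (r + 2)) s3) + (1 + acost (Add (Reg (r + 1)) (Const 1)) s4))
          \<le> b ^ (v * m2) + 3 * b ^ v + 9"
        using e3(2) c4 c5 by (simp add: power_mult)
      moreover have "I (Suc j) s5"
        unfolding I_def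
      proof (intro conjI allI impI)
        show "reg s5 (r + 1) = Suc j" using r1 by (simp add: s5_def)
        show "reg s5 r = val (Suc j)" using res by (simp add: s5_def s4_def)
        show "reg s5 x = reg s x" if "x < r" for x
          using that e3(4)[of x] I by (simp add: s5_def s4_def I_def)
        show "arr s5 a = arr s a" if "a < r" for a
          using that e3(5)[of a] I by (simp add: s5_def s4_def I_def)
      qed (use j in simp)
      ultimately show ?thesis using j by (intro conjI exI[of _ s5] exI)
    qed
    let ?\<kappa> = "3 * b ^ v + 5" and ?\<tau> = "b ^ (v * m2) + 3 * b ^ v + 9"
    have "\<exists>t s' j'. exec (While ?guard ?body) s2 t s' \<and> aval ?guard s' = 0 \<and> I j' s' \<and>
           t \<le> (n - 0) * (1 + ?\<kappa> + ?\<tau>) + 1 + ?\<kappa>"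
    proof (rule while_exec[where I = I])
      show "j < n \<and> (\<exists>t s''. exec ?body s' t s'' \<and> t \<le> ?\<tau> \<and> I (Suc j) s'')"
        if "I j s'" "aval ?guard s' \<noteq> 0" for j s'
        by (rule body[OF that])
      show "acost ?guard s' \<le> ?\<kappa>" if "I j s'" for j s' by (rule guard[OF that])
    qed (use I0 in auto)
    then obtain t3 s3 j where
      e3: "exec (While ?guard ?body) s2 t3 s3" "aval ?guard s3 = 0" "I j s3"
        "t3 \<le> n * (1 + ?\<kappa> + ?\<tau>) + 1 + ?\<kappa>" unfolding minus_nat.diff_0 by blast
    have jn: "j = n"
    proof -
      from e3(3) r have "arr s3 0 = i" "reg s3 (r + 1) = j" "j \<le> n" unfolding I_def i_def by simp_all
      then show ?thesis using e3(2) by (simp add: n_def)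
    qed
    have p: "b ^ m1 \<le> b ^ ?M" "b ^ (v * m2) \<le> b ^ ?M" "b ^ v \<le> b ^ ?M"
      by (intro pow_mono_exp[OF b]; simp)+
    have "t \<le> b ^ ?M \<and> 1 \<le> b ^ ?M"
      using le_trans[OF e1(2) p(1)] b by (intro conjI one_le_power) linarith+
    then have "t + (2 + t3) \<le> b ^ 5 * (b ^ ?M * b)" by (rule loop_cost[OF b n _ p(2,3) e3(4)])
    also have "\<dots> = b ^ (6 + ?M)" by (simp add: power_add numeral_eq_Suc ac_simps)
    finally have "t + (2 + t3) \<le> b ^ (6 + ?M)" .
    moreover have "exec ?c s (t + (2 + t3)) s3"
      using e1(1) e2 e3(1) by (intro exec.Seq)
    moreover have "reg s3 r = rec_nat (f (reg s) (arr s 0)) (g (reg s) (arr s 0)) (arr s 0 0)"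
      using e3(3) jn by (auto simp: I_def val_def n_def i_def)
    ultimately show "\<exists>t s'. exec ?c s t s' \<and> t \<le> b ^ (6 + ?M) \<and>
        reg s' r = rec_nat (f (reg s) (arr s 0)) (g (reg s) (arr s 0)) (arr s 0 0) \<and>
        (\<forall>x<r. reg s' x = reg s x) \<and> (\<forall>a<r. arr s' a = arr s a)"
      using e3(3) unfolding I_def by blast
  qed
  then show "\<exists>c m. computes r c m (\<lambda>e i. rec_nat (f e i) (g e i) (i 0))" by blast
qed

section \<open>Boolean operations, bounded sums and bounded quantifiers\<close>

lemma pt_size: "pt q (\<lambda>e i. i 0)"
  by (rule pt_read[OF pt_const])

lemma ptb_conj:
  assumes "ptb q P" "ptb q Q" shows "ptb q (\<lambda>e i. P e i \<and> Q e i)"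
  unfolding of_bool_conj using assms by (rule pt_mult)

lemma ptb_not:
  assumes "ptb q P" shows "ptb q (\<lambda>e i. \<not> P e i)"
proof -
  have "of_bool (\<not> P e i) = (1::nat) - of_bool (P e i)" for e i by simp
  then show ?thesis by (simp only:) (intro pt_diff pt_const assms)
qed

lemma ptb_disj:
  assumes "ptb q P" "ptb q Q" shows "ptb q (\<lambda>e i. P e i \<or> Q e i)"
proof -
  have "(P e i \<or> Q e i) = (\<not> (\<not> P e i \<and> \<not> Q e i))" for e i by simp
  then show ?thesis by (simp only:) (intro ptb_not ptb_conj assms)
qed

lemma ptb_imp:
  assumes "ptb q P" "ptb q Q" shows "ptb q (\<lambda>e i. P e i \<longrightarrow> Q e i)"
  unfolding imp_conv_disj by (intro ptb_not ptb_disj assms)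

lemma ptb_le:
  assumes "pt q f" "pt q g" shows "ptb q (\<lambda>e i. f e i \<le> g e i)"
  unfolding not_less[symmetric] by (intro ptb_not ptb_less assms)

lemma ptb_eq:
  assumes "pt q f" "pt q g" shows "ptb q (\<lambda>e i. f e i = g e i)"
  unfolding eq_iff by (intro ptb_conj ptb_le assms)

lemma pt_if:
  assumes "ptb q P" "pt q f" "pt q g" shows "pt q (\<lambda>e i. if P e i then f e i else g e i)"
proof -
  have "(if P e i then f e i else g e i) = of_bool (P e i) * f e i + of_bool (\<not> P e i) * g e i" for e i
    by simp
  then show ?thesis by (simp only:) (intro pt_add pt_mult ptb_not assms)
qed

lemma pt_mod:
  assumes "pt q f" "pt q g" shows "pt q (\<lambda>e i. f e i mod g e i)"
proof -
  have "f e i mod g e i = f e i - f e i div g e i * g e i" for e i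
    by (simp add: minus_div_mult_eq_mod)
  then show ?thesis by (simp only:) (intro pt_diff pt_mult pt_div assms)
qed

lemma ptb_odd:
  assumes "pt q f" shows "ptb q (\<lambda>e i. odd (f e i))"
  unfolding odd_iff_mod_2_eq_one by (intro ptb_eq pt_mod pt_const assms)

text \<open>The bound variable is turned into the free register \<open>q\<close>. It passes the test
  \<open>fits\<close> because it is at most \<open>i 0\<close>, hence at most
  \<open>b\<close>.\<close>

lemma pt_body_value:
  assumes F: "\<And>q' h. q \<le> q' \<Longrightarrow> pt q' h \<Longrightarrow> pt q' (\<lambda>e i. F e i (h e i))"
  shows "\<exists>m. \<forall>e i b x. fits q e i b \<longrightarrow> x \<le> i 0 \<longrightarrow> F e i x < 2 ^ (b ^ m)"
proof -
  have "pt (Suc q) (\<lambda>e i. F e i (e q))" by (intro F pt_var) auto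
  from pt_value[OF this] obtain m where
    m: "\<And>e i b. fits (Suc q) e i b \<Longrightarrow> F e i (e q) < 2 ^ (b ^ m)" by blast
  have "F e i x < 2 ^ (b ^ m)" if fit: "fits q e i b" and x: "x \<le> i 0" for e i b x
  proof -
    have "x < 2 ^ b" using x fit by (intro nat_less_pow2) (auto simp: fits_def)
    then have "fits (Suc q) (e(q := x)) i b" using fit by (auto simp: fits_def less_Suc_eq)
    then have "F (e(q := x)) i x < 2 ^ (b ^ m)" using m by fastforce
    moreover have "F (e(q := x)) i x = F e i x"
      by (rule pt_cong_regs[OF F[OF order.refl pt_const]]) simp
    ultimately show ?thesis by simp
  qed
  then show ?thesis by blast
qed

text \<open>Here the value bound demanded by \<open>pt_rec\<close> is automatic: bit lengths add, so
  \<open>j\<close> rounds produce at most \<open>Suc j * b ^ (m + c)\<close> bits, and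
  \<open>j\<close> is at most \<open>b\<close>.\<close>

lemma pt_fold:
  assumes op: "binop B op"
    and F: "\<And>q' h. q \<le> q' \<Longrightarrow> pt q' h \<Longrightarrow> pt q' (\<lambda>e i. F e i (h e i))"
  shows "pt q (\<lambda>e i. rec_nat c (\<lambda>x v. op v (F e i x)) (i 0))"
proof (rule pt_rec)
  show "pt q (\<lambda>e i. c)" by (rule pt_const)
  show "pt q' (\<lambda>e i. op (h' e i) (F e i (h e i)))" if "q \<le> q'" "pt q' h" "pt q' h'" for q' h h'
    by (intro pt_binop[OF op] that F)
  from pt_body_value[of q F] F obtain m where
    m: "\<And>e i b x. fits q e i b \<Longrightarrow> x \<le> i 0 \<Longrightarrow> F e i x < 2 ^ (b ^ m)" by blast
  have "rec_nat c (\<lambda>x v. op v (F e i x)) j < 2 ^ (b ^ (m + c + 2))"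
    if fit: "fits q e i b" and j: "j \<le> i 0" for e i b j
  proof -
    have b: "2 \<le> b" "i 0 \<le> b" using fit by (auto simp: fits_def)
    have one: "1 \<le> b ^ (m + c)" using b by simp
    have "rec_nat c (\<lambda>x v. op v (F e i x)) j < 2 ^ (Suc j * b ^ (m + c))"
      using j
    proof (induction j)
      case 0
      have "c < 2 ^ (b ^ c)" using nat_le_pow2[OF b(1)] by (intro nat_less_pow2)
      also have "\<dots> \<le> 2 ^ (b ^ (m + c))" using pow_mono_exp[OF b(1), of c "m + c"] by simp
      finally show ?case by simp
    next
      case (Suc j)
      have "F e i j < 2 ^ (b ^ m)" using Suc.prems by (intro m[OF fit]) simp
      also have "\<dots> \<le> 2 ^ (b ^ (m + c))" using pow_mono_exp[OF b(1), of m "m + c"] by simp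
      finally have F: "F e i j < 2 ^ (b ^ (m + c))" .
      have "1 \<le> Suc j * b ^ (m + c)" using one by (simp add: le_add1 trans_le_add1)
      then have "op (rec_nat c (\<lambda>x v. op v (F e i x)) j) (F e i j) < 2 ^ (Suc j * b ^ (m + c) + b ^ (m + c))"
        using Suc F one op unfolding binop_def by (meson Suc_leD)
      then show ?case by (simp add: ac_simps)
    qed
    also have "Suc j * b ^ (m + c) \<le> b ^ (m + c + 2)"
    proof -
      have "Suc j \<le> b * b" using j b mult_le_mono1[OF b(1), of b] by linarith
      then have "Suc j * b ^ (m + c) \<le> (b * b) * b ^ (m + c)" by (rule mult_le_mono1)
      then show ?thesis by (simp add: power_add power2_eq_square ac_simps)
    qed
    then have "(2::nat) ^ (Suc j * b ^ (m + c)) \<le> 2 ^ (b ^ (m + c + 2))" by (rule power_increasing) simp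
    finally show ?thesis .
  qed
  then show "\<exists>m. \<forall>e i b j. fits q e i b \<longrightarrow> j \<le> i 0 \<longrightarrow>
      rec_nat c (\<lambda>x v. op v (F e i x)) j < 2 ^ (b ^ m)" by blast
qed

lemma pt_sum:
  assumes F: "\<And>q' h. q \<le> q' \<Longrightarrow> pt q' h \<Longrightarrow> pt q' (\<lambda>e i. F e i (h e i))"
  shows "pt q (\<lambda>e i. \<Sum>x<i 0. F e i x)"
proof -
  have "rec_nat 0 (\<lambda>x v. v + F e i x) j = (\<Sum>x<j. F e i x)" for e i j
    by (induction j) auto
  then show ?thesis using pt_fold[OF binops(1), of q F 0] F by simp
qed

text \<open>The exponent is cut off at \<open>i 0\<close> because an arbitrary polynomial-time
  exponent would give a number with too many bits. Exponents are vertices below, where the cut-off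
  changes nothing.\<close>

lemma pt_pow2:
  assumes f: "pt q f" shows "pt q (\<lambda>e i. 2 ^ min (f e i) (i 0))"
proof -
  have "rec_nat (1::nat) (\<lambda>x v. v * (if x < f e i then 2 else 1)) j = 2 ^ min (f e i) j" for e i j
    by (induction j) (auto simp: min_def le_Suc_eq)
  moreover have "pt q (\<lambda>e i. rec_nat 1 (\<lambda>x v. v * (if x < f e i then 2 else 1)) (i 0))"
    by (rule pt_fold[OF binops(3)]) (intro pt_if ptb_less pt_const pt_mono[OF f]; assumption)
  ultimately show ?thesis by simp
qed

lemma ptb_ex:
  assumes "\<And>q' h. q \<le> q' \<Longrightarrow> pt q' h \<Longrightarrow> ptb q' (\<lambda>e i. P e i (h e i))"
  shows "ptb q (\<lambda>e i. \<exists>x<i 0. P e i x)"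
proof -
  have "(of_bool (\<exists>x<i 0. P e i x) :: nat) = of_bool (0 < (\<Sum>x<i 0. of_bool (P e i x) :: nat))" for e i
    by (simp add: neq0_conv[symmetric] sum_eq_0_iff Bex_def del: neq0_conv sum_of_bool_eq)
  then show ?thesis by (simp only:) (intro ptb_less pt_const pt_sum assms)
qed

lemma ptb_all:
  assumes "\<And>q' h. q \<le> q' \<Longrightarrow> pt q' h \<Longrightarrow> ptb q' (\<lambda>e i. P e i (h e i))"
  shows "ptb q (\<lambda>e i. \<forall>x<i 0. P e i x)"
proof -
  have "(\<forall>x<i 0. P e i x) = (\<not> (\<exists>x<i 0. \<not> P e i x))" for e i by blast
  then show ?thesis by (simp only:) (intro ptb_not ptb_ex assms)
qed

lemma pt_card:
  assumes "\<And>q' h. q \<le> q' \<Longrightarrow> pt q' h \<Longrightarrow> ptb q' (\<lambda>e i. P e i (h e i))"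
  shows "pt q (\<lambda>e i. card {x. x < i 0 \<and> P e i x})"
proof -
  have "card {x. x < i 0 \<and> P e i x} = (\<Sum>x<i 0. of_bool (P e i x))" for e i
    by (simp add: of_bool_def sum.If_cases Int_def)
  then show ?thesis by (simp only:) (intro pt_sum assms)
qed

section \<open>Sets of vertices as binary numbers, and reachability\<close>

lemma set_encode_eq_sum:
  "A \<subseteq> {..<n} \<Longrightarrow> set_encode A = (\<Sum>x<n. 2 ^ x * of_bool (x \<in> A))"
  unfolding set_encode_def by (rule sum.mono_neutral_cong_left) auto

lemma set_encode_less:
  assumes "A \<subseteq> {..<n}" shows "set_encode A < 2 ^ n"
proof -
  have "set_encode A \<le> set_encode {..<n}" unfolding set_encode_def
    using assms by (intro sum_mono2) auto
  also have "set_encode {..<n} = 2 ^ n - 1" unfolding set_encode_def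
    by (simp add: sum_power2 atLeast0LessThan[symmetric])
  finally show ?thesis using less_exp[of n] by (metis Suc_pred' less_Suc_eq_le pos2 zero_less_power)
qed

text \<open>Sets of vertices are stored as numbers, whose binary digits are the characteristic vector.\<close>

definition grow :: "nat \<Rightarrow> (nat \<Rightarrow> nat \<Rightarrow> bool) \<Rightarrow> nat set \<Rightarrow> nat set" where
  "grow n F A = {y. y < n \<and> (y \<in> A \<or> (\<exists>x<n. x \<in> A \<and> F x y))}"

text \<open>A reachable vertex is reached in at most \<open>card R\<close> steps, and
  \<open>R\<close> is a set of at most \<open>n * n\<close> pairs; this is the origin of the number
  of rounds.\<close>

lemma grow_iterate:
  assumes u: "u < n"
  shows "(grow n F ^^ (n * n)) {u} = {v. v < n \<and> (\<lambda>x y. x < n \<and> y < n \<and> F x y)\<^sup>*\<^sup>* u v}"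
proof -
  define R where "R = {(x, y). x < n \<and> y < n \<and> F x y}"
  have sub: "R \<subseteq> {..<n} \<times> {..<n}" by (auto simp: R_def)
  then have fin: "finite R" by (rule finite_subset) simp
  have card: "card R \<le> n * n" using card_mono[OF _ sub] by simp
  have "(grow n F ^^ k) {u} = {v. \<exists>j\<le>k. (u, v) \<in> R ^^ j}" for k
  proof (induction k)
    case (Suc k)
    have Rlt: "y < n" "x < n" "F x y" if "(x, y) \<in> R" for x y using that by (auto simp: R_def)
    have lt: "v < n" if "(u, v) \<in> R ^^ j" for v j
      using that u Rlt(1) by (cases j) auto
    have "(\<exists>j\<le>Suc k. (u, y) \<in> R ^^ j) \<longleftrightarrow>
        y < n \<and> ((\<exists>j\<le>k. (u, y) \<in> R ^^ j) \<or> (\<exists>x<n. (\<exists>j\<le>k. (u, x) \<in> R ^^ j) \<and> F x y))" (is "?L \<longleftrightarrow> ?R") for y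
    proof
      assume ?L
      then obtain j where j: "j \<le> Suc k" "(u, y) \<in> R ^^ j" by blast
      note y = lt[OF j(2)]
      show ?R
      proof (cases "j = Suc k")
        case True
        then obtain x where x: "(u, x) \<in> R ^^ k" "(x, y) \<in> R" using j by auto
        then have "\<exists>j\<le>k. (u, x) \<in> R ^^ j" by (intro exI[of _ k]) simp
        then show ?thesis using y Rlt[OF x(2)] by metis
      next
        case False
        then have "j \<le> k" using j(1) by simp
        then show ?thesis using j(2) y by metis
      qed
    next
      assume R: ?R
      show ?L
      proof (cases "\<exists>j\<le>k. (u, y) \<in> R ^^ j")
        case True
        then obtain j where "j \<le> k" "(u, y) \<in> R ^^ j" by metis
        then show ?thesis by (intro exI[of _ j]) simp
      next
        case False
        then obtain x j where x: "j \<le> k" "(u, x) \<in> R ^^ j" "x < n" "F x y" using R by metis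
        moreover have "(x, y) \<in> R" using x R by (simp add: R_def)
        ultimately show ?thesis by (intro exI[of _ "Suc j"]) auto
      qed
    qed
    then show ?case using Suc by (auto simp: grow_def)
  qed (use u in auto)
  then have "(grow n F ^^ (n * n)) {u} = {v. \<exists>j\<le>n*n. (u, v) \<in> R ^^ j}" .
  also have "\<dots> = {v. (u, v) \<in> R\<^sup>*}"
  proof (intro Collect_cong iffI)
    fix v assume "(u, v) \<in> R\<^sup>*"
    then obtain j where j: "j \<le> card R" "(u, v) \<in> R ^^ j"
      unfolding rtrancl_finite_eq_relpow[OF fin] by blast
    show "\<exists>j\<le>n * n. (u, v) \<in> R ^^ j" using le_trans[OF j(1) card] j(2) by (intro exI conjI)
  next
    fix v assume "\<exists>j\<le>n * n. (u, v) \<in> R ^^ j"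
    then show "(u, v) \<in> R\<^sup>*" using relpow_imp_rtrancl by metis
  qed
  also have "\<dots> = {v. v < n \<and> (\<lambda>x y. x < n \<and> y < n \<and> F x y)\<^sup>*\<^sup>* u v}"
  proof -
    have eq: "(u, v) \<in> R\<^sup>* \<longleftrightarrow> (\<lambda>x y. x < n \<and> y < n \<and> F x y)\<^sup>*\<^sup>* u v" for v
      by (simp add: R_def rtranclp_rtrancl_eq[symmetric])
    have "v < n" if "(u, v) \<in> R\<^sup>*" for v
      using that by (rule rtranclE) (use u in \<open>auto simp: R_def\<close>)
    then show ?thesis unfolding eq[symmetric] by blast
  qed
  finally show ?thesis .
qed

lemma rec_nat_funpow: "rec_nat a (\<lambda>_. g) j = (g ^^ j) a"
  by (induction j) auto

definition digit :: "nat \<Rightarrow> nat \<Rightarrow> nat \<Rightarrow> bool" where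
  "digit n m x \<longleftrightarrow> x < n \<and> x \<in> set_decode m"

text \<open>The guard \<open>x < n\<close> inside \<open>digit\<close> makes the cut-off in
  \<open>pt_pow2\<close> harmless.\<close>

lemma ptb_digit:
  assumes "pt q f" "pt q g"
  shows "ptb q (\<lambda>e i. digit (i 0) (f e i) (g e i))"
proof -
  have "digit (i 0) (f e i) (g e i) =
     (g e i < i 0 \<and> odd (f e i div 2 ^ min (g e i) (i 0)))" for e i
    by (auto simp: digit_def set_decode_def min_def)
  then show ?thesis by (simp only:) (intro ptb_conj ptb_less ptb_odd pt_div pt_pow2 pt_size assms)
qed

lemma pt_set_encode:
  assumes "\<And>q' h. q \<le> q' \<Longrightarrow> pt q' h \<Longrightarrow> ptb q' (\<lambda>e i. P e i (h e i))"
  shows "pt q (\<lambda>e i. set_encode {x. x < i 0 \<and> P e i x})"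
proof -
  have "set_encode {x. x < i 0 \<and> P e i x} = (\<Sum>x<i 0. 2 ^ min x (i 0) * of_bool (P e i x))" for e i
    by (subst set_encode_eq_sum[of _ "i 0"]) (auto intro!: sum.cong)
  then show ?thesis by (simp only:) (intro pt_sum pt_mult pt_pow2 assms)
qed

text \<open>One recursion has only \<open>i 0\<close> rounds, so the \<open>n * n\<close> rounds of
  \<open>grow_iterate\<close> become two nested recursions. Each round yields the code of a set of
  vertices, a number below \<open>2 ^ i 0\<close>, which supplies the value bounds for
  \<open>pt_rec\<close>.\<close>

lemma ptb_reach:
  assumes F: "\<And>q' h h'. q \<le> q' \<Longrightarrow> pt q' h \<Longrightarrow> pt q' h' \<Longrightarrow> ptb q' (\<lambda>e i. F e i (h e i) (h' e i))"
    and f: "pt q f" and g: "pt q g"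
  shows "ptb q (\<lambda>e i. f e i < i 0 \<and> g e i < i 0 \<and>
     (\<lambda>x y. x < i 0 \<and> y < i 0 \<and> F e i x y)\<^sup>*\<^sup>* (f e i) (g e i))"
proof -
  define G where "G e i v = set_encode {y. y < i 0 \<and> (digit (i 0) v y \<or>
      (\<exists>x<i 0. digit (i 0) v x \<and> F e i x y))}" for e and i :: "nat \<Rightarrow> nat" and v
  have G: "pt q' (\<lambda>e i. G e i (h e i))" if "q \<le> q'" "pt q' h" for q' h
    unfolding G_def
    by (insert that, intro pt_set_encode ptb_disj ptb_ex ptb_conj ptb_less ptb_digit pt_size F;
        (assumption | (erule pt_mono, linarith) | linarith))
  have G_less: "G e i v < 2 ^ i 0" for e i v unfolding G_def by (rule set_encode_less) auto
  have val1: "rec_nat v (\<lambda>_. G e i) j < 2 ^ (b ^ Suc m)"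
    if "fits q e i b" "v < 2 ^ (b ^ m)" for e i b v j m
  proof (cases j)
    case 0
    have "2 \<le> b" using that by (simp add: fits_def)
    then have "b ^ m \<le> b ^ Suc m" by (rule pow_mono_exp) simp
    then have "(2::nat) ^ (b ^ m) \<le> 2 ^ (b ^ Suc m)" by (rule power_increasing) simp
    then show ?thesis using 0 that(2) less_le_trans by fastforce
  next
    case (Suc k)
    have "b ^ 1 \<le> b ^ Suc m" using that(1) by (intro pow_mono_exp) (auto simp: fits_def)
    then have "i 0 \<le> b ^ Suc m" using that(1) unfolding fits_def power_one_right by linarith
    then have "(2::nat) ^ i 0 \<le> 2 ^ (b ^ Suc m)" by (rule power_increasing) simp
    then show ?thesis using Suc less_le_trans[OF G_less[of e i "rec_nat v (\<lambda>_. G e i) k"]] by fastforce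
  qed
  have inner: "pt q' (\<lambda>e i. rec_nat (h e i) (\<lambda>_. G e i) (i 0))" if q: "q \<le> q'" and h: "pt q' h" for q' h
  proof (rule pt_rec)
    show "pt q' h" by fact
    show "pt q'' (\<lambda>e i. G e i (h'' e i))" if "q' \<le> q''" "pt q'' h''" for q'' and h''
      using that q by (intro G) auto
    from pt_value[OF h] obtain m where m: "\<And>e i b. fits q' e i b \<Longrightarrow> h e i < 2 ^ (b ^ m)" by blast
    then show "\<exists>m. \<forall>e i b j. fits q' e i b \<longrightarrow> j \<le> i 0 \<longrightarrow> rec_nat (h e i) (\<lambda>_. G e i) j < 2 ^ b ^ m"
      using val1 fits_mono[OF _ q] by blast
  qed
  have outer: "pt q (\<lambda>e i. rec_nat (2 ^ min (f e i) (i 0)) (\<lambda>_ v. rec_nat v (\<lambda>_. G e i) (i 0)) (i 0))"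
  proof (rule pt_rec)
    show p: "pt q (\<lambda>e i. 2 ^ min (f e i) (i 0))" by (intro pt_pow2 f)
    show "pt q' (\<lambda>e i. rec_nat (h' e i) (\<lambda>_. G e i) (i 0))" if "q \<le> q'" "pt q' h'" for q' and h'
      using that by (intro inner)
    have "rec_nat (2 ^ min (f e i) (i 0)) (\<lambda>_ v. rec_nat v (\<lambda>_. G e i) (i 0)) j < 2 ^ (b ^ 2)"
      if fit: "fits q e i b" for e i b j
    proof -
      have "(2::nat) ^ min (f e i) (i 0) < 2 ^ (b ^ 2)"
      proof (rule power_strict_increasing)
        have "b < b ^ 2" using fit by (simp add: fits_def power2_eq_square)
        then show "min (f e i) (i 0) < b ^ 2" using fit by (auto simp: fits_def)
      qed simp
      moreover have "rec_nat v (\<lambda>_. G e i) (i 0) < 2 ^ (b ^ 2)" if v: "v < 2 ^ (b ^ 2)" for v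
      proof (cases "i 0")
        case (Suc k)
        have "i 0 \<le> b ^ 2" using fit self_le_power[of b 2] by (auto simp: fits_def)
        then have "(2::nat) ^ i 0 \<le> 2 ^ (b ^ 2)" by (rule power_increasing) simp
        then show ?thesis using G_less[of e i "rec_nat v (\<lambda>_. G e i) k"] Suc by simp
      qed (use v in simp)
      ultimately show ?thesis by (induction j) auto
    qed
    then show "\<exists>m. \<forall>e i b j. fits q e i b \<longrightarrow> j \<le> i 0 \<longrightarrow>
      rec_nat (2 ^ min (f e i) (i 0)) (\<lambda>_ v. rec_nat v (\<lambda>_. G e i) (i 0)) j < 2 ^ b ^ m" by blast
  qed
  have eq: "(f e i < i 0 \<and> g e i < i 0 \<and> (\<lambda>x y. x < i 0 \<and> y < i 0 \<and> F e i x y)\<^sup>*\<^sup>* (f e i) (g e i)) \<longleftrightarrow>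
     f e i < i 0 \<and> digit (i 0) (rec_nat (2 ^ min (f e i) (i 0)) (\<lambda>_ v. rec_nat v (\<lambda>_. G e i) (i 0)) (i 0)) (g e i)" for e i
  proof (cases "f e i < i 0")
    case True
    have "G e i (set_encode A) = set_encode (grow (i 0) (F e i) A)" if "finite A" for A
      using that by (auto simp: G_def grow_def digit_def intro!: arg_cong[where f = set_encode])
    then have "finite A \<Longrightarrow> (G e i ^^ k) (set_encode A) = set_encode ((grow (i 0) (F e i) ^^ k) A)
        \<and> finite ((grow (i 0) (F e i) ^^ k) A)" for A k
      by (induction k) (auto simp: grow_def)
    from this[of "{f e i}" "i 0 * i 0"] have
      "(G e i ^^ (i 0 * i 0)) (set_encode {f e i}) = set_encode ((grow (i 0) (F e i) ^^ (i 0 * i 0)) {f e i})"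
      "finite ((grow (i 0) (F e i) ^^ (i 0 * i 0)) {f e i})" by simp_all
    moreover have "set_encode {f e i} = 2 ^ f e i" by (simp add: set_encode_def)
    ultimately have
      "set_decode ((G e i ^^ (i 0 * i 0)) (2 ^ f e i)) = (grow (i 0) (F e i) ^^ (i 0 * i 0)) {f e i}"
      using set_encode_inverse by metis
    moreover have "rec_nat (2 ^ f e i) (\<lambda>_ v. rec_nat v (\<lambda>_. G e i) (i 0)) (i 0) = (G e i ^^ (i 0 * i 0)) (2 ^ f e i)"
    proof -
      have "(\<lambda>v. rec_nat v (\<lambda>_. G e i) (i 0)) = G e i ^^ i 0" by (rule ext) (rule rec_nat_funpow)
      then show ?thesis using rec_nat_funpow[of "2 ^ f e i" "G e i ^^ i 0" "i 0"] by (simp add: funpow_mult)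
    qed
    ultimately show ?thesis using True by (auto simp: digit_def grow_iterate min_def)
  qed auto
  show ?thesis unfolding eq by (intro ptb_conj ptb_less ptb_digit pt_size outer f g)
qed

section \<open>Complete programs: writing a list, and breadth-first search\<close>

definition input_array :: "nat list \<Rightarrow> nat \<Rightarrow> nat" where
  "input_array xs j = (if j < length xs then xs ! j else 0)"

lemma initial_store_simps [simp]:
  "reg (initial_store xs) x = (if x = 0 then length xs else 0)"
  "arr (initial_store xs) 0 = input_array xs"
  "a \<noteq> 0 \<Longrightarrow> arr (initial_store xs) a j = 0"
  by (auto simp: initial_store_def input_array_def fun_eq_iff)

definition fits_input :: "nat list \<Rightarrow> nat \<Rightarrow> bool" where
  "fits_input xs b \<longleftrightarrow> 2 \<le> b \<and> length xs < 2 ^ b \<and> input_array xs 0 \<le> b \<and> (\<forall>x\<in>set xs. x < 2 ^ b)"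

lemma fits_initial:
  assumes "fits_input xs b"
  shows "fits q (reg (initial_store xs)) (arr (initial_store xs) 0) b"
  using assms by (auto simp: fits_def fits_input_def input_array_def)

lemma floorlog_0 [simp]: "floorlog 2 0 = 0"
  by (simp add: floorlog_def)

lemma floorlog_1: "floorlog 2 (Suc 0) \<le> 1"
  by (rule floorlog_le_pow) simp

lemma fits_Suc: "fits (Suc q) e i b \<longleftrightarrow> fits q e i b \<and> e q < 2 ^ b"
  by (auto simp: fits_def less_Suc_eq)

lemma fits_cong: "fits q e i b \<Longrightarrow> (\<And>x. x < q \<Longrightarrow> e' x = e x) \<Longrightarrow> fits q e' i b"
  by (simp add: fits_def)

primrec loop_free :: "com \<Rightarrow> bool" where
  "loop_free Skip \<longleftrightarrow> True"
| "loop_free (Assign x e) \<longleftrightarrow> True"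
| "loop_free (Store a e f) \<longleftrightarrow> True"
| "loop_free (Seq c d) \<longleftrightarrow> loop_free c \<and> loop_free d"
| "loop_free (If b c d) \<longleftrightarrow> loop_free c \<and> loop_free d"
| "loop_free (While b c) \<longleftrightarrow> False"

primrec result :: "com \<Rightarrow> store \<Rightarrow> store" where
  "result Skip s = s"
| "result (Assign x e) s = s\<lparr>reg := (reg s)(x := aval e s)\<rparr>"
| "result (Store a e f) s = s\<lparr>arr := (arr s)(a := (arr s a)(aval e s := aval f s))\<rparr>"
| "result (Seq c d) s = result d (result c s)"
| "result (If b c d) s = (if aval b s \<noteq> 0 then result c s else result d s)"
| "result (While b c) s = s"

primrec cost :: "com \<Rightarrow> store \<Rightarrow> nat" where
  "cost Skip s = 1"
| "cost (Assign x e) s = 1 + acost e s"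
| "cost (Store a e f) s = 1 + acost e s + acost f s"
| "cost (Seq c d) s = cost c s + cost d (result c s)"
| "cost (If b c d) s = 1 + acost b s + (if aval b s \<noteq> 0 then cost c s else cost d s)"
| "cost (While b c) s = 0"

text \<open>For loop-free programs the final store and the cost are plain functions of the initial
  store, so simplification can execute the body of the search loop.\<close>

lemma exec_loop_free: "loop_free c \<Longrightarrow> exec c s (cost c s) (result c s)"
proof (induction c arbitrary: s)
  case (If b c d)
  then have "exec c s (cost c s) (result c s)" "exec d s (cost d s) (result d s)" by simp_all
  then show ?case
    unfolding cost.simps result.simps by (cases "aval b s = 0") (simp_all only: if_False if_True simp_thms, rule exec.intros exec.IfFalse exec.IfTrue; assumption)+
next
  case (Seq c d)
  then show ?case unfolding cost.simps result.simps loop_free.simps by (blast intro: exec.Seq)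
qed (simp_all only: cost.simps result.simps loop_free.simps exec.Skip exec.Assign exec.Store)

lemma output_cost:
  fixes b n t t' x y P :: nat
  assumes "2 \<le> b" "n \<le> b" "t \<le> P" "b \<le> P" "x \<le> P" "y \<le> P"
    and t': "t' \<le> n * (1 + (2 * b + 4) + (x + y + 3 * b + 9)) + 1 + (2 * b + 4)"
  shows "t + (2 + (t' + (2 + b))) \<le> b ^ 5 * (P * b)"
proof -
  have "n * (1 + (2 * b + 4) + (x + y + 3 * b + 9)) \<le> b * (14 * P)"
    using assms by (intro mult_le_mono) auto
  then have "t + (2 + (t' + (2 + b))) \<le> b * (14 * P) + 10 * P" using assms by linarith
  also have "\<dots> \<le> b * (14 * P) + b * (5 * P)"
    using mult_le_mono1[OF assms(1), of "5 * P"] by simp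
  also have "\<dots> \<le> 2 ^ 5 * (P * b)" by (simp add: algebra_simps)
  also have "\<dots> \<le> b ^ 5 * (P * b)" using assms(1) by (intro mult_le_mono1 power_mono) auto
  finally show ?thesis .
qed

text \<open>Each symbol of the output is computed afresh from the untouched input: register 2 holds
  the length, register 3 the position, register 4 the symbol. Arrays 0 and 1 are safe because the
  program for a symbol is requested with \<open>r = 4\<close>.\<close>

lemma output_program:
  assumes len: "pt 2 (\<lambda>e i. len i)" and out: "pt 4 (\<lambda>e i. out i (e 3))"
  shows "\<exists>c m. \<forall>xs b. fits_input xs b \<longrightarrow> len (input_array xs) \<le> b \<longrightarrow>
    computes_within c xs (map (out (input_array xs)) [0..<len (input_array xs)]) (b ^ m)"
proof -
  from pt_computes[OF len, of 2] obtain cl m1 where cl: "computes 2 cl m1 (\<lambda>e i. len i)" by auto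
  from pt_computes[OF out, of 4] obtain co m2 where co: "computes 4 co m2 (\<lambda>e i. out i (e 3))" by auto
  from pt_value[OF out] obtain mv where
    mv: "\<And>e i b. fits 4 e i b \<Longrightarrow> out i (e 3) < 2 ^ (b ^ mv)" by blast
  let ?guard = "Less (Reg 3) (Reg 2)"
  let ?A1 = "Store 1 (Reg 3) (Reg 4)" and ?A2 = "Assign 3 (Add (Reg 3) (Const 1))"
  let ?body = "Seq co (Seq ?A1 ?A2)"
  let ?c = "Seq cl (Seq (Assign 3 (Const 0)) (Seq (While ?guard ?body) (Assign 0 (Reg 2))))"
  have "computes_within ?c xs (map (out (input_array xs)) [0..<len (input_array xs)]) (b ^ (6 + (m1 + m2 + mv + 1)))"
    if fi: "fits_input xs b" and lb: "len (input_array xs) \<le> b" for xs b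
  proof -
    define s where "s = initial_store xs"
    define i where "i = input_array xs"
    have b: "2 \<le> b" using fi by (simp add: fits_input_def)
    have fit: "fits q (reg s) (arr s 0) b" for q unfolding s_def by (rule fits_initial[OF fi])
    have s0: "arr s 0 = i" by (simp add: s_def i_def)
    have lb: "len i \<le> b" using lb by (simp add: i_def)
    from computesD[OF cl fit] obtain t s1 where e1: "exec cl s t s1" "t \<le> b ^ m1"
      "reg s1 2 = len (arr s 0)" "\<And>x. x < 2 \<Longrightarrow> reg s1 x = reg s x" "\<And>a. a < 2 \<Longrightarrow> arr s1 a = arr s a"
      by metis
    define s2 where "s2 = s1\<lparr>reg := (reg s1)(3 := aval (Const 0) s1)\<rparr>"
    have c2: "1 + acost (Const 0) s1 = 2" by simp
    have "exec (Assign 3 (Const 0)) s1 (1 + acost (Const 0) s1) s2"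
      unfolding s2_def by (rule exec.Assign)
    then have e2: "exec (Assign 3 (Const 0)) s1 2 s2" unfolding c2 .
    define I where "I j s' \<longleftrightarrow> j \<le> len i \<and> reg s' 3 = j \<and> reg s' 2 = len i \<and>
      (\<forall>x<2. reg s' x = reg s x) \<and> arr s' 0 = i \<and> (\<forall>p<j. arr s' 1 p = out i p)" for j and s' :: store
    have I0: "I 0 s2" using e1(3-5) s0 by (simp add: I_def s2_def)
    have guard: "acost ?guard s' \<le> 2 * b + 4" if I: "I j s'" for j and s' :: store
    proof -
      have "floorlog 2 (reg s' 2) \<le> b" "floorlog 2 (reg s' 3) \<le> b"
        using I lb by (auto intro!: floorlog_le_pow nat_less_pow2 simp: I_def)
      moreover have "floorlog 2 (aval ?guard s') \<le> 1" by (intro floorlog_le_pow) auto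
      ultimately show ?thesis by simp
    qed
    have body: "j < len i \<and> (\<exists>t s''. exec ?body s' t s'' \<and> t \<le> b ^ m2 + b ^ mv + 3 * b + 9 \<and> I (Suc j) s'')"
      if I: "I j s'" and g: "aval ?guard s' \<noteq> 0" for j and s' :: store
    proof -
      have j: "j < len i" using g I by (auto simp: I_def)
      have "reg s' x < 2 ^ b" if "x < 4" for x
      proof -
        have "x = 2 \<or> x = 3 \<or> x < 2" using that by linarith
        moreover have "len i < 2 ^ b" "j < 2 ^ b" using I lb by (auto simp: I_def intro!: nat_less_pow2)
        ultimately show ?thesis using I fit[of 2] by (auto simp: I_def fits_def)
      qed
      then have f4: "fits 4 (reg s') (arr s' 0) b" using fit[of 4] I s0 by (auto simp: fits_def I_def)
      from computesD[OF co f4] obtain t' s3 where e3: "exec co s' t' s3" "t' \<le> b ^ m2"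
        "reg s3 4 = out (arr s' 0) (reg s' 3)" "\<And>x. x < 4 \<Longrightarrow> reg s3 x = reg s' x"
        "\<And>a. a < 4 \<Longrightarrow> arr s3 a = arr s' a" by metis
      have r: "reg s3 4 = out i j" "reg s3 3 = j" "reg s3 4 < 2 ^ (b ^ mv)" "reg s3 2 = len i"
        using e3(3) e3(4)[of 3] e3(4)[of 2] I mv[OF f4] by (auto simp: I_def)
      define s4 where "s4 = s3\<lparr>arr := (arr s3)(1 := (arr s3 1)(aval (Reg 3) s3 := aval (Reg 4) s3))\<rparr>"
      define s5 where "s5 = s4\<lparr>reg := (reg s4)(3 := aval (Add (Reg 3) (Const 1)) s4)\<rparr>"
      have e4: "exec ?A1 s3 (1 + acost (Reg 3) s3 + acost (Reg 4) s3) s4"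
        unfolding s4_def by (rule exec.Store)
      have e5: "exec ?A2 s4 (1 + acost (Add (Reg 3) (Const 1)) s4) s5"
        unfolding s5_def by (rule exec.Assign)
      have "floorlog 2 j \<le> b" "floorlog 2 (Suc j) \<le> b" "floorlog 2 (reg s3 4) \<le> b ^ mv"
        using j lb r(3) by (auto intro!: floorlog_le_pow nat_less_pow2)
      then have c: "acost (Reg 3) s3 + acost (Reg 4) s3 \<le> b ^ mv + b + 2"
          "acost (Add (Reg 3) (Const 1)) s4 \<le> 2 * b + 4"
        using r floorlog_1 by (simp_all add: s4_def)
      have "exec ?body s' (t' + ((1 + acost (Reg 3) s3 + acost (Reg 4) s3) + (1 + acost (Add (Reg 3) (Const 1)) s4))) s5"
        using e3(1) e4 e5 by (intro exec.Seq)
      moreover have "t' + ((1 + acost (Reg 3) s3 + acost (Reg 4) s3) + (1 + acost (Add (Reg 3) (Const 1)) s4))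
          \<le> b ^ m2 + b ^ mv + 3 * b + 9"
        using e3(2) c by linarith
      moreover have "I (Suc j) s5"
        using I e3(4,5) r j by (auto simp: I_def s5_def s4_def less_Suc_eq)
      ultimately show ?thesis using j by metis
    qed
    have "\<exists>t s' j'. exec (While ?guard ?body) s2 t s' \<and> aval ?guard s' = 0 \<and> I j' s' \<and>
           t \<le> (len i - 0) * (1 + (2 * b + 4) + (b ^ m2 + b ^ mv + 3 * b + 9)) + 1 + (2 * b + 4)"
      by (rule while_exec[of I ?guard "len i" ?body _ _ 0 s2, OF body guard I0 le0])
    then obtain t3 s3 j where
      e3: "exec (While ?guard ?body) s2 t3 s3" "aval ?guard s3 = 0" "I j s3"
        "t3 \<le> len i * (1 + (2 * b + 4) + (b ^ m2 + b ^ mv + 3 * b + 9)) + 1 + (2 * b + 4)"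
      unfolding minus_nat.diff_0 by metis
    have jn: "j = len i" "reg s3 2 = len i" using e3(2,3) by (auto simp: I_def split: if_splits)
    define s4 where "s4 = s3\<lparr>reg := (reg s3)(0 := aval (Reg 2) s3)\<rparr>"
    have e4: "exec (Assign 0 (Reg 2)) s3 (1 + acost (Reg 2) s3) s4" unfolding s4_def by (rule exec.Assign)
    have "floorlog 2 (len i) \<le> b" using lb by (intro floorlog_le_pow nat_less_pow2)
    then have c4: "1 + acost (Reg 2) s3 \<le> 2 + b" using jn by simp
    let ?M = "m1 + m2 + mv + 1"
    have p: "b ^ m1 \<le> b ^ ?M" "b ^ m2 \<le> b ^ ?M" "b ^ mv \<le> b ^ ?M" "b ^ 1 \<le> b ^ ?M"
      by (intro pow_mono_exp[OF b]; simp)+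
    have "t + (2 + (t3 + (2 + b))) \<le> b ^ 5 * (b ^ ?M * b)"
      by (rule output_cost[OF b lb le_trans[OF e1(2) p(1)] _ p(2,3) e3(4)]) (use p(4) in simp)
    also have "\<dots> = b ^ (6 + ?M)" by (simp add: power_add numeral_eq_Suc ac_simps)
    finally have "t + (2 + (t3 + (1 + acost (Reg 2) s3))) \<le> b ^ (6 + ?M)" using c4 by linarith
    moreover have "exec ?c s (t + (2 + (t3 + (1 + acost (Reg 2) s3)))) s4"
      using e1(1) e2 e3(1) e4 by (intro exec.Seq)
    moreover have "output_of s4 = map (out i) [0..<len i]"
      using e3(3) jn by (auto simp: output_of_def s4_def I_def)
    ultimately show ?thesis unfolding computes_within_def s_def i_def by blast
  qed
  then show ?thesis by blast
qed

lemma search_cost: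
  fixes b t1 t2 tw t4 L A P C K :: nat
  assumes "2 \<le> b" "t1 \<le> P" "t2 \<le> P" "t4 \<le> P" "A \<le> P" "L \<le> P" "x \<le> P" "1 \<le> P" "K \<le> b" "1 \<le> C"
    and tw: "tw \<le> C * K * (1 + (2 * L + 4) + (A + 20 * L + 40)) + 1 + (2 * L + 4)"
  shows "t1 + (t2 + (5 * L + 30 + (tw + (t4 + (x + 3 * L + 20))))) \<le> b ^ 8 * (P * b) * C"
proof -
  have "C * K * (1 + (2 * L + 4) + (A + 20 * L + 40)) \<le> C * b * (68 * P)"
    using assms by (intro mult_le_mono) auto
  then have "t1 + (t2 + (5 * L + 30 + (tw + (t4 + (x + 3 * L + 20))))) \<le> C * b * (68 * P) + 69 * P"
    using assms by linarith
  also have "69 * P \<le> C * b * (69 * P)"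
    using mult_le_mono[OF assms(10), of 1 b] assms(1) by simp
  also have "C * b * (68 * P) + C * b * (69 * P) \<le> 2 ^ 8 * (P * b) * C" by (simp add: algebra_simps)
  also have "\<dots> \<le> b ^ 8 * (P * b) * C" using assms(1) by (intro mult_le_mono1 power_mono) auto
  finally show ?thesis by simp
qed

text \<open>
  Breadth-first search. Register 3 holds the number of successors of a state, array 1 from index
  \<open>reg 5\<close> to index \<open>reg 6\<close> is the queue, array 2 marks the visited states, and register 7 counts
  the successors of the head of the queue that have been treated.
\<close>

lemma search_program:
  assumes size: "pt 3 (\<lambda>e i. K i)" and start: "pt 4 (\<lambda>e i. start i)" and target: "pt 8 (\<lambda>e i. target i)"
    and succ: "pt 9 (\<lambda>e i. succ i (e 8) (e 7))"
  shows "\<exists>c m. \<forall>xs b i M. fits_input xs b \<longrightarrow> i = input_array xs \<longrightarrow> 1 \<le> K i \<longrightarrow> K i \<le> b \<longrightarrow>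
    M = {x. (\<lambda>x y. \<exists>z<K i. y = succ i x z)\<^sup>*\<^sup>* (start i) x} \<longrightarrow> M \<subseteq> {..<2 ^ b} \<longrightarrow>
    computes_within c xs [of_bool (target i \<in> M)] (b ^ m * card M)"
proof -
  from pt_computes[OF size, of 3] obtain cK mK where cK: "computes 3 cK mK (\<lambda>e i. K i)" by auto
  from pt_computes[OF start, of 4] obtain cS mS where cS: "computes 4 cS mS (\<lambda>e i. start i)" by auto
  from pt_computes[OF target, of 8] obtain cT mT where cT: "computes 8 cT mT (\<lambda>e i. target i)" by auto
  from pt_computes[OF succ, of 9] obtain cN mN where cN: "computes 9 cN mN (\<lambda>e i. succ i (e 8) (e 7))" by auto
  from pt_value[OF target] obtain mv where mv: "\<And>e i b. fits 8 e i b \<Longrightarrow> target i < 2 ^ (b ^ mv)" by blast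
  let ?guard = "Less (Reg 5) (Reg 6)"
  let ?incr = "\<lambda>r. Assign r (Add (Reg r) (Const 1))"
  let ?push = "Seq (Store 2 (Reg 9) (Const 1)) (Seq (Store 1 (Reg 6) (Reg 9)) (?incr 6))"
  let ?visit = "If (Arr 2 (Reg 9)) Skip ?push"
  let ?next = "If (Less (Reg 7) (Reg 3)) Skip (Seq (Assign 7 (Const 0)) (?incr 5))"
  let ?body = "Seq (Assign 8 (Arr 1 (Reg 5))) (Seq cN (Seq ?visit (Seq (?incr 7) ?next)))"
  let ?init = "Seq (Store 2 (Reg 4) (Const 1)) (Seq (Store 1 (Const 0) (Reg 4))
    (Seq (Assign 5 (Const 0)) (Seq (Assign 6 (Const 1)) (Assign 7 (Const 0)))))"
  let ?final = "Seq (Store 1 (Const 0) (Arr 2 (Reg 8))) (Assign 0 (Const 1))"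
  let ?c = "Seq cK (Seq cS (Seq ?init (Seq (While ?guard ?body) (Seq cT ?final))))"
  let ?m = "mK + 2 * mS + 2 * mN + 2 * mT + 2 * mv + 2 + 9"
  have "computes_within ?c xs [of_bool (target i \<in> M)] (b ^ ?m * card M)"
    if fi: "fits_input xs b" and i: "i = input_array xs" and K: "1 \<le> K i" "K i \<le> b"
      and M: "M = {x. (\<lambda>x y. \<exists>z<K i. y = succ i x z)\<^sup>*\<^sup>* (start i) x}" and Mb: "M \<subseteq> {..<2 ^ b}"
    for xs b i M
  proof -
    define s where "s = initial_store xs"
    have b: "2 \<le> b" using fi by (simp add: fits_input_def)
    have fit: "fits q (reg s) (arr s 0) b" for q unfolding s_def by (rule fits_initial[OF fi])
    have s0: "arr s 0 = i" "\<And>a j. a \<noteq> 0 \<Longrightarrow> arr s a j = 0" by (auto simp: s_def i)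
    have finM: "finite M" using Mb finite_subset by blast
    have cM: "card M \<le> 2 ^ b" using card_mono[OF _ Mb] by simp
    have sM: "start i \<in> M" unfolding M by simp
    have succM: "succ i x z \<in> M" if "x \<in> M" "z < K i" for x z
      using that unfolding M by (auto intro: rtranclp.rtrancl_into_rtrancl)
    have "card M > 0" using sM finM by (auto simp: card_gt_0_iff)
    then have M1: "1 \<le> card M" by simp
    define L where "L = b + 2"
    have "1 \<le> (2::nat) ^ b" by simp
    then have "2 ^ b + 1 < 4 * (2::nat) ^ b" by linarith
    then have pow: "(2::nat) ^ b + 1 < 2 ^ L" by (simp add: L_def)
    have fl: "floorlog 2 x \<le> L" if "x \<le> 2 ^ b + 1" for x
      using that pow by (intro floorlog_le_pow) simp
    have bb: "b \<le> (2::nat) ^ b" by (rule less_imp_le[OF less_exp])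
    \<comment> \<open>States, counters and queue positions are at most \<open>2 ^ b + 1\<close>,
      slightly too large for the bound \<open>b\<close>; squaring it suffices because
      \<open>b\<close> is at least 2.\<close>
    define \<beta> where "\<beta> = b ^ 2"
    have L\<beta>: "L \<le> \<beta>" and \<beta>2: "2 \<le> \<beta>" "b \<le> \<beta>"
      using mult_le_mono1[OF b, of b] b unfolding L_def \<beta>_def power2_eq_square by linarith+
    have less\<beta>: "x < 2 ^ \<beta>" if "x \<le> 2 ^ b + 1" for x :: nat
    proof -
      have "(2::nat) ^ L \<le> 2 ^ \<beta>" using L\<beta> by (rule power_increasing) simp
      then show ?thesis by (rule less_le_trans[OF le_less_trans[OF that pow]])
    qed
    have fit\<beta>: "fits q (reg s) i \<beta>" for q using fits_weaken[OF fit \<beta>2(2)] s0(1) by simp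
    obtain t1 s1 where e1: "exec cK s t1 s1" "t1 \<le> b ^ mK"
      "reg s1 3 = K (arr s 0)" "\<And>x. x < 3 \<Longrightarrow> reg s1 x = reg s x" "\<And>a. a < 3 \<Longrightarrow> arr s1 a = arr s a"
      using computesD[OF cK fit] by metis
    have a1: "arr s1 0 = i" using e1(5) s0 by simp
    have "fits 3 (reg s1) i \<beta>" by (rule fits_cong[OF fit\<beta> e1(4)])
    then have "fits (Suc 3) (reg s1) (arr s1 0) \<beta>"
      unfolding fits_Suc using e1(3,5) s0 less\<beta>[of "K i"] K bb by simp
    then have fit1: "fits 4 (reg s1) (arr s1 0) \<beta>" by simp
    obtain t2 s2 where e2: "exec cS s1 t2 s2" "t2 \<le> \<beta> ^ mS"
      "reg s2 4 = start (arr s1 0)" "\<And>x. x < 4 \<Longrightarrow> reg s2 x = reg s1 x" "\<And>a. a < 4 \<Longrightarrow> arr s2 a = arr s1 a"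
      using computesD[OF cS fit1] by metis
    have st2: "reg s2 4 = start i" using e2(3) a1 by simp
    define s3 where "s3 = result ?init s2"
    have e3: "exec ?init s2 (cost ?init s2) s3" unfolding s3_def by (rule exec_loop_free) simp
    have st: "start i \<le> 2 ^ b + 1" using sM Mb by auto
    then have c3: "cost ?init s2 \<le> 5 * L + 30"
      using floorlog_1 st2 fl[OF st] by simp
    define low where "low s' \<longleftrightarrow> (\<forall>x<3. reg s' x = reg s x) \<and> reg s' 3 = K i \<and> reg s' 4 = start i \<and>
      arr s' 0 = i" for s' :: store
    have low3: "low s3"
      using e1(3-5) e2(4-5) st2 s0 by (auto simp: low_def s3_def)
    \<comment> \<open>One round of the loop treats one pair of a queue position \<open>h\<close> and
      a successor number \<open>z\<close>, and \<open>j = h * K i + z\<close> numbers these pairs.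
      The queue has no repetitions and stays inside \<open>M\<close>, so there are at most
      \<open>card M * K i\<close> rounds: the time is linear in \<open>card M\<close>.\<close>
    define I where "I j s' \<longleftrightarrow> low s' \<and> (\<exists>Q h t z. reg s' 5 = h \<and> reg s' 6 = t \<and> reg s' 7 = z \<and> arr s' 1 = Q \<and>
      j = h * K i + z \<and> h \<le> t \<and> z < K i \<and> inj_on Q {..<t} \<and> Q ` {..<t} \<subseteq> M \<and> start i \<in> Q ` {..<t} \<and>
      (\<forall>x. arr s' 2 x = of_bool (x \<in> Q ` {..<t})) \<and> (\<forall>p<h. \<forall>y<K i. succ i (Q p) y \<in> Q ` {..<t}) \<and>
      (\<forall>y<z. succ i (Q h) y \<in> Q ` {..<t}))" for j and s' :: store
    have a12: "arr s2 2 x = 0" for x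
      using e2(5)[of 2] e1(5)[of 2] s0(2) by simp
    have I0: "I 0 s3"
      unfolding I_def
    proof (intro conjI exI)
      show "low s3" by (rule low3)
      show "inj_on (arr s3 1) {..<1}" "arr s3 1 ` {..<1} \<subseteq> M" "start i \<in> arr s3 1 ` {..<1}"
        "\<forall>x. arr s3 2 x = of_bool (x \<in> arr s3 1 ` {..<1})"
        using st2 a12 sM by (auto simp: s3_def lessThan_Suc)
    qed (use K in \<open>auto simp: s3_def\<close>)
    have tail: "t \<le> card M" if "inj_on Q {..<t}" "Q ` {..<t} \<subseteq> M" for Q :: "nat \<Rightarrow> nat" and t
      using card_mono[OF finM that(2)] card_image[OF that(1)] by simp
    have guard: "acost ?guard s' \<le> 2 * L + 4" if I: "I j s'" for j and s' :: store
    proof -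
      have "reg s' 6 \<le> card M" "reg s' 5 \<le> reg s' 6" using I tail unfolding I_def by auto
      then have "floorlog 2 (reg s' 5) \<le> L" "floorlog 2 (reg s' 6) \<le> L" using cM by (auto intro!: fl)
      moreover have "floorlog 2 (aval ?guard s') \<le> 1" by (intro floorlog_le_pow) auto
      ultimately show ?thesis by simp
    qed
    have body: "j < card M * K i \<and> (\<exists>t s''. exec ?body s' t s'' \<and> t \<le> \<beta> ^ mN + 20 * L + 40 \<and> I (Suc j) s'')"
      if I: "I j s'" and g: "aval ?guard s' \<noteq> 0" for j and s' :: store
    proof -
      define Q h t z where "Q = arr s' 1" and "h = reg s' 5" and "t = reg s' 6" and "z = reg s' 7"
      have lo: "low s'" and j: "j = h * K i + z" and z: "z < K i" and inj: "inj_on Q {..<t}"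
        and QM: "Q ` {..<t} \<subseteq> M" and stQ: "start i \<in> Q ` {..<t}" and V: "\<And>x. arr s' 2 x = of_bool (x \<in> Q ` {..<t})"
        and old: "\<And>p y. p < h \<Longrightarrow> y < K i \<Longrightarrow> succ i (Q p) y \<in> Q ` {..<t}"
        and cur: "\<And>y. y < z \<Longrightarrow> succ i (Q h) y \<in> Q ` {..<t}"
        using I unfolding I_def Q_def h_def t_def z_def by auto
      have ht: "h < t" using g by (auto simp: h_def t_def)
      have tM: "t \<le> card M" by (rule tail[OF inj QM])
      have "Suc h * K i \<le> card M * K i" using ht tM by (intro mult_le_mono1) simp
      then have jl: "j < card M * K i" using z by (simp add: j)
      have Qh: "Q h \<in> M" using ht QM by auto
      define s4 where "s4 = result (Assign 8 (Arr 1 (Reg 5))) s'"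
      define c4 where "c4 = cost (Assign 8 (Arr 1 (Reg 5))) s'"
      have e4: "exec (Assign 8 (Arr 1 (Reg 5))) s' c4 s4" unfolding s4_def c4_def by (rule exec_loop_free) simp
      have s4: "reg s4 8 = Q h" "\<And>x. x \<noteq> 8 \<Longrightarrow> reg s4 x = reg s' x" "arr s4 = arr s'"
        by (auto simp: s4_def Q_def h_def)
      have Qhb: "Q h \<le> 2 ^ b + 1" using Qh Mb by auto
      have hb: "h \<le> 2 ^ b + 1" "t \<le> 2 ^ b + 1" "Suc t \<le> 2 ^ b + 1" using ht tM cM by auto
      have zb: "z \<le> 2 ^ b + 1" "Suc z \<le> 2 ^ b + 1" "K i \<le> 2 ^ b + 1" using z K bb by linarith+
      have c4: "c4 \<le> 2 * L + 3" using fl[OF Qhb] fl[OF hb(1)] by (simp add: c4_def Q_def h_def)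
      have "fits 3 (reg s4) i \<beta>" by (rule fits_cong[OF fit\<beta>]) (use lo s4(2) in \<open>simp add: low_def\<close>)
      then have "fits (Suc (Suc (Suc (Suc (Suc (Suc 3)))))) (reg s4) (arr s4 0) \<beta>"
        unfolding fits_Suc using lo s4 less\<beta> st Qhb hb zb
        by (simp add: low_def h_def[symmetric] t_def[symmetric] z_def[symmetric])
      then have fit4: "fits 9 (reg s4) (arr s4 0) \<beta>" by (simp add: numeral_eq_Suc)
      obtain t5 s5 where e5: "exec cN s4 t5 s5" "t5 \<le> \<beta> ^ mN"
        "reg s5 9 = succ (arr s4 0) (reg s4 8) (reg s4 7)" "\<And>x. x < 9 \<Longrightarrow> reg s5 x = reg s4 x"
        "\<And>a. a < 9 \<Longrightarrow> arr s5 a = arr s4 a"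
        using computesD[OF cN fit4] by metis
      define n where "n = succ i (Q h) z"
      have nM: "n \<in> M" unfolding n_def by (rule succM[OF Qh z])
      then have nb: "n \<le> 2 ^ b + 1" using Mb by auto
      have s5: "reg s5 9 = n" "reg s5 5 = h" "reg s5 6 = t" "reg s5 7 = z" "reg s5 3 = K i"
        "arr s5 1 = Q" "arr s5 2 = arr s' 2" "low s5"
        using e5(3-5) s4 lo by (auto simp: n_def h_def t_def z_def Q_def low_def)
      define t' where "t' = (if n \<in> Q ` {..<t} then t else Suc t)"
      define Q' where "Q' = (if n \<in> Q ` {..<t} then Q else Q(t := n))"
      have Q': "inj_on Q' {..<t'}" "Q' ` {..<t'} = insert n (Q ` {..<t})"
        using inj unfolding Q'_def t'_def by (auto simp: inj_on_def less_Suc_eq image_iff)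
      have Qlt: "Q' p = Q p" if "p < t" for p using that unfolding Q'_def by simp
      define s6 where "s6 = result ?visit s5"
      have e6: "exec ?visit s5 (cost ?visit s5) s6" unfolding s6_def by (rule exec_loop_free) simp
      have V5: "arr s5 2 x = of_bool (x \<in> Q ` {..<t})" for x using V s5 by simp
      have s6: "reg s6 5 = h" "reg s6 6 = t'" "reg s6 7 = z" "reg s6 3 = K i" "arr s6 1 = Q'"
        "\<And>x. arr s6 2 x = of_bool (x \<in> insert n (Q ` {..<t}))" "low s6"
        using s5 V5 by (auto simp: s6_def t'_def Q'_def low_def)
      have f1: "floorlog 2 (of_bool P) \<le> 1" for P by (rule floorlog_le_pow) simp
      have c6: "cost ?visit s5 \<le> 6 * L + 16"
        using fl[OF nb] fl[OF hb(2)] fl[OF hb(3)] f1[of "n \<in> Q ` {..<t}"] floorlog_1 s5 V5 by simp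
      define s7 where "s7 = result (?incr 7) s6"
      have e7: "exec (?incr 7) s6 (cost (?incr 7) s6) s7" unfolding s7_def by (rule exec_loop_free) simp
      have c7: "cost (?incr 7) s6 \<le> 2 * L + 5" using fl[OF zb(1)] fl[OF zb(2)] floorlog_1 s6 by simp
      define s8 where "s8 = result ?next s7"
      have e8: "exec ?next s7 (cost ?next s7) s8" unfolding s8_def by (rule exec_loop_free) simp
      have "floorlog 2 (Suc h) \<le> L" using ht tM cM by (intro fl) simp
      then have c8: "cost ?next s7 \<le> 4 * L + 12"
        using fl[OF zb(2)] fl[OF zb(3)] fl[OF hb(1)] f1[of "Suc z < K i"] floorlog_1 s6 by (simp add: s7_def)
      define h' z' where "h' = (if Suc z < K i then h else Suc h)" and "z' = (if Suc z < K i then Suc z else 0)"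
      have s8: "reg s8 5 = h'" "reg s8 6 = t'" "reg s8 7 = z'" "arr s8 1 = Q'"
        "\<And>x. arr s8 2 x = of_bool (x \<in> Q' ` {..<t'})" "low s8"
        using s6 Q'(2) by (auto simp: s8_def s7_def h'_def z'_def low_def)
      have "I (Suc j) s8"
        unfolding I_def
      proof (intro conjI exI allI impI)
        show "low s8" by fact
        show "Suc j = h' * K i + z'"
        proof (cases "Suc z < K i")
          case False
          then have "K i = Suc z" using z by simp
          then show ?thesis by (simp add: j h'_def z'_def)
        qed (simp add: j h'_def z'_def)
        show "h' \<le> t'" using ht by (auto simp: h'_def t'_def)
        show "z' < K i" using K by (auto simp: z'_def)
        show "inj_on Q' {..<t'}" by (rule Q')
        show "Q' ` {..<t'} \<subseteq> M" using Q'(2) QM nM by simp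
        show "start i \<in> Q' ` {..<t'}" using Q'(2) stQ by simp
        show "succ i (Q' p) y \<in> Q' ` {..<t'}" if p: "p < h'" and y: "y < K i" for p y
        proof (cases "p = h")
          case True
          then have "K i = Suc z" using p z by (auto simp: h'_def split: if_splits)
          then have "y < z \<or> y = z" using y by auto
          then show ?thesis using True cur Q'(2) Qlt[OF ht] n_def by auto
        next
          case False
          then have "p < h" using p by (auto simp: h'_def split: if_splits)
          then show ?thesis using old[OF _ y] Q'(2) Qlt[of p] ht by simp
        qed
        show "succ i (Q' h') y \<in> Q' ` {..<t'}" if y: "y < z'" for y
        proof -
          have "h' = h" "y < z \<or> y = z" using y by (auto simp: h'_def z'_def split: if_splits)
          then show ?thesis using cur Q'(2) Qlt[OF ht] n_def by auto
        qed
      qed (use s8 in auto)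
      moreover have "exec ?body s' (c4 + (t5 + (cost ?visit s5 + (cost (?incr 7) s6 + cost ?next s7)))) s8"
        using e4 e5(1) e6 e7 e8 by (intro exec.Seq)
      moreover have "c4 + (t5 + (cost ?visit s5 + (cost (?incr 7) s6 + cost ?next s7))) \<le> \<beta> ^ mN + 20 * L + 40"
        using c4 e5(2) c6 c7 c8 by linarith
      ultimately show ?thesis using jl by metis
    qed
    have "\<exists>t s' j'. exec (While ?guard ?body) s3 t s' \<and> aval ?guard s' = 0 \<and> I j' s' \<and>
           t \<le> (card M * K i - 0) * (1 + (2 * L + 4) + (\<beta> ^ mN + 20 * L + 40)) + 1 + (2 * L + 4)"
      by (rule while_exec[of I ?guard "card M * K i" ?body _ _ 0 s3, OF body guard I0 le0])
    then obtain tw s9 j where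
      e9: "exec (While ?guard ?body) s3 tw s9" "aval ?guard s9 = 0" "I j s9"
        "tw \<le> card M * K i * (1 + (2 * L + 4) + (\<beta> ^ mN + 20 * L + 40)) + 1 + (2 * L + 4)"
      unfolding minus_nat.diff_0 by metis
    define Q t where "Q = arr s9 1" and "t = reg s9 6"
    have lo: "low s9" and ht: "reg s9 5 \<le> t" and z: "reg s9 7 < K i" and inj: "inj_on Q {..<t}"
      and QM: "Q ` {..<t} \<subseteq> M" and stQ: "start i \<in> Q ` {..<t}" and V: "\<And>x. arr s9 2 x = of_bool (x \<in> Q ` {..<t})"
      and old: "\<And>p y. p < reg s9 5 \<Longrightarrow> y < K i \<Longrightarrow> succ i (Q p) y \<in> Q ` {..<t}"
      using e9(3) unfolding I_def Q_def t_def by auto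
    have h: "reg s9 5 = t" using e9(2) ht by (auto simp: t_def split: if_splits)
    \<comment> \<open>Once the queue is exhausted, its contents contain the start and are closed
      under successors, so they are all of \<open>M\<close>.\<close>
    have "x \<in> Q ` {..<t}" if "(\<lambda>x y. \<exists>z<K i. y = succ i x z)\<^sup>*\<^sup>* (start i) x" for x
      using that by (induction rule: rtranclp_induct) (use stQ old h in auto)
    then have QM: "Q ` {..<t} = M" using QM by (auto simp: M)
    have tM: "t \<le> card M" by (rule tail[OF inj]) (simp add: QM)
    have "fits 3 (reg s9) i \<beta>" by (rule fits_cong[OF fit\<beta>]) (use lo in \<open>simp add: low_def\<close>)
    moreover have "t \<le> 2 ^ b + 1" "K i \<le> 2 ^ b + 1" "reg s9 7 \<le> 2 ^ b + 1" using tM cM z K bb by linarith+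
    ultimately have "fits (Suc (Suc (Suc (Suc (Suc 3))))) (reg s9) (arr s9 0) \<beta>"
      unfolding fits_Suc using lo less\<beta> st h by (simp add: low_def t_def[symmetric])
    then have fit9: "fits 8 (reg s9) (arr s9 0) \<beta>" by (simp add: numeral_eq_Suc)
    obtain t10 s10 where e10: "exec cT s9 t10 s10" "t10 \<le> \<beta> ^ mT"
      "reg s10 8 = target (arr s9 0)" "\<And>x. x < 8 \<Longrightarrow> reg s10 x = reg s9 x"
      "\<And>a. a < 8 \<Longrightarrow> arr s10 a = arr s9 a"
      using computesD[OF cT fit9] by metis
    have tg: "reg s10 8 = target i" "target i < 2 ^ (\<beta> ^ mv)"
      using e10(3) lo mv[OF fit9] by (simp_all add: low_def)
    have V10: "arr s10 2 x = of_bool (x \<in> M)" for x using e10(5)[of 2] V QM by simp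
    define s11 where "s11 = result ?final s10"
    have e11: "exec ?final s10 (cost ?final s10) s11" unfolding s11_def by (rule exec_loop_free) simp
    have "floorlog 2 (of_bool (target i \<in> M)) \<le> 1" by (rule floorlog_le_pow) simp
    then have c11: "cost ?final s10 \<le> \<beta> ^ mv + 3 * L + 20"
      using floorlog_le_pow[OF tg(2)] tg(1) V10 floorlog_1 by simp
    have out: "output_of s11 = [of_bool (target i \<in> M)]"
      using tg V10 by (simp add: output_of_def s11_def)
    let ?P = "b ^ (mK + 2 * mS + 2 * mN + 2 * mT + 2 * mv + 2)"
    have p: "b ^ mK \<le> ?P" "\<beta> ^ mS \<le> ?P" "\<beta> ^ mT \<le> ?P" "\<beta> ^ mN \<le> ?P" "\<beta> ^ mv \<le> ?P" "b ^ 2 \<le> ?P" "b ^ 0 \<le> ?P"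
      unfolding \<beta>_def power_mult[symmetric] by (intro pow_mono_exp[OF b]; simp)+
    have LP: "L \<le> ?P" using L\<beta> p(6) unfolding \<beta>_def by linarith
    have P1: "1 \<le> ?P" using p(7) by simp
    have "t1 + (t2 + (5 * L + 30 + (tw + (t10 + (\<beta> ^ mv + 3 * L + 20))))) \<le> b ^ 8 * (?P * b) * card M"
      by (rule search_cost[OF b le_trans[OF e1(2) p(1)] le_trans[OF e2(2) p(2)] le_trans[OF e10(2) p(3)] p(4) LP p(5) P1 K(2) M1 e9(4)])
    also have "b ^ 8 * (?P * b) = b ^ ?m" by (simp add: power_add numeral_eq_Suc ac_simps)
    finally have "t1 + (t2 + (cost ?init s2 + (tw + (t10 + cost ?final s10)))) \<le> b ^ ?m * card M"
      using c3 c11 by linarith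
    moreover have "exec ?c s (t1 + (t2 + (cost ?init s2 + (tw + (t10 + cost ?final s10))))) s11"
      using e1(1) e2(1) e3 e9(1) e10(1) e11 by (intro exec.Seq)
    ultimately show ?thesis unfolding computes_within_def s_def
      by (intro exI[of _ "t1 + (t2 + (cost ?init s2 + (tw + (t10 + cost ?final s10))))"] exI[of _ s11] conjI out)
  qed
  then have main: "fits_input xs b \<Longrightarrow> i = input_array xs \<Longrightarrow> 1 \<le> K i \<Longrightarrow> K i \<le> b \<Longrightarrow>
      M = {x. (\<lambda>x y. \<exists>z<K i. y = succ i x z)\<^sup>*\<^sup>* (start i) x} \<Longrightarrow> M \<subseteq> {..<2 ^ b} \<Longrightarrow>
      computes_within ?c xs [of_bool (target i \<in> M)] (b ^ ?m * card M)" for xs b i M .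
  show ?thesis by (rule exI[of _ ?c], rule exI[of _ ?m], intro allI impI, rule main; assumption)
qed

section \<open>Token sliding in graphs with large connected pieces\<close>

definition indep :: "('a \<Rightarrow> 'a \<Rightarrow> bool) \<Rightarrow> 'a set \<Rightarrow> bool" where
  "indep E S \<longleftrightarrow> (\<forall>u\<in>S. \<forall>w\<in>S. \<not> E u w)"

definition step :: "('a \<Rightarrow> 'a \<Rightarrow> bool) \<Rightarrow> 'a set \<Rightarrow> 'a set \<Rightarrow> bool" where
  "step E A B \<longleftrightarrow> indep E A \<and> indep E B \<and> (\<exists>u w. u \<in> A \<and> w \<notin> A \<and> E u w \<and> B = insert w (A - {u}))"

lemma stepI: "indep E A \<Longrightarrow> indep E B \<Longrightarrow> u \<in> A \<Longrightarrow> w \<notin> A \<Longrightarrow> E u w \<Longrightarrow> B = insert w (A - {u}) \<Longrightarrow> step E A B"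
  unfolding step_def by blast

lemma step_sym:
  assumes "symp E" "step E A B" shows "step E B A"
proof -
  from assms(2) obtain u w where s: "indep E A" "indep E B" "u \<in> A" "w \<notin> A" "E u w" "B = insert w (A - {u})"
    unfolding step_def by blast
  show ?thesis by (rule stepI[of E B A w u]) (use s assms(1) in \<open>auto dest: sympD\<close>)
qed

lemma bij_betw_upd:
  assumes "bij_betw f A B" "a \<notin> A" "b \<notin> B"
  shows "bij_betw (f(a := b)) (insert a A) (insert b B)"
proof -
  have "(f(a := b)) x = f x" if "x \<in> A" for x using that assms(2) by auto
  then have "bij_betw (f(a := b)) A B" using bij_betw_cong[of A "f(a := b)" f B] assms(1) by blast
  moreover have "bij_betw (f(a := b)) {a} {b}" by (simp add: bij_betw_def)
  ultimately have "bij_betw (f(a := b)) (A \<union> {a}) (B \<union> {b})"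
    using assms(3) by (intro bij_betw_combine) auto
  then show ?thesis by simp
qed

text \<open>
  The holes \<open>H c\<close> are the pieces that may be exchanged for other large pieces, the planets \<open>P\<close> are the
  vertices outside of them.
\<close>

locale holes =
  fixes E :: "'a \<Rightarrow> 'a \<Rightarrow> bool" and Lab :: "'c set" and H :: "'c \<Rightarrow> 'a set" and P :: "'a set" and N :: nat
  assumes sym: "symp E" and irrefl: "\<not> E x x"
    and hole_edge: "c \<in> Lab \<Longrightarrow> c' \<in> Lab \<Longrightarrow> x \<in> H c \<Longrightarrow> y \<in> H c' \<Longrightarrow> x = y \<or> E x y \<Longrightarrow> c = c'"
    and connected: "c \<in> Lab \<Longrightarrow> x \<in> H c \<Longrightarrow> y \<in> H c \<Longrightarrow> (\<lambda>x y. x \<in> H c \<and> y \<in> H c \<and> E x y)\<^sup>*\<^sup>* x y"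
    and planets: "c \<in> Lab \<Longrightarrow> P \<inter> H c = {}"
    and roomy: "c \<in> Lab \<Longrightarrow> finite W \<Longrightarrow> W \<subseteq> (\<Union>c\<in>Lab. H c) \<Longrightarrow> card W \<le> N \<Longrightarrow>
      \<exists>q\<in>H c. \<forall>w\<in>W. \<not> (w = q \<or> E w q \<or> (\<exists>z. E w z \<and> E z q))"
begin

section \<open>Tokens inside and outside the holes\<close>

definition "HH = (\<Union>c\<in>Lab. H c)"

text \<open>Distance at most two, with a middle vertex inside a hole: rearrangements inside the
  holes follow walks that never visit a planet, so common neighbours on planets create no conflict
  for them.\<close>

definition close :: "'a \<Rightarrow> 'a \<Rightarrow> bool" where
  "close x y \<longleftrightarrow> x = y \<or> E x y \<or> (\<exists>z\<in>HH. E x z \<and> E z y)"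

definition spread :: "'a set \<Rightarrow> bool" where
  "spread C \<longleftrightarrow> finite C \<and> C \<subseteq> HH \<and> (\<forall>x\<in>C. \<forall>y\<in>C. x \<noteq> y \<longrightarrow> \<not> close x y)"

definition touch :: "'a \<Rightarrow> 'c \<Rightarrow> bool" where
  "touch x c \<longleftrightarrow> (\<exists>h\<in>H c. E x h)"

text \<open>Tokens on these planets are not adjacent to any token in a hole, hence neither block nor
  notice rearrangements there. They are copied literally by the simulation.\<close>

definition free :: "'a \<Rightarrow> bool" where
  "free x \<longleftrightarrow> x \<in> P \<and> (\<forall>c\<in>Lab. \<not> touch x c)"

definition outer :: "'a set \<Rightarrow> bool" where
  "outer O' \<longleftrightarrow> indep E O' \<and> (\<forall>x\<in>O'. free x)"

lemma E_sym: "E x y \<Longrightarrow> E y x"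
  using sym by (rule sympD)

lemma close_sym: "close x y \<Longrightarrow> close y x"
  unfolding close_def using E_sym by blast

lemma P_HH: "x \<in> P \<Longrightarrow> x \<notin> HH"
  unfolding HH_def using planets by blast

lemma free_HH: "free x \<Longrightarrow> y \<in> HH \<Longrightarrow> \<not> E x y \<and> \<not> E y x \<and> x \<noteq> y"
  unfolding free_def touch_def using E_sym[of y x] P_HH[of x] by (auto simp: HH_def)

lemma spread_indep:
  assumes "spread C" shows "indep E C"
  unfolding indep_def
proof (intro ballI notI)
  fix u w assume u: "u \<in> C" "w \<in> C" "E u w"
  then have "u \<noteq> w" using irrefl by blast
  then show False using u assms by (auto simp: spread_def close_def)
qed

lemma indep_Un:
  assumes "indep E A" "indep E B" and AB: "\<And>x y. x \<in> A \<Longrightarrow> y \<in> B \<Longrightarrow> \<not> E x y"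
  shows "indep E (A \<union> B)"
proof -
  have "\<not> E y x" if "x \<in> A" "y \<in> B" for x y using AB[OF that] E_sym[of y x] by blast
  then show ?thesis using assms unfolding indep_def by blast
qed

lemma indep_insert:
  assumes "indep E A" "\<And>y. y \<in> A \<Longrightarrow> \<not> E x y"
  shows "indep E (insert x A)"
proof -
  have "indep E ({x} \<union> A)" by (rule indep_Un) (use assms irrefl[of x] in \<open>auto simp: indep_def\<close>)
  then show ?thesis by simp
qed

lemma indep_config: "outer O' \<Longrightarrow> spread C \<Longrightarrow> indep E (O' \<union> C)"
  by (rule indep_Un) (use spread_indep free_HH in \<open>auto simp: outer_def spread_def subset_iff\<close>)

lemma spread_subset: "spread C \<Longrightarrow> D \<subseteq> C \<Longrightarrow> spread D"
  unfolding spread_def using finite_subset by blast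

lemma spread_insert: "spread C \<Longrightarrow> q \<in> HH \<Longrightarrow> (\<And>x. x \<in> C \<Longrightarrow> \<not> close x q) \<Longrightarrow> spread (insert q C)"
  unfolding spread_def using close_sym by blast

section \<open>Moving tokens inside the holes\<close>

lemma slide_walk:
  assumes "\<And>j. j \<le> m \<Longrightarrow> f j \<notin> R \<and> indep E (insert (f j) R)" "\<And>j. j < m \<Longrightarrow> E (f j) (f (Suc j))"
  shows "(step E)\<^sup>*\<^sup>* (insert (f 0) R) (insert (f m) R)"
  using assms
proof (induction m)
  case (Suc m)
  have "f m \<notin> R" "f (Suc m) \<notin> R" using Suc.prems(1)[of m] Suc.prems(1)[of "Suc m"] by auto
  moreover have "f (Suc m) \<noteq> f m" using Suc.prems(2)[of m] irrefl by force
  ultimately have "step E (insert (f m) R) (insert (f (Suc m)) R)"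
    by (intro stepI[of _ _ _ "f m" "f (Suc m)"]) (use Suc.prems in auto)
  moreover have "(step E)\<^sup>*\<^sup>* (insert (f 0) R) (insert (f m) R)" using Suc by simp
  ultimately show ?case by simp
qed simp

text \<open>
  The token nearest to the target along a walk from \<open>q\<close> to \<open>t\<close> can be moved to \<open>q\<close>, which leaves
  the shorter task of refilling its former place with the token \<open>t\<close>.
\<close>

lemma jump_walk:
  assumes O: "outer O'" and c: "c \<in> Lab"
  shows "spread C \<Longrightarrow> t \<in> C \<Longrightarrow> (\<And>x. x \<in> C \<Longrightarrow> \<not> close x q) \<Longrightarrow> f 0 = q \<Longrightarrow> f m = t \<Longrightarrow>
    (\<And>j. j \<le> m \<Longrightarrow> f j \<in> H c) \<Longrightarrow> (\<And>j. j < m \<Longrightarrow> E (f j) (f (Suc j))) \<Longrightarrow>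
    (step E)\<^sup>*\<^sup>* (O' \<union> C) (O' \<union> insert q (C - {t}))"
proof (induction m arbitrary: C q f rule: less_induct)
  case (less m)
  note C = less.prems(1) and t = less.prems(2) and q = less.prems(3) and f0 = less.prems(4)
    and fm = less.prems(5) and fH = less.prems(6) and fE = less.prems(7)
  define near where "near i \<longleftrightarrow> (\<exists>x\<in>C. x = f i \<or> E x (f i))" for i
  define i where "i = (LEAST i. near i)"
  have "near m" using t fm by (auto simp: near_def)
  then have i: "near i" "i \<le> m" "\<And>j. j < i \<Longrightarrow> \<not> near j"
    unfolding i_def using LeastI Least_le not_less_Least by metis+
  have fHH: "f j \<in> HH" if "j \<le> m" for j using fH[OF that] c by (auto simp: HH_def)
  have qHH: "q \<in> HH" using fHH[of 0] f0 by simp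
  \<comment> \<open>No token is close to \<open>q\<close>, so neither \<open>f 0 = q\<close> nor its
    neighbour \<open>f 1\<close> is near a token. Hence the walk left for the recursive call, of
    length \<open>m - i\<close> or \<open>Suc (m - i)\<close>, is shorter than
    \<open>m\<close>.\<close>
  have i2: "2 \<le> i"
  proof (rule ccontr)
    assume "\<not> 2 \<le> i"
    then consider "i = 0" | "i = 1" by linarith
    then show False
    proof cases
      case 1
      then show False using i(1) q f0 by (auto simp: near_def close_def)
    next
      case 2
      then have "E (f 1) q" "f 1 \<in> HH" using fE[of 0] f0 E_sym i(2) fHH[of 1] by auto
      then show False using i(1) q 2 by (auto simp: near_def close_def)
    qed
  qed
  obtain x where x: "x \<in> C" "x = f i \<or> E x (f i)" using i(1) by (auto simp: near_def)
  obtain c' where c': "c' \<in> Lab" "x \<in> H c'" using x(1) C by (auto simp: spread_def HH_def)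
  have xH: "x \<in> H c" using hole_edge[OF c'(1) c c'(2) fH[OF i(2)] x(2)] c'(2) by simp
  define R where "R = O' \<union> (C - {x})"
  have R: "indep E R" unfolding R_def by (rule indep_config[OF O spread_subset[OF C]]) auto
  have fR: "f j \<notin> R \<and> indep E (insert (f j) R)" if "j \<le> i" for j
  proof -
    have jHH: "f j \<in> HH" using fHH that i(2) by simp
    have "y \<noteq> f j \<and> \<not> E y (f j)" if y: "y \<in> C - {x}" for y
    proof (cases "j = i")
      \<comment> \<open>A second token equal or adjacent to \<open>f i\<close> would be close to
        \<open>x\<close> through \<open>f i\<close>, although the tokens are spread. Before position
        \<open>i\<close> the minimality of \<open>i\<close> is enough.\<close>
      case True
      have "close x y" if "y = f i \<or> E y (f i)"
        using that x(2) jHH True E_sym unfolding close_def by blast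
      then show ?thesis using C y x(1) True by (auto simp: spread_def)
    next
      case False
      then show ?thesis using i(3)[of j] \<open>j \<le> i\<close> y by (auto simp: near_def)
    qed
    moreover have "y \<noteq> f j \<and> \<not> E y (f j)" if "y \<in> O'" for y
      using free_HH[OF _ jHH, of y] O that by (auto simp: outer_def)
    ultimately have "y \<noteq> f j \<and> \<not> E (f j) y" if "y \<in> R" for y using that E_sym by (auto simp: R_def)
    then show ?thesis using indep_insert[OF R] by blast
  qed
  have xR: "x \<notin> R" using x(1) O free_HH[of x x] C by (auto simp: R_def outer_def spread_def)
  have OC: "O' \<union> C = insert x R" using x(1) by (auto simp: R_def)
  have "(step E)\<^sup>*\<^sup>* (insert (f i) R) (insert (f 0) R)"
  proof -
    have "E (f (i - j)) (f (i - Suc j))" if "j < i" for j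
      using E_sym[OF fE[of "i - Suc j"]] that i(2) by (simp add: Suc_diff_Suc)
    then show ?thesis using slide_walk[of i "\<lambda>j. f (i - j)" R] fR by simp
  qed
  moreover have "(step E)\<^sup>*\<^sup>* (insert x R) (insert (f i) R)"
  proof (cases "x = f i")
    case False
    have "step E (insert x R) (insert (f i) R)"
      by (rule stepI[of _ _ _ x "f i"]) (use False x(2) fR[of i] xR indep_config[OF O C] OC in auto)
    then show ?thesis by simp
  qed simp
  moreover have "insert (f 0) R = O' \<union> insert q (C - {x})" by (auto simp: R_def f0)
  ultimately have s1: "(step E)\<^sup>*\<^sup>* (O' \<union> C) (O' \<union> insert q (C - {x}))" unfolding OC by simp
  show ?case
  proof (cases "x = t")
    case False
    let ?C = "insert q (C - {x})"
    have C': "spread ?C" by (rule spread_insert[OF spread_subset[OF C] qHH]) (use q in auto)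
    have t': "t \<in> ?C" using t False by simp
    have far: "\<not> close y x" if "y \<in> ?C" for y
      using that C x(1) q[OF x(1)] close_sym by (auto simp: spread_def)
    have "(step E)\<^sup>*\<^sup>* (O' \<union> ?C) (O' \<union> insert x (?C - {t}))"
    proof (cases "x = f i")
      case True
      have "m - i < m" using i2 i(2) by simp
      then show ?thesis
        by (rule less.IH[OF _ C' t' far, of "m - i" "\<lambda>j. f (i + j)"]) (use True fm fH fE i(2) in auto)
    next
      case neq: False
      have "Suc (m - i) < m" using i2 i(2) by simp
      then show ?thesis
      proof (rule less.IH[OF _ C' t' far, of "Suc (m - i)" "\<lambda>j. if j = 0 then x else f (i + (j - 1))"])
        show "(if j = 0 then x else f (i + (j - 1))) \<in> H c" if "j \<le> Suc (m - i)" for j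
          using that xH i(2) by (auto intro!: fH)
        show "E (if j = 0 then x else f (i + (j - 1))) (if Suc j = 0 then x else f (i + (Suc j - 1)))"
          if "j < Suc (m - i)" for j
          using that x(2) neq i(2) fE[of "i + (j - 1)"] by (cases j) auto
      qed (use fm i(2) in auto)
    qed
    moreover have "insert x (?C - {t}) = insert q (C - {t})"
      using x(1) False q[OF t] by (auto simp: close_def)
    ultimately show ?thesis using s1 by simp
  qed (use s1 in simp)
qed

lemma jump:
  assumes O: "outer O'" and C: "spread C" and c: "c \<in> Lab" and t: "t \<in> C" "t \<in> H c" and q: "q \<in> H c"
    and far: "\<And>x. x \<in> C \<Longrightarrow> \<not> close x q"
  shows "(step E)\<^sup>*\<^sup>* (O' \<union> C) (O' \<union> insert q (C - {t}))"
proof -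
  let ?r = "\<lambda>x y. x \<in> H c \<and> y \<in> H c \<and> E x y"
  obtain m where "(?r ^^ m) q t" using connected[OF c q t(2)] rtranclp_imp_relpowp by metis
  then obtain f where f: "f 0 = q" "f m = t" "\<forall>j<m. ?r (f j) (f (Suc j))"
    unfolding relpowp_fun_conv by blast
  have fH: "f j \<in> H c" if "j \<le> m" for j
    using that f t by (cases "j = m") auto
  show ?thesis by (rule jump_walk[OF O c C t(1) far f(1,2)]) (use f(3) fH in simp_all)
qed

text \<open>While some token is close to \<open>W\<close>, \<open>roomy\<close> offers a place in
  its own hole that is far from all tokens and from \<open>W\<close>; jumping there lowers the
  number of offending tokens. The map \<open>g\<close> records that no token changes its
  hole.\<close>

lemma clear:
  assumes O: "outer O'" and W: "finite W" "W \<subseteq> HH"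
  shows "spread C \<Longrightarrow> card C + card W \<le> N \<Longrightarrow>
    \<exists>C' g. bij_betw g C C' \<and> (\<forall>x\<in>C. \<forall>c\<in>Lab. x \<in> H c \<longrightarrow> g x \<in> H c) \<and> spread C' \<and>
      (\<forall>x\<in>C'. \<forall>w\<in>W. \<not> close w x) \<and> (step E)\<^sup>*\<^sup>* (O' \<union> C) (O' \<union> C')"
proof (induction "card {x\<in>C. \<exists>w\<in>W. close w x}" arbitrary: C rule: less_induct)
  case less
  note C = less.prems(1)
  have fin: "finite C" using C by (simp add: spread_def)
  show ?case
  proof (cases "\<exists>t\<in>C. \<exists>w\<in>W. close w t")
    case False
    then show ?thesis using C by (intro exI[of _ C] exI[of _ id]) auto
  next
    case True
    then obtain t w where t: "t \<in> C" "w \<in> W" "close w t" by blast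
    then obtain c where c: "c \<in> Lab" "t \<in> H c" using C by (auto simp: spread_def HH_def)
    have "C \<union> W \<subseteq> (\<Union>c\<in>Lab. H c)" using C W by (auto simp: spread_def HH_def)
    moreover have "card (C \<union> W) \<le> N" using card_Un_le[of C W] less.prems(2) by linarith
    ultimately obtain q where q: "q \<in> H c" "\<forall>w\<in>C \<union> W. \<not> (w = q \<or> E w q \<or> (\<exists>z. E w z \<and> E z q))"
      using roomy[OF c(1), of "C \<union> W"] fin W by auto
    then have far: "\<not> close x q" if "x \<in> C \<union> W" for x using that unfolding close_def by blast
    have qC: "q \<notin> C" using far[of q] by (auto simp: close_def)
    let ?C = "insert q (C - {t})" and ?g = "id(t := q)"
    have qHH: "q \<in> HH" using q c by (auto simp: HH_def)
    have C': "spread ?C" by (rule spread_insert[OF spread_subset[OF C] qHH]) (use far in auto)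
    have s: "(step E)\<^sup>*\<^sup>* (O' \<union> C) (O' \<union> ?C)" by (rule jump[OF O C c(1) t(1) c(2) q(1)]) (use far in auto)
    have bij: "bij_betw ?g C ?C"
      unfolding bij_betw_def using qC t(1) by (auto simp: inj_on_def image_iff)
    have "{x\<in>?C. \<exists>w\<in>W. close w x} \<subseteq> {x\<in>C. \<exists>w\<in>W. close w x}" using far by auto
    moreover have "t \<in> {x\<in>C. \<exists>w\<in>W. close w x}" "t \<notin> {x\<in>?C. \<exists>w\<in>W. close w x}" using t qC by auto
    ultimately have "{x\<in>?C. \<exists>w\<in>W. close w x} \<subset> {x\<in>C. \<exists>w\<in>W. close w x}" by blast
    then have "card {x\<in>?C. \<exists>w\<in>W. close w x} < card {x\<in>C. \<exists>w\<in>W. close w x}"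
      using fin by (intro psubset_card_mono) auto
    moreover have "card ?C = card C" using bij_betw_same_card[OF bij] by simp
    then have "card ?C + card W \<le> N" using less.prems(2) by simp
    ultimately have "\<exists>C' g. bij_betw g ?C C' \<and> (\<forall>x\<in>?C. \<forall>c\<in>Lab. x \<in> H c \<longrightarrow> g x \<in> H c) \<and> spread C' \<and>
      (\<forall>x\<in>C'. \<forall>w\<in>W. \<not> close w x) \<and> (step E)\<^sup>*\<^sup>* (O' \<union> ?C) (O' \<union> C')" by (rule less.hyps[OF _ C'])
    then obtain C' g where g: "bij_betw g ?C C'" "\<forall>x\<in>?C. \<forall>c\<in>Lab. x \<in> H c \<longrightarrow> g x \<in> H c" "spread C'"
      "\<forall>x\<in>C'. \<forall>w\<in>W. \<not> close w x" "(step E)\<^sup>*\<^sup>* (O' \<union> ?C) (O' \<union> C')"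
      by (elim exE conjE)
    have "bij_betw (g \<circ> ?g) C C'" using bij g(1) by (rule bij_betw_trans)
    moreover have "(g \<circ> ?g) x \<in> H d" if x: "x \<in> C" "d \<in> Lab" "x \<in> H d" for x d
    proof (cases "x = t")
      case True
      then have "d = c" using hole_edge[OF x(2) c(1) x(3), of t] c(2) by simp
      then show ?thesis using True g(2) q(1) c(1) by simp
    qed (use x g(2) in simp)
    ultimately show ?thesis using g s by (intro exI[of _ C'] exI[of _ "g \<circ> ?g"]) auto
  qed
qed

text \<open>A token on planet \<open>d\<close> is hidden in a hole. The hypothesis
  \<open>far\<close> keeps all hole neighbours of \<open>d\<close> away from the tokens in holes, so
  that the result is spread again.\<close>

lemma absorb:
  assumes O: "outer O'" and C: "spread C" and d: "d \<in> P" "d \<notin> O'" "\<And>x. x \<in> O' \<Longrightarrow> \<not> E d x"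
    and h: "h \<in> HH" "E d h" and far: "\<And>x y. x \<in> C \<Longrightarrow> y \<in> HH \<Longrightarrow> E d y \<Longrightarrow> \<not> close y x"
  shows "step E (insert d O' \<union> C) (O' \<union> insert h C)" "spread (insert h C)" "h \<notin> C"
proof -
  show hC: "h \<notin> C" using far[of h h] h by (auto simp: close_def)
  show sp: "spread (insert h C)" by (rule spread_insert[OF C h(1)]) (use far[OF _ h] close_sym in blast)
  have dC: "\<not> E d x" if "x \<in> C" for x
    using far[of x x] that C by (auto simp: close_def spread_def)
  have "indep E (insert d (O' \<union> C))"
    by (rule indep_insert[OF indep_config[OF O C]]) (use dC d in auto)
  moreover have "d \<notin> C" using P_HH[OF d(1)] C by (auto simp: spread_def)
  moreover have "h \<notin> O'" using O free_HH[of h h] h by (auto simp: outer_def)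
  moreover have "h \<noteq> d" using h irrefl by blast
  ultimately show "step E (insert d O' \<union> C) (O' \<union> insert h C)"
    by (intro stepI[of _ _ _ d h] indep_config[OF O sp]) (use hC h d in auto)
qed

text \<open>The reverse of \<open>absorb\<close>: some token of a hole next to \<open>d\<close>
  jumps to the entrance \<open>h\<close> and then slides out. Any token \<open>y\<close> of that
  hole will do, which is why positions inside a hole need not be remembered.\<close>

lemma emit:
  assumes O: "outer O'" and C: "spread C" and d: "d \<in> P" "d \<notin> O'" "\<And>x. x \<in> O' \<Longrightarrow> \<not> E d x"
    and c: "c \<in> Lab" "touch d c" and y: "y \<in> C" "y \<in> H c"
    and far: "\<And>x y. x \<in> C \<Longrightarrow> y \<in> HH \<Longrightarrow> E d y \<Longrightarrow> \<not> close y x"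
  shows "(step E)\<^sup>*\<^sup>* (O' \<union> C) (insert d O' \<union> (C - {y}))"
proof -
  obtain h where h: "h \<in> H c" "E d h" using c(2) by (auto simp: touch_def)
  have hHH: "h \<in> HH" using h c by (auto simp: HH_def)
  have "(step E)\<^sup>*\<^sup>* (O' \<union> C) (O' \<union> insert h (C - {y}))"
    by (rule jump[OF O C c(1) y h(1)]) (use far[OF _ hHH h(2)] close_sym in blast)
  moreover have "step E (O' \<union> insert h (C - {y})) (insert d O' \<union> (C - {y}))"
    by (rule step_sym[OF sym], rule absorb(1)[OF O spread_subset[OF C] d hHH h(2)]) (use far in auto)
  ultimately show ?thesis by simp
qed


text \<open>
  Tokens of the first graph in a hole or on a planet next to a hole are represented by tokens
  inside the holes of the second graph.
\<close>

definition represents :: "('c \<Rightarrow> 'a set) \<Rightarrow> 'a set \<Rightarrow> 'a set \<Rightarrow> bool" where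
  "represents G A X \<longleftrightarrow> (\<exists>C f. X = {x\<in>A. free x} \<union> C \<and> spread C \<and> bij_betw f {x\<in>A. \<not> free x} C \<and>
     (\<forall>x\<in>A. \<not> free x \<longrightarrow> (\<exists>c\<in>Lab. (x \<in> G c \<or> (x \<in> P \<and> touch x c)) \<and> f x \<in> H c)))"

text \<open>\<open>E'\<close> with holes \<open>G\<close> is the graph being simulated,
  \<open>E\<close> with holes \<open>H\<close> the one in which moves are made. A token entering or
  touching a hole is hidden in the corresponding hole, and it is emitted only when it slides from a
  planet to a vertex that its hole does not account for. Each planet is next to at most
  \<open>D\<close> hole vertices, so \<open>N\<close> covers the tokens plus the surroundings of
  both ends of the slide.\<close>

lemma simulate_step:
  fixes E' :: "'a \<Rightarrow> 'a \<Rightarrow> bool" and G :: "'c \<Rightarrow> 'a set"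
  assumes sym': "symp E'"
    and same: "\<And>x y. x \<in> P \<Longrightarrow> y \<in> P \<Longrightarrow> E' x y = E x y"
    and touch': "\<And>x c. x \<in> P \<Longrightarrow> c \<in> Lab \<Longrightarrow> (\<exists>h\<in>G c. E' x h) = touch x c"
    and edge': "\<And>c c' x y. c \<in> Lab \<Longrightarrow> c' \<in> Lab \<Longrightarrow> x \<in> G c \<Longrightarrow> y \<in> G c' \<Longrightarrow> x = y \<or> E' x y \<Longrightarrow> c = c'"
    and planets': "\<And>c. c \<in> Lab \<Longrightarrow> P \<inter> G c = {}"
    and closed: "\<And>x y. x \<in> P \<union> (\<Union>c\<in>Lab. G c) \<Longrightarrow> E' x y \<Longrightarrow> y \<in> P \<union> (\<Union>c\<in>Lab. G c)"
    and degree: "\<And>u. u \<in> P \<Longrightarrow> finite {h\<in>HH. E u h} \<and> card {h\<in>HH. E u h} \<le> D"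
    and N: "card A + 2 * D \<le> N" and A: "finite A" "A \<subseteq> P \<union> (\<Union>c\<in>Lab. G c)"
    and rep: "represents G A X" and st: "step E' A A'"
  shows "\<exists>X'. (step E)\<^sup>*\<^sup>* X X' \<and> represents G A' X'"
proof -
  define O1 where "O1 = {x\<in>A. free x}"
  define I1 where "I1 = {x\<in>A. \<not> free x}"
  obtain C0 f0 where r: "X = O1 \<union> C0" "spread C0" "bij_betw f0 I1 C0"
    "\<And>x. x \<in> I1 \<Longrightarrow> \<exists>c\<in>Lab. (x \<in> G c \<or> (x \<in> P \<and> touch x c)) \<and> f0 x \<in> H c"
    using rep unfolding represents_def O1_def I1_def by blast
  obtain u w where s: "indep E' A" "indep E' A'" "u \<in> A" "w \<notin> A" "E' u w" "A' = insert w (A - {u})"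
    using st unfolding step_def by blast
  have freeP: "free x \<Longrightarrow> x \<in> P" for x by (simp add: free_def)
  have free_indep: "indep E {x\<in>B. free x}" if "indep E' B" for B
    using that same freeP unfolding indep_def by blast
  have O: "outer O1" using free_indep[OF s(1)] by (simp add: outer_def O1_def)
  \<comment> \<open>All entrances to holes next to \<open>u\<close> or \<open>w\<close> are cleared
    in advance, so that every \<open>absorb\<close> and \<open>emit\<close> below finds its
    \<open>far\<close> hypothesis satisfied.\<close>
  define W where "W = {h\<in>HH. (u \<in> P \<and> E u h) \<or> (w \<in> P \<and> E w h)}"
  have W: "finite W" "card W \<le> 2 * D"
  proof -
    define Wx where "Wx x = (if x \<in> P then {h\<in>HH. E x h} else {})" for x
    have Wx: "finite (Wx x)" "card (Wx x) \<le> D" for x using degree[of x] by (auto simp: Wx_def)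
    have eq: "W = Wx u \<union> Wx w" by (auto simp: W_def Wx_def)
    show "finite W" using Wx by (simp add: eq)
    show "card W \<le> 2 * D" using card_Un_le[of "Wx u" "Wx w"] Wx(2)[of u] Wx(2)[of w] by (simp add: eq)
  qed
  have "card C0 = card I1" using bij_betw_same_card[OF r(3)] by simp
  then have "card C0 \<le> card A" using A(1) card_mono[of A I1] by (auto simp: I1_def)
  then have le: "card C0 + card W \<le> N" using W(2) N by linarith
  have WHH: "W \<subseteq> HH" by (auto simp: W_def)
  from clear[OF O W(1) WHH r(2) le] obtain C g where C: "bij_betw g C0 C" "\<forall>x\<in>C0. \<forall>c\<in>Lab. x \<in> H c \<longrightarrow> g x \<in> H c" "spread C"
    "\<forall>x\<in>C. \<forall>w\<in>W. \<not> close w x" "(step E)\<^sup>*\<^sup>* (O1 \<union> C0) (O1 \<union> C)"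
    by (elim exE conjE)
  define f where "f = g \<circ> f0"
  have f: "bij_betw f I1 C" unfolding f_def by (rule bij_betw_trans[OF r(3) C(1)])
  have place: "\<exists>c\<in>Lab. (x \<in> G c \<or> (x \<in> P \<and> touch x c)) \<and> f x \<in> H c" if "x \<in> I1" for x
  proof -
    from r(4)[OF that] obtain c where c: "c \<in> Lab" "x \<in> G c \<or> (x \<in> P \<and> touch x c)" "f0 x \<in> H c" by blast
    have "f x \<in> H c" using C(2)[rule_format, OF bij_betw_apply[OF r(3) that] c(1,3)] by (simp add: f_def)
    then show ?thesis using c by blast
  qed
  have far: "\<not> close y x" if "x \<in> C" "y \<in> HH" "(u \<in> P \<and> E u y) \<or> (w \<in> P \<and> E w y)" for x y
    using C(4) that by (auto simp: W_def)
  have CHH: "C \<subseteq> HH" using C(3) by (simp add: spread_def)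
  have w: "w \<in> P \<union> (\<Union>c\<in>Lab. G c)" using closed[OF _ s(5)] s(3) A(2) by blast
  have wu: "w \<noteq> u" using s(3,4) by blast
  have E'sym: "E' x y \<Longrightarrow> E' y x" for x y using sym' by (rule sympD)
  have far1: "\<not> E u x" if "u \<in> P" "x \<in> C" for x
    using far[OF that(2), of x] that CHH by (auto simp: close_def)
  have far2: "\<not> E w x" if "w \<in> P" "x \<in> C" for x
    using far[OF that(2), of x] that CHH by (auto simp: close_def)
  have O_u: "\<not> E u x" if "u \<in> P" "x \<in> O1" for x
    using that s(1,3) same[of u x] freeP[of x] by (simp add: indep_def O1_def)
  have O_w: "\<not> E w x" if "w \<in> P" "x \<in> O1 - {u}" for x
    using that s(2,6) same[of w x] freeP[of x] by (simp add: indep_def O1_def)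
  have wO: "w \<notin> O1" using s(4) by (simp add: O1_def)
  have O': "outer (O1 - {u})" using O by (auto simp: outer_def indep_def)
  \<comment> \<open>The clearing phase is prepended here once; each case below starts from the
    cleared configuration \<open>O1 \<union> C\<close>.\<close>
  have goal: ?thesis if "(step E)\<^sup>*\<^sup>* (O1 \<union> C) ({x\<in>A'. free x} \<union> D')" "spread D'"
      "bij_betw f' {x\<in>A'. \<not> free x} D'"
      "\<forall>x\<in>A'. \<not> free x \<longrightarrow> (\<exists>c\<in>Lab. (x \<in> G c \<or> (x \<in> P \<and> touch x c)) \<and> f' x \<in> H c)" for D' f'
  proof (intro exI conjI)
    show "(step E)\<^sup>*\<^sup>* X ({x\<in>A'. free x} \<union> D')"
      unfolding r(1) using C(5) that(1) by (rule rtranclp_trans)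
    show "represents G A' ({x\<in>A'. free x} \<union> D')"
      unfolding represents_def by (intro exI[of _ D'] exI[of _ f'] conjI refl that(2-4))
  qed
  have del: "bij_betw f (I1 - {u}) (C - {f u})" if "u \<in> I1"
    using f that unfolding bij_betw_def by (auto simp: inj_on_def)
  have w1: "w \<notin> I1" using s(4) by (simp add: I1_def)
  show ?thesis
  proof (cases "free u")
    case u: True
    have uP: "u \<in> P" and uO: "u \<in> O1" using u freeP s(3) by (auto simp: O1_def)
    have wP: "w \<in> P"
    proof (rule ccontr)
      assume "w \<notin> P"
      then obtain c where "c \<in> Lab" "w \<in> G c" using w by blast
      then show False using touch'[OF uP, of c] s(5) u by (auto simp: free_def)
    qed
    have uC: "u \<notin> C" using free_HH[OF u] CHH by blast
    have wC: "w \<notin> C" using P_HH[OF wP] CHH by blast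
    have Ew: "E u w" using s(5) same uP wP by blast
    have "indep E (insert w ((O1 - {u}) \<union> C))"
      by (rule indep_insert[OF indep_config[OF O' C(3)]]) (use O_w far2 wP in auto)
    then have s1: "step E (O1 \<union> C) (insert w (O1 - {u}) \<union> C)"
      by (intro stepI[of _ _ _ u w] indep_config[OF O C(3)]) (use uO uC wO wC Ew in auto)
    show ?thesis
    proof (cases "free w")
      case True
      have A': "{x\<in>A'. free x} = insert w (O1 - {u})" "{x\<in>A'. \<not> free x} = I1"
        using s(6) u True by (auto simp: O1_def I1_def)
      show ?thesis by (rule goal[of C f]) (use A' s1 C(3) f place in \<open>auto simp: I1_def\<close>)
    next
      case False
      then obtain c h where c: "c \<in> Lab" "h \<in> H c" "E w h" using wP by (auto simp: free_def touch_def)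
      have hHH: "h \<in> HH" using c by (auto simp: HH_def)
      have ab: "step E (insert w (O1 - {u}) \<union> C) ((O1 - {u}) \<union> insert h C)" "spread (insert h C)" "h \<notin> C"
        by (rule absorb[OF O' C(3) wP _ _ hHH c(3)]; use wO O_w wP far in auto)+
      have A': "{x\<in>A'. free x} = O1 - {u}" "{x\<in>A'. \<not> free x} = insert w I1"
        using s(6) u False by (auto simp: O1_def I1_def)
      have bij: "bij_betw (f(w := h)) (insert w I1) (insert h C)"
        by (rule bij_betw_upd[OF f w1 ab(3)])
      have pl: "\<exists>c\<in>Lab. (x \<in> G c \<or> (x \<in> P \<and> touch x c)) \<and> (f(w := h)) x \<in> H c" if "x \<in> insert w I1" for x
        using that place w1 c wP by (cases "x = w") (auto simp: touch_def)
      show ?thesis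
      proof (rule goal[of "insert h C" "f(w := h)"])
        show "(step E)\<^sup>*\<^sup>* (O1 \<union> C) ({x\<in>A'. free x} \<union> insert h C)" unfolding A' using s1 ab(1) by simp
        show "\<forall>x\<in>A'. \<not> free x \<longrightarrow> (\<exists>c\<in>Lab. (x \<in> G c \<or> (x \<in> P \<and> touch x c)) \<and> (f(w := h)) x \<in> H c)"
          using pl A'(2) by blast
      qed (use ab(2) bij A' in simp_all)
    qed
  next
    case u: False
    have uI: "u \<in> I1" using u s(3) by (simp add: I1_def)
    have uO: "u \<notin> O1" using u by (simp add: O1_def)
    then have O1u: "O1 - {u} = O1" by simp
    obtain c where c: "c \<in> Lab" "u \<in> G c \<or> (u \<in> P \<and> touch u c)" "f u \<in> H c" using place[OF uI] by blast
    define y where "y = f u"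
    have y: "y \<in> C" "y \<in> H c" using bij_betw_apply[OF f uI] c(3) by (auto simp: y_def)
    have spy: "spread (C - {y})" by (rule spread_subset[OF C(3)]) auto
    have emit_u: "(step E)\<^sup>*\<^sup>* (O1 \<union> C) (insert u O1 \<union> (C - {y}))" if "u \<in> P" "touch u c"
      by (rule emit[OF O C(3) that(1) uO _ c(1) that(2) y]) (use O_u far that in auto)
    have move: "(step E)\<^sup>*\<^sup>* (insert u O1 \<union> (C - {y})) (insert w O1 \<union> (C - {y}))" if P: "u \<in> P" "w \<in> P"
    proof -
      have uC: "u \<notin> C" "w \<notin> C" using P_HH P CHH by blast+
      have i1: "indep E (insert u (O1 \<union> (C - {y})))" "indep E (insert w (O1 \<union> (C - {y})))"
        by (rule indep_insert[OF indep_config[OF O spy]]; use O_u O_w far1 far2 P O1u in auto)+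
      have "step E (insert u O1 \<union> (C - {y})) (insert w O1 \<union> (C - {y}))"
        by (intro stepI[of _ _ _ u w]) (use i1 uC uO wO wu s(5) same P in auto)
      then show ?thesis by simp
    qed
    show ?thesis
    proof (cases "free w")
      case True
      then have wP: "w \<in> P" by (rule freeP)
      have uP: "u \<in> P"
      proof (rule ccontr)
        assume "u \<notin> P"
        then have "u \<in> G c" using c by blast
        then show False using touch'[OF wP c(1)] E'sym[OF s(5)] True c(1) by (auto simp: free_def)
      qed
      then have tu: "touch u c" using c(2) planets'[OF c(1)] by blast
      have A': "{x\<in>A'. free x} = insert w O1" "{x\<in>A'. \<not> free x} = I1 - {u}"
        using s(6) u True by (auto simp: O1_def I1_def)
      have "bij_betw f (I1 - {u}) (C - {y})" using del[OF uI] by (simp add: y_def)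
      moreover have "(step E)\<^sup>*\<^sup>* (O1 \<union> C) (insert w O1 \<union> (C - {y}))"
        by (rule rtranclp_trans[OF emit_u[OF uP tu] move[OF uP wP]])
      moreover have "\<forall>x\<in>A'. \<not> free x \<longrightarrow> (\<exists>c\<in>Lab. (x \<in> G c \<or> (x \<in> P \<and> touch x c)) \<and> f x \<in> H c)"
        using place A'(2) by blast
      ultimately show ?thesis using spy by (intro goal[of "C - {y}" f]) (simp_all only: A')
    next
      case False
      have A': "{x\<in>A'. free x} = O1" "{x\<in>A'. \<not> free x} = insert w (I1 - {u})"
        using s(6) u False by (auto simp: O1_def I1_def)
      have finish: ?thesis if "(step E)\<^sup>*\<^sup>* (O1 \<union> C) (O1 \<union> insert h (C - {y}))" "spread (insert h (C - {y}))"
        "h \<notin> C - {y}" "d \<in> Lab" "w \<in> G d \<or> (w \<in> P \<and> touch w d)" "h \<in> H d" for h d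
      proof -
        have bij: "bij_betw (f(w := h)) (insert w (I1 - {u})) (insert h (C - {y}))"
          using del[OF uI] w1 that(3) by (intro bij_betw_upd) (auto simp: y_def)
        have pl: "\<exists>c\<in>Lab. (x \<in> G c \<or> (x \<in> P \<and> touch x c)) \<and> (f(w := h)) x \<in> H c"
          if "x \<in> insert w (I1 - {u})" for x
          using that place w1 \<open>d \<in> Lab\<close> \<open>w \<in> G d \<or> (w \<in> P \<and> touch w d)\<close> \<open>h \<in> H d\<close> by (cases "x = w") auto
        show ?thesis
        proof (rule goal[of "insert h (C - {y})" "f(w := h)"])
          show "\<forall>x\<in>A'. \<not> free x \<longrightarrow> (\<exists>c\<in>Lab. (x \<in> G c \<or> (x \<in> P \<and> touch x c)) \<and> (f(w := h)) x \<in> H c)"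
            using pl A'(2) by blast
        qed (use that(1,2) bij A' in simp_all)
      qed
      show ?thesis
      proof (cases "w \<in> G c \<or> (w \<in> P \<and> touch w c)")
        case True
        \<comment> \<open>The hole \<open>c\<close> that stands for the token on \<open>u\<close>
          also accounts for \<open>w\<close>; no token moves, only the representative
          \<open>y\<close> is renamed.\<close>
        show ?thesis by (rule finish[OF _ _ _ c(1) True y(2)]) (use y C(3) in \<open>auto simp: insert_absorb\<close>)
      next
        case no: False
        \<comment> \<open>From inside the hole \<open>G c\<close> a slide leads either into
          \<open>G c\<close> again or to a planet touching it, and both have just been excluded. So
          \<open>u\<close> is a planet, and its token has to be emitted first.\<close>
        have uP: "u \<in> P"
        proof (rule ccontr)
          assume "u \<notin> P"
          then have uG: "u \<in> G c" using c by blast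
          have "w \<notin> P"
          proof
            assume "w \<in> P"
            then show False using touch'[OF _ c(1), of w] E'sym[OF s(5)] uG no by blast
          qed
          then obtain d where "d \<in> Lab" "w \<in> G d" using w by blast
          then show False using edge'[OF c(1) _ uG, of d w] s(5) no by blast
        qed
        then have tu: "touch u c" using c(2) planets'[OF c(1)] by blast
        show ?thesis
        proof (cases "w \<in> P")
          case False
          then obtain d where d: "d \<in> Lab" "w \<in> G d" using w by blast
          then have "touch u d" using touch'[OF uP d(1)] s(5) by blast
          then obtain h where h: "h \<in> H d" "E u h" by (auto simp: touch_def)
          have hHH: "h \<in> HH" using h d by (auto simp: HH_def)
          have ab: "step E (insert u O1 \<union> (C - {y})) (O1 \<union> insert h (C - {y}))" "spread (insert h (C - {y}))"
            by (rule absorb[OF O spy uP uO _ hHH h(2)]; use O_u uP far in auto)+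
          have hC: "h \<notin> C" using far[of h h] hHH h(2) uP by (auto simp: close_def)
          have "(step E)\<^sup>*\<^sup>* (O1 \<union> C) (O1 \<union> insert h (C - {y}))"
            by (rule rtranclp.rtrancl_into_rtrancl[OF emit_u[OF uP tu] ab(1)])
          then show ?thesis by (rule finish[OF _ ab(2) _ d(1) _ h(1)]) (use hC d(2) in auto)
        next
          case wP: True
          then obtain d h where d: "d \<in> Lab" "h \<in> H d" "E w h"
            using \<open>\<not> free w\<close> by (auto simp: touch_def free_def)
          have hHH: "h \<in> HH" using d by (auto simp: HH_def)
          have ab: "step E (insert w O1 \<union> (C - {y})) (O1 \<union> insert h (C - {y}))" "spread (insert h (C - {y}))"
            by (rule absorb[OF O spy wP wO _ hHH d(3)]; use O_w O1u wP far in auto)+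
          have hC: "h \<notin> C" using far[of h h] hHH d(3) wP by (auto simp: close_def)
          have "(step E)\<^sup>*\<^sup>* (O1 \<union> C) (insert w O1 \<union> (C - {y}))"
            by (rule rtranclp_trans[OF emit_u[OF uP tu] move[OF uP wP]])
          then have "(step E)\<^sup>*\<^sup>* (O1 \<union> C) (O1 \<union> insert h (C - {y}))"
            using ab(1) by (rule rtranclp.rtrancl_into_rtrancl)
          then show ?thesis by (rule finish[OF _ ab(2) _ d(1) _ d(2)]) (use hC wP d in \<open>auto simp: touch_def\<close>)
        qed
      qed
    qed
  qed
qed

text \<open>At both ends every token is free, so the hidden part of the representation is empty: the
  simulation starts at \<open>S\<close> itself and has to end at \<open>T\<close> itself.\<close>

lemma simulate:
  fixes E' :: "'a \<Rightarrow> 'a \<Rightarrow> bool" and G :: "'c \<Rightarrow> 'a set"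
  assumes sym': "symp E'"
    and same: "\<And>x y. x \<in> P \<Longrightarrow> y \<in> P \<Longrightarrow> E' x y = E x y"
    and touch': "\<And>x c. x \<in> P \<Longrightarrow> c \<in> Lab \<Longrightarrow> (\<exists>h\<in>G c. E' x h) = touch x c"
    and edge': "\<And>c c' x y. c \<in> Lab \<Longrightarrow> c' \<in> Lab \<Longrightarrow> x \<in> G c \<Longrightarrow> y \<in> G c' \<Longrightarrow> x = y \<or> E' x y \<Longrightarrow> c = c'"
    and planets': "\<And>c. c \<in> Lab \<Longrightarrow> P \<inter> G c = {}"
    and closed: "\<And>x y. x \<in> P \<union> (\<Union>c\<in>Lab. G c) \<Longrightarrow> E' x y \<Longrightarrow> y \<in> P \<union> (\<Union>c\<in>Lab. G c)"
    and degree: "\<And>u. u \<in> P \<Longrightarrow> finite {h\<in>HH. E u h} \<and> card {h\<in>HH. E u h} \<le> D"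
    and N: "card S + 2 * D \<le> N" and S: "finite S" "\<And>x. x \<in> S \<union> T \<Longrightarrow> free x"
    and st: "(step E')\<^sup>*\<^sup>* S T"
  shows "(step E)\<^sup>*\<^sup>* S T"
proof -
  have "\<exists>X. (step E)\<^sup>*\<^sup>* S X \<and> represents G A X \<and> finite A \<and> card A = card S \<and> A \<subseteq> P \<union> (\<Union>c\<in>Lab. G c)"
    if "(step E')\<^sup>*\<^sup>* S A" for A
    using that
  proof (induction rule: rtranclp_induct)
    case base
    have "represents G S S"
    proof -
      have "{x\<in>S. free x} = S" "{x\<in>S. \<not> free x} = {}" using S(2) by auto
      then show ?thesis
        unfolding represents_def using S(2)
        by (intro exI[of _ "{}"] exI[of _ id]) (simp add: spread_def bij_betw_def)
    qed
    moreover have "S \<subseteq> P" using S(2) by (auto simp: free_def)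
    ultimately show ?case using S(1) by (intro exI[of _ S]) auto
  next
    case (step A A')
    from step.IH obtain X where X: "(step E)\<^sup>*\<^sup>* S X" "represents G A X" "finite A" "card A = card S"
      "A \<subseteq> P \<union> (\<Union>c\<in>Lab. G c)" by (elim exE conjE)
    from step(2) obtain u w where s: "u \<in> A" "w \<notin> A" "E' u w" "A' = insert w (A - {u})"
      unfolding step_def by blast
    have le: "card A + 2 * D \<le> N" using N X(4) by simp
    have "\<exists>X'. (step E)\<^sup>*\<^sup>* X X' \<and> represents G A' X'"
    proof (rule simulate_step[where E' = E' and G = G and D = D and A = A])
      show "step E' A A'" by (rule step(2))
    qed (fact sym' same touch' edge' planets' closed degree le X)+
    then obtain X' where X': "(step E)\<^sup>*\<^sup>* X X'" "represents G A' X'" by (elim exE conjE)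
    have "w \<in> P \<union> (\<Union>c\<in>Lab. G c)" by (rule closed[OF _ s(3)]) (use s(1) X(5) in blast)
    then have "A' \<subseteq> P \<union> (\<Union>c\<in>Lab. G c)" using s X(5) by blast
    moreover have "card A' = card A" using s X(3) card.remove[of A u] by simp
    ultimately show ?case using X(1,3,4) X' s(4) by (intro exI[of _ X']) auto
  qed
  from this[OF st] obtain X where X: "(step E)\<^sup>*\<^sup>* S X" "represents G T X" by (elim exE conjE)
  have "{x\<in>T. free x} = T" "{x\<in>T. \<not> free x} = {}" using S(2) by auto
  then have "X = T" using X(2) by (auto simp: represents_def bij_betw_def)
  then show ?thesis using X(1) by simp
qed

end

section \<open>Replacing large components by short paths\<close>

lemma rank_bij:
  fixes S :: "nat set" assumes "finite S"
  shows "bij_betw (\<lambda>a. card {x\<in>S. x < a}) S {..<card S}"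
proof -
  have mono: "card {x\<in>S. x < a} < card {x\<in>S. x < b}" if "a \<in> S" "a < b" for a b
    using that assms by (intro psubset_card_mono) auto
  have inj: "inj_on (\<lambda>a. card {x\<in>S. x < a}) S"
  proof (rule inj_onI)
    fix a b assume ab: "a \<in> S" "b \<in> S" "card {x\<in>S. x < a} = card {x\<in>S. x < b}"
    show "a = b" using mono[of a b] mono[of b a] ab by (cases a b rule: linorder_cases) auto
  qed
  have "(\<lambda>a. card {x\<in>S. x < a}) ` S \<subseteq> {..<card S}"
    using assms by (auto intro!: psubset_card_mono)
  moreover have "card ((\<lambda>a. card {x\<in>S. x < a}) ` S) = card S" using inj by (rule card_image)
  ultimately show ?thesis unfolding bij_betw_def using inj by (simp add: card_subset_eq)
qed

text \<open>A connected graph on \<open>m\<close> vertices has at least \<open>m - 1\<close> edges,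
  each counted at both ends. The vertex set is grown by one vertex at a time, always across an edge
  leaving the current set.\<close>

lemma connected_degree_sum:
  fixes A :: "'a \<Rightarrow> 'a \<Rightarrow> bool"
  assumes fin: "finite c" and sym: "symp A"
    and conn: "\<And>x y. x \<in> c \<Longrightarrow> y \<in> c \<Longrightarrow> A\<^sup>*\<^sup>* x y" and clo: "\<And>x y. x \<in> c \<Longrightarrow> A x y \<Longrightarrow> y \<in> c"
  shows "2 * card c \<le> (\<Sum>v\<in>c. card {w. A v w}) + 2"
proof (cases "c = {}")
  case False
  have "\<exists>B\<subseteq>c. card B = Suc m \<and> 2 * m \<le> (\<Sum>v\<in>B. card {w\<in>B. A v w})" if "Suc m \<le> card c" for m
    using that
  proof (induction m)
    case 0
    obtain x where "x \<in> c" using False by blast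
    then show ?case by (intro exI[of _ "{x}"]) auto
  next
    case (Suc m)
    then obtain B where B: "B \<subseteq> c" "card B = Suc m" "2 * m \<le> (\<Sum>v\<in>B. card {w\<in>B. A v w})" by auto
    have finB: "finite B" using B(1) fin finite_subset by blast
    have "B \<noteq> c" "B \<noteq> {}" using B(2) Suc.prems by auto
    then obtain x y where y: "y \<in> c" "y \<notin> B" and x: "x \<in> B" using B(1) by blast
    have "\<exists>u\<in>B. \<exists>v. v \<notin> B \<and> A u v"
    proof (rule ccontr)
      assume no: "\<not> ?thesis"
      have "A\<^sup>*\<^sup>* x z \<Longrightarrow> z \<in> B" for z
        by (induction rule: rtranclp_induct) (use x no in auto)
      then show False using conn[of x y] x y B(1) by blast
    qed
    then obtain u v where uv: "u \<in> B" "v \<notin> B" "A u v" by blast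
    have vc: "v \<in> c" using clo uv B(1) by blast
    let ?B = "insert v B"
    have vu: "A v u" using uv(3) sym by (auto dest: sympD)
    have "2 * Suc m \<le> (\<Sum>a\<in>B. card {w\<in>B. A a w}) + 2" using B(3) by simp
    also have "(\<Sum>a\<in>B. card {w\<in>B. A a w}) + 1 \<le> (\<Sum>a\<in>B. card {w\<in>?B. A a w})"
    proof -
      have "card {w\<in>?B. A a w} \<ge> card {w\<in>B. A a w}" for a using finB by (intro card_mono) auto
      moreover have "card {w\<in>?B. A u w} > card {w\<in>B. A u w}"
        using finB uv by (intro psubset_card_mono) auto
      ultimately have "(\<Sum>a\<in>B. card {w\<in>B. A a w}) < (\<Sum>a\<in>B. card {w\<in>?B. A a w})"
        using finB uv(1) by (intro sum_strict_mono_ex1) auto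
      then show ?thesis by simp
    qed
    then have "(\<Sum>a\<in>B. card {w\<in>B. A a w}) + 2 \<le> (\<Sum>a\<in>B. card {w\<in>?B. A a w}) + 1" by simp
    also have "1 \<le> card {w\<in>?B. A v w}"
    proof -
      have "u \<in> {w\<in>?B. A v w}" using uv vu by auto
      then have "{w\<in>?B. A v w} \<noteq> {}" by (metis empty_iff)
      then have "0 < card {w\<in>?B. A v w}" using finB by (simp add: card_gt_0_iff)
      then show ?thesis by simp
    qed
    then have "(\<Sum>a\<in>B. card {w\<in>?B. A a w}) + 1 \<le> (\<Sum>a\<in>?B. card {w\<in>?B. A a w})"
      using finB uv(2) by simp
    finally show ?case using B vc uv(2) finB by (intro exI[of _ ?B]) auto
  qed
  from this[of "card c - 1"] obtain B where B: "B \<subseteq> c" "card B = card c"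
    "2 * (card c - 1) \<le> (\<Sum>v\<in>B. card {w\<in>B. A v w})"
    using False fin by (auto simp: card_gt_0_iff Suc_diff_le)
  then have "B = c" using fin by (simp add: card_subset_eq)
  moreover have "{w\<in>c. A v w} = {w. A v w}" if "v \<in> c" for v using clo that by blast
  ultimately show ?thesis using B(3) by simp
qed simp

text \<open>A ball of radius two has at most \<open>1 + D + D * D\<close> vertices, so
  \<open>N\<close> such balls cannot cover \<open>c\<close>.\<close>

lemma roomy_card:
  fixes E :: "'a \<Rightarrow> 'a \<Rightarrow> bool"
  assumes deg: "\<And>v. finite {w. E v w} \<and> card {w. E v w} \<le> D"
    and W: "finite W" "card W \<le> N" and c: "N * (1 + D + D * D) < card c"
  shows "\<exists>q\<in>c. \<forall>w\<in>W. \<not> (w = q \<or> E w q \<or> (\<exists>z. E w z \<and> E z q))"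
proof -
  define B where "B w = insert w ({q. E w q} \<union> (\<Union>z\<in>{z. E w z}. {q. E z q}))" for w
  have F: "finite {q. E w q}" "card {q. E w q} \<le> D" for w using deg[of w] by auto
  have B: "card (B w) \<le> 1 + D + D * D" "finite (B w)" for w
  proof -
    let ?S = "\<Union>z\<in>{z. E w z}. {q. E z q}"
    have "card ?S \<le> (\<Sum>z\<in>{z. E w z}. card {q. E z q})"
      by (rule card_UN_le) (rule F)
    also have "\<dots> \<le> of_nat (card {z. E w z}) * D" by (rule sum_bounded_above) (rule F)
    also have "\<dots> \<le> D * D" using F(2)[of w] by (simp add: mult_le_mono1)
    finally have S: "card ?S \<le> D * D" .
    have finS: "finite ?S" by (rule finite_UN_I; rule F)
    have "card (B w) \<le> Suc (card ({q. E w q} \<union> ?S))"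
      unfolding B_def using finS F(1)[of w] by (simp add: card_insert_if)
    moreover have "card ({q. E w q} \<union> ?S) \<le> card {q. E w q} + card ?S" by (rule card_Un_le)
    ultimately show "card (B w) \<le> 1 + D + D * D" using S F(2)[of w] by linarith
    show "finite (B w)" unfolding B_def using finS F(1)[of w] by simp
  qed
  have "card (\<Union>w\<in>W. B w) \<le> (\<Sum>w\<in>W. card (B w))" using W(1) by (rule card_UN_le)
  also have "\<dots> \<le> of_nat (card W) * (1 + D + D * D)" by (rule sum_bounded_above) (rule B)
  also have "\<dots> \<le> N * (1 + D + D * D)" unfolding of_nat_id using W(2) by (rule mult_le_mono1)
  finally have lt: "card (\<Union>w\<in>W. B w) < card c" using c by linarith
  have "finite (\<Union>w\<in>W. B w)" using B(2) W(1) by simp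
  then have "\<not> c \<subseteq> (\<Union>w\<in>W. B w)" using card_mono[of "\<Union>w\<in>W. B w" c] lt by linarith
  then obtain q where q: "q \<in> c" "q \<notin> (\<Union>w\<in>W. B w)" by blast
  show ?thesis by (rule bexI[OF _ q(1)]) (use q(2) in \<open>auto simp: B_def\<close>)
qed

text \<open>
  \<open>U\<close> is the union of the two given independent sets and \<open>X\<close> its closed neighbourhood. The components
  of the rest graph \<open>A\<close> are the classes of \<open>R\<close>. In a component with at least \<open>T\<close> vertices, a path
  is formed by the vertices \<open>v\<close> of smallest rank \<open>rk v\<close>, where vertices of consecutive ranks are adjacent.
  A vertex \<open>d\<close> of \<open>X\<close> with a neighbour in the component of \<open>v\<close> is attached to the vertex of rank
  \<open>pos d v\<close>. The smallest such \<open>d\<close> is attached to one end of the path, and the largest one to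
  the other end; the parity of \<open>pos d v\<close> keeps the graph bipartite.
\<close>

locale shrink_defs =
  fixes n :: nat and E :: "nat \<Rightarrow> nat \<Rightarrow> bool" and U :: "nat \<Rightarrow> bool" and M T :: nat
begin

definition X where "X v \<longleftrightarrow> v < n \<and> (U v \<or> (\<exists>u<n. U u \<and> E u v))"

definition A where "A u v \<longleftrightarrow> E u v \<and> \<not> X u \<and> \<not> X v"

text \<open>No colouring is part of the input. Inside a component of \<open>A\<close>, walks of even
  length recover the colour classes, and with one optional further edge they give the component
  itself.\<close>

definition even_walk where "even_walk u v \<longleftrightarrow> u < n \<and> v < n \<and>
  (\<lambda>x y. x < n \<and> y < n \<and> (\<exists>z<n. A x z \<and> A z y))\<^sup>*\<^sup>* u v"

definition R where "R u v \<longleftrightarrow> even_walk u v \<or> (\<exists>w<n. even_walk u w \<and> A w v)"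

definition nbr where "nbr d v \<longleftrightarrow> X d \<and> (\<exists>h<n. R v h \<and> E d h)"

text \<open>The remaining components have no neighbour in \<open>X\<close>. Tokens start in
  \<open>X\<close> and can never enter them, so they are dropped.\<close>

definition alive where "alive v \<longleftrightarrow> v < n \<and> \<not> X v \<and> (\<exists>d<n. nbr d v)"

definition big where "big v \<longleftrightarrow> alive v \<and> T \<le> card {w. w < n \<and> R v w}"

definition rk where "rk v = card {w. w < n \<and> R v w \<and> w < v}"

definition ix where "ix d v = card {d'. d' < n \<and> nbr d' v \<and> d' < d}"

text \<open>Compares the colour of \<open>d\<close> with that of the first attached vertex
  \<open>d0\<close>, by way of neighbours of both in the component.\<close>

definition differ where "differ d v \<longleftrightarrow> (\<exists>d0<n. \<exists>h0<n. \<exists>h<n. nbr d0 v \<and> ix d0 v = 0 \<and>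
  R v h0 \<and> E d0 h0 \<and> R v h \<and> E d h \<and> \<not> even_walk h0 h)"

text \<open>Consecutive indices are two apart, so the parity bit cannot disturb their order. All
  positions except the first exceed \<open>M\<close>, so a path vertex with an attachment and a
  predecessor has rank above \<open>M\<close>; the degree bound relies on this.\<close>

definition pos where "pos d v = (if ix d v = 0 then 0 else M + 2 * ix d v + of_bool (differ d v))"

definition gad where "gad v \<longleftrightarrow> big v \<and> (rk v \<le> M \<or> (\<exists>d<n. nbr d v \<and> rk v \<le> pos d v))"

definition core where "core v \<longleftrightarrow> X v \<or> (alive v \<and> \<not> big v)"

definition att where "att d v \<longleftrightarrow> gad v \<and> nbr d v \<and> rk v = pos d v"

definition E' where "E' u v \<longleftrightarrow> (core u \<and> core v \<and> E u v) \<or>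
  (gad u \<and> gad v \<and> R u v \<and> (rk u = Suc (rk v) \<or> rk v = Suc (rk u))) \<or> att u v \<or> att v u"

definition keep where "keep v \<longleftrightarrow> core v \<or> gad v"

end

lemma card_neighbours:
  fixes E :: "'a \<Rightarrow> 'a \<Rightarrow> bool"
  assumes "finite S" "\<And>v. card {w. E v w} \<le> D" shows "card {w. \<exists>v\<in>S. E v w} \<le> card S * D"
proof -
  have "card (\<Union>v\<in>S. {w. E v w}) \<le> (\<Sum>v\<in>S. card {w. E v w})" by (rule card_UN_le[OF assms(1)])
  also have "\<dots> \<le> of_nat (card S) * D" by (rule sum_bounded_above) (rule assms(2))
  also have "(\<Union>v\<in>S. {w. E v w}) = {w. \<exists>v\<in>S. E v w}" by auto
  finally show ?thesis by simp
qed

lemma (in shrink_defs) card_frontier: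
  assumes E_less: "\<And>u v. E u v \<Longrightarrow> v < n" and U_less: "\<And>v. U v \<Longrightarrow> v < n"
    and deg: "\<And>v. card {w. E v w} \<le> D"
  shows "card {d. X d \<and> \<not> U d} \<le> card {v. U v} * D"
proof -
  have finU: "finite {v. U v}" by (rule finite_subset[of _ "{..<n}"]) (auto dest: U_less)
  have "card {d. X d \<and> \<not> U d} \<le> card {w. \<exists>v\<in>{v. U v}. E v w}"
    by (rule card_mono) (auto simp: X_def intro: finite_subset[of _ "{..<n}"] dest: E_less)
  also have "\<dots> \<le> card {v. U v} * D" by (rule card_neighbours[OF finU deg])
  finally show ?thesis .
qed

text \<open>The third condition on \<open>M\<close> lets the first \<open>M + 1\<close> path
  vertices alone offer room against \<open>k + 2 * D\<close> balls of radius two. The condition on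
  \<open>T\<close> gives a large component enough ranks for every position, as only vertices of
  \<open>X\<close> outside \<open>U\<close> are attached.\<close>

locale shrink = shrink_defs +
  fixes D k :: nat and col :: "nat \<Rightarrow> bool"
  assumes sym: "symp E" and E_less: "E u v \<Longrightarrow> u < n" and U_less: "U v \<Longrightarrow> v < n"
    and col: "E u v \<Longrightarrow> col u \<noteq> col v" and deg: "card {w. E v w} \<le> D"
    and M: "even M" "1 \<le> M" "(k + 2 * D) * (1 + D + D * D) \<le> M"
    and T: "M + 2 * card {d. X d \<and> \<not> U d} + 2 \<le> T"
begin

section \<open>Components of the rest graph\<close>

lemma irrefl: "\<not> E x x"
  using col by blast

lemma E_sym: "E x y \<Longrightarrow> E y x"
  using sym by (rule sympD)

lemma E_less2: "E u v \<Longrightarrow> v < n"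
  using E_less E_sym by blast

lemma X_less: "X v \<Longrightarrow> v < n"
  by (simp add: X_def)

lemma A_sym: "A x y \<Longrightarrow> A y x"
  unfolding A_def using E_sym by blast

lemma A_dest: "A x y \<Longrightarrow> E x y \<and> x < n \<and> y < n \<and> \<not> X x \<and> \<not> X y"
  unfolding A_def using E_less E_less2 by blast

abbreviation AA where "AA \<equiv> (\<lambda>x y. x < n \<and> y < n \<and> (\<exists>z<n. A x z \<and> A z y))"

text \<open>Along a walk, each edge toggles between an even walk and an even walk followed by one
  edge.\<close>

lemma R_iff:
  assumes "u < n" "\<not> X u"
  shows "R u v \<longleftrightarrow> A\<^sup>*\<^sup>* u v"
proof
  have AA: "A\<^sup>*\<^sup>* u y" if "AA\<^sup>*\<^sup>* u y" for y
    using that by (induction rule: rtranclp_induct) (auto intro: rtranclp.rtrancl_into_rtrancl)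
  assume "R u v"
  then show "A\<^sup>*\<^sup>* u v" unfolding R_def even_walk_def using AA by (auto intro: rtranclp.rtrancl_into_rtrancl)
next
  assume "A\<^sup>*\<^sup>* u v"
  then have "v < n \<and> (AA\<^sup>*\<^sup>* u v \<or> (\<exists>w<n. AA\<^sup>*\<^sup>* u w \<and> A w v))"
  proof (induction rule: rtranclp_induct)
    case base
    then show ?case using assms by simp
  next
    case (step y z)
    have yz: "y < n" "z < n" using A_dest[OF step(2)] by auto
    from step.IH show ?case
    proof (elim conjE disjE exE)
      assume "AA\<^sup>*\<^sup>* u y"
      then show ?thesis using step(2) yz by blast
    next
      fix w assume w: "w < n" "AA\<^sup>*\<^sup>* u w" "A w y"
      then have "AA w z" using step(2) yz by blast
      with w(2) have "AA\<^sup>*\<^sup>* u z" by (rule rtranclp.rtrancl_into_rtrancl)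
      then show ?thesis using yz by blast
    qed
  qed
  then show "R u v" unfolding R_def even_walk_def using assms by blast
qed

lemma R_cls:
  assumes "u < n" "\<not> X u" "R u v" shows "v < n" "\<not> X v"
proof -
  have "A\<^sup>*\<^sup>* u v" using assms R_iff by simp
  then have "v < n \<and> \<not> X v" by (cases rule: rtranclp.cases) (use assms A_dest in auto)
  then show "v < n" "\<not> X v" by auto
qed

lemma R_refl: "u < n \<Longrightarrow> R u u"
  unfolding R_def even_walk_def by simp

lemma R_eq:
  assumes "u < n" "\<not> X u" "R u v" shows "R v = R u"
proof -
  have v: "v < n" "\<not> X v" using R_cls[OF assms] by auto
  have uv: "A\<^sup>*\<^sup>* u v" using assms R_iff by simp
  have "symp A" using A_sym by (rule sympI)
  then have "symp A\<^sup>*\<^sup>*" by (rule symp_rtranclp)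
  then have vu: "A\<^sup>*\<^sup>* v u" using uv by (rule sympD)
  have "R v x \<longleftrightarrow> R u x" for x
    unfolding R_iff[OF v] R_iff[OF assms(1,2)] using uv vu rtranclp_trans by metis
  then show ?thesis by blast
qed

lemma A_R: "A u v \<Longrightarrow> R u v"
  using R_iff[of u v] A_dest[of u v] by auto

text \<open>Colours alternate along edges. Two vertices of a component without an even walk between
  them are joined by an even walk and one more edge, hence have different colours.\<close>

lemma even_walk_col:
  assumes "u < n" "\<not> X u" "R u v"
  shows "even_walk u v \<longleftrightarrow> col u = col v"
proof -
  have c: "col x = col y" if "even_walk x y" for x y
  proof -
    have "AA\<^sup>*\<^sup>* x y" using that by (simp add: even_walk_def)
    then show ?thesis
    proof (induction rule: rtranclp_induct)
      case (step y z)
      then obtain w where "A y w" "A w z" by blast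
      then have "col y \<noteq> col w" "col w \<noteq> col z" using col A_dest by blast+
      then show ?case using step.IH by auto
    qed simp
  qed
  show ?thesis
  proof
    assume "col u = col v"
    show "even_walk u v"
    proof (rule ccontr)
      assume "\<not> even_walk u v"
      then obtain w where w: "even_walk u w" "A w v" using assms(3) by (auto simp: R_def)
      then have "col w \<noteq> col v" using col A_dest by blast
      then show False using c[OF w(1)] \<open>col u = col v\<close> by simp
    qed
  qed (rule c)
qed

context
  fixes u v assumes uv: "u < n" "\<not> X u" "R u v"
begin

lemma cls_nbr: "nbr d v = nbr d u"
  unfolding nbr_def R_eq[OF uv] ..

lemma cls_alive: "alive v = alive u"
  unfolding alive_def cls_nbr using uv R_cls[OF uv] by simp

lemma cls_big: "big v = big u"
  unfolding big_def cls_alive R_eq[OF uv] ..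

lemma cls_ix: "ix d v = ix d u"
  unfolding ix_def cls_nbr ..

lemma cls_pos: "pos d v = pos d u"
  unfolding pos_def differ_def cls_ix cls_nbr R_eq[OF uv] ..

end

lemma alive_dest: "alive v \<Longrightarrow> v < n \<and> \<not> X v"
  by (simp add: alive_def)

lemma big_dest: "big v \<Longrightarrow> v < n \<and> \<not> X v \<and> alive v"
  by (simp add: big_def alive_def)

lemma gad_dest: "gad v \<Longrightarrow> v < n \<and> \<not> X v \<and> big v"
  using big_dest by (auto simp: gad_def)

lemma core_not_gad: "core v \<Longrightarrow> \<not> big v" "core v \<Longrightarrow> \<not> gad v"
  using big_dest by (auto simp: core_def gad_def)

lemma core_less: "core v \<Longrightarrow> v < n"
  using X_less alive_dest by (auto simp: core_def)

text \<open>All neighbours of \<open>U\<close> belong to \<open>X\<close>, so a vertex outside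
  \<open>X\<close> is never adjacent to \<open>U\<close>. This limits the attached vertices to
  \<open>X\<close> without \<open>U\<close>.\<close>

lemma nbr_dest:
  assumes "nbr d v" "v < n" "\<not> X v" shows "X d" "\<not> U d" "d < n"
proof -
  show "X d" using assms by (simp add: nbr_def)
  then show "d < n" by (rule X_less)
  obtain h where h: "h < n" "R v h" "E d h" using assms by (auto simp: nbr_def)
  then have "\<not> X h" using R_cls assms by blast
  then show "\<not> U d" using h \<open>d < n\<close> by (auto simp: X_def)
qed

section \<open>Ranks in a component and positions on its path\<close>

lemma cls_rank:
  assumes "v < n" "\<not> X v"
  shows "bij_betw rk {w. w < n \<and> R v w} {..<card {w. w < n \<and> R v w}}"
proof -
  have "rk w = card {x \<in> {w. w < n \<and> R v w}. x < w}" if "w \<in> {w. w < n \<and> R v w}" for w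
    using that R_eq[OF assms, of w] by (simp add: rk_def conj_assoc)
  then show ?thesis
    using rank_bij[of "{w. w < n \<and> R v w}"] bij_betw_cong[of "{w. w < n \<and> R v w}" rk] by simp
qed

lemma rk_inj:
  assumes v: "v < n" "\<not> X v" and w: "R v w" "R v w'" "rk w = rk w'"
  shows "w = w'"
proof (rule inj_onD[OF bij_betw_imp_inj_on[OF cls_rank[OF v]] w(3)])
  show "w \<in> {w. w < n \<and> R v w}" "w' \<in> {w. w < n \<and> R v w}"
    using w R_cls(1)[OF v w(1)] R_cls(1)[OF v w(2)] by simp_all
qed

lemma rk_surj:
  assumes "v < n" "\<not> X v" "j < card {w. w < n \<and> R v w}"
  obtains w where "w < n" "R v w" "rk w = j"
proof -
  have "j \<in> rk ` {w. w < n \<and> R v w}"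
    unfolding bij_betw_imp_surj_on[OF cls_rank[OF assms(1,2)]] using assms(3) by simp
  then show ?thesis using that by auto
qed

lemma ix_bij: "bij_betw (\<lambda>d. ix d v) {d. d < n \<and> nbr d v} {..<card {d. d < n \<and> nbr d v}}"
  using rank_bij[of "{d. d < n \<and> nbr d v}"] by (simp add: ix_def conj_assoc)

lemma nbr_less: "nbr d v \<Longrightarrow> d < n"
  unfolding nbr_def using X_less by blast

lemma ix_inj:
  assumes "nbr d v" "nbr d' v" "ix d v = ix d' v" shows "d = d'"
  by (rule inj_onD[OF bij_betw_imp_inj_on[OF ix_bij[of v]] assms(3)])
    (use assms(1,2) nbr_less in simp_all)

lemma ix_less:
  assumes "nbr d v" shows "ix d v < card {d. d < n \<and> nbr d v}"
  using bij_betw_apply[OF ix_bij[of v], of d] assms nbr_less[OF assms] by simp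

lemma first_nbr:
  assumes "alive v" obtains d0 where "nbr d0 v" "ix d0 v = 0"
proof -
  have "{d. d < n \<and> nbr d v} \<noteq> {}" using assms by (auto simp: alive_def)
  then have "0 < card {d. d < n \<and> nbr d v}" by (simp add: card_gt_0_iff)
  then have "0 \<in> (\<lambda>d. ix d v) ` {d. d < n \<and> nbr d v}"
    unfolding bij_betw_imp_surj_on[OF ix_bij] by simp
  then show ?thesis using that by auto
qed

text \<open>\<open>d0\<close> and \<open>d\<close> have the colours opposite to those of their
  neighbours \<open>h0\<close> and \<open>h\<close>, and inside the component
  \<open>even_walk\<close> decides whether the latter agree.\<close>

lemma differ_iff:
  assumes v: "v < n" "\<not> X v" and d0: "nbr d0 v" "ix d0 v = 0" and d: "nbr d v"
  shows "differ d v \<longleftrightarrow> col d \<noteq> col d0"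
proof
  assume "differ d v"
  then obtain d1 h0 h where h: "nbr d1 v" "ix d1 v = 0" "R v h0" "E d1 h0" "R v h" "E d h" "\<not> even_walk h0 h"
    by (auto simp: differ_def)
  have "d1 = d0" using ix_inj h(1,2) d0 by simp
  moreover have "col h0 \<noteq> col h" using even_walk_col[of h0 h] R_cls[OF v h(3)] R_eq[OF v h(3)] h(5,7) by simp
  ultimately show "col d \<noteq> col d0" using col[OF h(4)] col[OF h(6)] by auto
next
  assume c: "col d \<noteq> col d0"
  obtain h0 where h0: "h0 < n" "R v h0" "E d0 h0" using d0 by (auto simp: nbr_def)
  obtain h where h: "h < n" "R v h" "E d h" using d by (auto simp: nbr_def)
  have "col h0 \<noteq> col h" using col[OF h0(3)] col[OF h(3)] c by auto
  then have "\<not> even_walk h0 h" using even_walk_col[of h0 h] R_cls[OF v h0(2)] R_eq[OF v h0(2)] h(2) by simp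
  then show "differ d v" unfolding differ_def using d0 h0 h nbr_less[OF d0(1)] by blast
qed

lemma pos_parity:
  assumes v: "v < n" "\<not> X v" and d0: "nbr d0 v" "ix d0 v = 0" and d: "nbr d v"
  shows "odd (pos d v) \<longleftrightarrow> col d \<noteq> col d0"
proof (cases "ix d v = 0")
  case True
  then have "d = d0" using ix_inj d d0 by simp
  then show ?thesis using d0 by (simp add: pos_def)
next
  case False
  then show ?thesis using differ_iff[OF assms] M(1) by (simp add: pos_def)
qed

lemma pos_mono:
  assumes "ix d v < ix d' v" shows "pos d v < pos d' v" "M < pos d' v"
  using assms M(2) by (auto simp: pos_def)

lemma pos_inj:
  assumes "nbr d v" "nbr d' v" "pos d v = pos d' v" shows "d = d'"
proof (rule ix_inj[OF assms(1,2)])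
  show "ix d v = ix d' v"
    using pos_mono(1)[of d v d'] pos_mono(1)[of d' v d] assms(3) by linarith
qed

lemma nbr_card:
  assumes "v < n" "\<not> X v"
  shows "card {d. d < n \<and> nbr d v} \<le> card {d. X d \<and> \<not> U d}"
proof (rule card_mono)
  show "finite {d. X d \<and> \<not> U d}" by (rule finite_subset[of _ "{..<n}"]) (auto dest: X_less)
qed (use nbr_dest assms in auto)

text \<open>With \<open>m\<close> vertices in \<open>X\<close> outside \<open>U\<close>, indices are
  at most \<open>m - 1\<close>, so positions are at most \<open>M + 2 * m - 1\<close>.\<close>

lemma pos_less:
  assumes "v < n" "\<not> X v" "nbr d v" shows "Suc (pos d v) < T"
  using ix_less[OF assms(3)] nbr_card[OF assms(1,2)] T by (auto simp: pos_def)

lemma att_exists: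
  assumes "big v" "nbr d v"
  obtains w where "R v w" "att d w"
proof -
  have v: "v < n" "\<not> X v" using big_dest assms by auto
  have "pos d v < card {w. w < n \<and> R v w}" using pos_less[OF v assms(2)] assms(1) by (simp add: big_def)
  then obtain w where w: "w < n" "R v w" "rk w = pos d v" using rk_surj[OF v] by metis
  note c = cls_nbr[OF v w(2)] cls_big[OF v w(2)] cls_pos[OF v w(2)]
  have "att d w" unfolding att_def gad_def c using assms w nbr_less[OF assms(2)] by auto
  then show ?thesis using that w by blast
qed

lemma E'_sym: "E' u v \<Longrightarrow> E' v u"
  unfolding E'_def using E_sym R_eq gad_dest R_refl by metis

text \<open>The ranks from 0 to \<open>M\<close> occur on every path, and no rank reaches
  \<open>T\<close>: the first bound gives room in the reduced graph, the second its size.\<close>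

lemma gad_class:
  assumes "big v" shows "M < card {w. R v w \<and> gad w}" "card {w. R v w \<and> gad w} \<le> T"
proof -
  have v: "v < n" "\<not> X v" using big_dest assms by auto
  let ?c = "{w. w < n \<and> R v w}"
  have fin: "finite {w. R v w \<and> gad w}" by (rule finite_subset[of _ "{..<n}"]) (auto dest: gad_dest)
  have sz: "T \<le> card ?c" using assms by (simp add: big_def)
  have inj: "inj_on rk ?c" using cls_rank[OF v] by (simp add: bij_betw_def)
  have "{..M} \<subseteq> rk ` {w. R v w \<and> gad w}"
  proof
    fix j assume "j \<in> {..M}"
    then obtain w where w: "w < n" "R v w" "rk w = j" using rk_surj[OF v, of j] sz T by auto
    then have "gad w" using cls_big[OF v w(2)] assms \<open>j \<in> {..M}\<close> by (simp add: gad_def)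
    then show "j \<in> rk ` {w. R v w \<and> gad w}" using w by blast
  qed
  then have "card {..M} \<le> card {w. R v w \<and> gad w}" using fin by (rule surj_card_le[rotated])
  then show "M < card {w. R v w \<and> gad w}" by simp
  have "rk ` {w. R v w \<and> gad w} \<subseteq> {..<T}"
  proof (rule image_subsetI)
    fix w assume w: "w \<in> {w. R v w \<and> gad w}"
    then have "rk w \<le> M \<or> (\<exists>d<n. nbr d v \<and> rk w \<le> pos d v)"
      using cls_nbr[OF v] cls_pos[OF v] by (auto simp: gad_def)
    then show "rk w \<in> {..<T}" using pos_less[OF v] T by fastforce
  qed
  moreover have "inj_on rk {w. R v w \<and> gad w}" by (rule inj_on_subset[OF inj]) (use R_cls[OF v] in auto)
  ultimately show "card {w. R v w \<and> gad w} \<le> T" using card_inj_on_le[of rk _ "{..<T}"] by simp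
qed

end

context shrink
begin

text \<open>The original component itself serves as the label of a hole in both graphs: the old hole
  is the whole component \<open>c\<close>, the new one consists of its vertices with
  \<open>gad\<close>.\<close>

definition "Lab = {c. \<exists>v. big v \<and> c = {w. R v w}}"

lemma Lab_mem:
  assumes "c \<in> Lab" "x \<in> c"
  shows "c = {w. R x w}" "big x" "x < n" "\<not> X x"
proof -
  obtain v where v: "big v" "c = {w. R v w}" using assms(1) by (auto simp: Lab_def)
  have vn: "v < n" "\<not> X v" using big_dest[OF v(1)] by auto
  have vx: "R v x" using assms(2) v(2) by simp
  show "c = {w. R x w}" using R_eq[OF vn vx] v(2) by simp
  show "big x" using cls_big[OF vn vx] v(1) by simp
  show "x < n" "\<not> X x" using R_cls[OF vn vx] by auto
qed

lemma Lab_big: "big v \<Longrightarrow> {w. R v w} \<in> Lab" "big v \<Longrightarrow> v \<in> {w. R v w}"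
  using big_dest R_refl by (auto simp: Lab_def)

lemma fin_E: "finite {w. E v w}"
  by (rule finite_subset[of _ "{..<n}"]) (auto dest: E_less2)

lemma fin_R: "v < n \<Longrightarrow> \<not> X v \<Longrightarrow> finite {w. R v w}"
  by (rule finite_subset[of _ "{..<n}"]) (auto dest: R_cls)

lemma E_R: "E u v \<Longrightarrow> \<not> X u \<Longrightarrow> \<not> X v \<Longrightarrow> R u v"
  by (rule A_R) (simp add: A_def)

lemma core_big_edge:
  assumes "core x" "big y" "E x y" shows "X x" "nbr x y"
proof -
  have y: "y < n" "\<not> X y" using big_dest[OF assms(2)] by auto
  show Xx: "X x"
  proof (rule ccontr)
    assume x: "\<not> X x"
    have "R x y" by (rule E_R[OF assms(3) x y(2)])
    then have "big x" using cls_big[of x y] x core_less[OF assms(1)] assms(2) by simp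
    then show False using core_not_gad(1)[OF assms(1)] by simp
  qed
  show "nbr x y" using Xx y R_refl[OF y(1)] assms(3) by (auto simp: nbr_def)
qed

lemma att_dest:
  assumes "att d v" shows "gad v" "nbr d v" "rk v = pos d v" "E' d v" "X d" "\<not> X v"
proof -
  show g: "gad v" and d: "nbr d v" and "rk v = pos d v" using assms by (simp_all add: att_def)
  show "E' d v" using assms by (simp add: E'_def)
  show "\<not> X v" using gad_dest[OF g] by simp
  show "X d" using d by (simp add: nbr_def)
qed

lemma E'_core:
  assumes "E' u v" "core u" shows "core v \<and> E u v \<or> \<not> core v \<and> att u v"
proof -
  have "\<not> gad u" using core_not_gad(2)[OF assms(2)] .
  then have "core v \<and> E u v \<or> att u v" using assms(1) att_dest(1)[of v u] unfolding E'_def by blast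
  moreover have "\<not> core v" if "att u v" using core_not_gad(2)[of v] att_dest(1)[OF that] by blast
  ultimately show ?thesis by blast
qed

lemma E'_gad:
  assumes "E' u v" "gad u"
  shows "gad v \<and> R u v \<and> (rk u = Suc (rk v) \<or> rk v = Suc (rk u)) \<or> att v u"
proof -
  have "\<not> core u" using core_not_gad(2)[of u] assms(2) by blast
  moreover have "\<not> att u v" using att_dest(5)[of u v] gad_dest[OF assms(2)] by blast
  ultimately show ?thesis using assms(1) unfolding E'_def by blast
qed

text \<open>The attachments preserve exactly which vertices are adjacent to which hole, the only
  information about a hole's surroundings that the simulation uses.\<close>

lemma touch_old:
  assumes "core x" "c \<in> Lab"
  shows "(\<exists>h\<in>c. E x h) \<longleftrightarrow> (\<exists>h\<in>{w\<in>c. gad w}. E' x h)"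
proof
  assume "\<exists>h\<in>c. E x h"
  then obtain h where h: "h \<in> c" "E x h" by blast
  note c = Lab_mem[OF assms(2) h(1)]
  obtain w where w: "R h w" "att x w"
    using att_exists[OF c(2) core_big_edge(2)[OF assms(1) c(2) h(2)]] by metis
  have "w \<in> c" by (subst c(1)) (simp add: w(1))
  then show "\<exists>h\<in>{w\<in>c. gad w}. E' x h" using att_dest(1,4)[OF w(2)] by blast
next
  assume "\<exists>h\<in>{w\<in>c. gad w}. E' x h"
  then obtain w where w: "w \<in> c" "gad w" "E' x w" by blast
  have "att x w" using E'_core[OF w(3) assms(1)] core_not_gad(2)[of w] w(2) by blast
  then obtain h where h: "R w h" "E x h" by (auto simp: att_def nbr_def)
  have "h \<in> c" by (subst Lab_mem(1)[OF assms(2) w(1)]) (simp add: h(1))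
  then show "\<exists>h\<in>c. E x h" using h(2) by blast
qed

lemma hole_edge_old:
  assumes "c \<in> Lab" "c' \<in> Lab" "x \<in> c" "y \<in> c'" "x = y \<or> E x y"
  shows "c = c'"
proof -
  note x = Lab_mem[OF assms(1,3)] and y = Lab_mem[OF assms(2,4)]
  have "R x y" using assms(5) E_R[of x y] x(4) y(4) R_refl[OF x(3)] by auto
  then have "R y = R x" by (rule R_eq[OF x(3,4)])
  then show ?thesis by (subst x(1), subst y(1)) simp
qed

lemma E'_hole:
  assumes "E' x y" "gad x" "gad y" shows "R x y" "rk x = Suc (rk y) \<or> rk y = Suc (rk x)"
proof -
  have "\<not> att y x" using att_dest(5)[of y x] gad_dest[OF assms(3)] by blast
  then have "R x y \<and> (rk x = Suc (rk y) \<or> rk y = Suc (rk x))"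
    using E'_gad[OF assms(1,2)] by blast
  then show "R x y" "rk x = Suc (rk y) \<or> rk y = Suc (rk x)" by auto
qed

text \<open>This justifies dropping the components that are not \<open>alive\<close>: an edge out of
  \<open>X\<close> makes its other end alive, and edges inside the rest graph stay in one
  component.\<close>

lemma closed_old:
  assumes "x \<in> {v. core v} \<union> \<Union>Lab" "E x y" shows "y \<in> {v. core v} \<union> \<Union>Lab"
proof -
  have yn: "y < n" using E_less2[OF assms(2)] .
  have goal: ?thesis if "X y \<or> alive y"
  proof (cases "big y")
    case True
    then show ?thesis using Lab_big[of y] by blast
  qed (use that in \<open>simp add: core_def\<close>)
  show ?thesis
  proof (cases "X y")
    case y: False
    show ?thesis
    proof (cases "X x")
      case True
      then have "nbr x y" using R_refl[OF yn] yn assms(2) by (auto simp: nbr_def)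
      then have "alive y" using y yn nbr_less by (auto simp: alive_def)
      then show ?thesis using goal by blast
    next
      case x: False
      have al: "alive x"
      proof (cases "core x")
        case False
        then obtain c where "c \<in> Lab" "x \<in> c" using assms(1) by blast
        then show ?thesis using Lab_mem(2) big_dest by blast
      qed (use x in \<open>simp add: core_def\<close>)
      then have "alive y" using cls_alive[of x y] alive_dest[OF al] E_R[OF assms(2) x y] by simp
      then show ?thesis using goal by blast
    qed
  qed (use goal in blast)
qed

lemma E'_keep: "E' x y \<Longrightarrow> keep x \<and> keep y"
  using att_dest(1,5)[of x y] att_dest(1,5)[of y x] unfolding E'_def keep_def core_def by blast

lemma connected_old:
  assumes "c \<in> Lab" "x \<in> c" "y \<in> c" shows "(\<lambda>x y. x \<in> c \<and> y \<in> c \<and> E x y)\<^sup>*\<^sup>* x y"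
proof -
  note x = Lab_mem[OF assms(1,2)]
  have "A\<^sup>*\<^sup>* x y" using R_iff[OF x(3,4)] assms(3) x(1) by simp
  then have "y \<in> c \<and> (\<lambda>x y. x \<in> c \<and> y \<in> c \<and> E x y)\<^sup>*\<^sup>* x y"
  proof (induction rule: rtranclp_induct)
    case (step y z)
    then have y: "y \<in> c" by simp
    have z: "z \<in> c" by (subst Lab_mem(1)[OF assms(1) y]) (simp add: A_R[OF step(2)])
    have "(\<lambda>x y. x \<in> c \<and> y \<in> c \<and> E x y)\<^sup>*\<^sup>* x y" using step.IH by simp
    then have "(\<lambda>x y. x \<in> c \<and> y \<in> c \<and> E x y)\<^sup>*\<^sup>* x z"
      by (rule rtranclp.rtrancl_into_rtrancl) (use y z A_dest[OF step(2)] in simp)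
    then show ?case using z by simp
  qed (use assms in simp)
  then show ?thesis ..
qed

text \<open>\<open>gad\<close> is downward closed in the rank, so every path vertex is linked to the
  vertex of rank 0 through all smaller ranks.\<close>

lemma connected_new:
  assumes "c \<in> Lab" "x \<in> {w\<in>c. gad w}" "y \<in> {w\<in>c. gad w}"
  shows "(\<lambda>x y. x \<in> {w\<in>c. gad w} \<and> y \<in> {w\<in>c. gad w} \<and> E' x y)\<^sup>*\<^sup>* x y"
proof -
  let ?r = "\<lambda>x y. x \<in> {w\<in>c. gad w} \<and> y \<in> {w\<in>c. gad w} \<and> E' x y"
  have xc: "x \<in> c" using assms(2) by simp
  note x = Lab_mem[OF assms(1) xc]
  obtain o' where o: "o' < n" "R x o'" "rk o' = 0" using rk_surj[OF x(3,4), of 0] x(2) T by (auto simp: big_def)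
  have "?r\<^sup>*\<^sup>* o' z" if "z \<in> {w\<in>c. gad w}" "rk z = j" for z j
    using that
  proof (induction j arbitrary: z)
    case 0
    then have "z \<in> {w. R x w}" by (subst x(1)[symmetric]) simp
    then have "z = o'" using rk_inj[OF x(3,4), of z o'] o 0(2) by simp
    then show ?case by simp
  next
    case (Suc j)
    then have "z \<in> {w. R x w}" by (subst x(1)[symmetric]) simp
    then have xz: "R x z" and gz: "gad z" using Suc.prems(1) by auto
    have "j < card {w. w < n \<and> R x w}"
      using Suc.prems(2) bij_betw_apply[OF cls_rank[OF x(3,4)], of z] xz R_cls[OF x(3,4) xz] by simp
    then obtain w where w: "w < n" "R x w" "rk w = j" using rk_surj[OF x(3,4)] by metis
    have "gad w"
    proof -
      have "rk z \<le> M \<or> (\<exists>d<n. nbr d x \<and> rk z \<le> pos d x)"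
        using gz unfolding gad_def cls_nbr[OF x(3,4) xz] cls_pos[OF x(3,4) xz] by blast
      then have "rk w \<le> M \<or> (\<exists>d<n. nbr d x \<and> rk w \<le> pos d x)"
        using w(3) Suc.prems(2) by fastforce
      then show ?thesis unfolding gad_def cls_nbr[OF x(3,4) w(2)] cls_pos[OF x(3,4) w(2)] cls_big[OF x(3,4) w(2)]
        using x(2) by blast
    qed
    have "w \<in> c" by (subst x(1)) (simp add: w(2))
    then have wc: "w \<in> {w\<in>c. gad w}" using \<open>gad w\<close> by simp
    have "R w z" using R_eq[OF x(3,4) w(2)] xz by simp
    then have "E' w z" unfolding E'_def using \<open>gad w\<close> gz w(3) Suc.prems(2) by simp
    then have "?r w z" using wc Suc.prems(1) by blast
    with Suc.IH[OF wc w(3)] show ?case by (rule rtranclp.rtrancl_into_rtrancl)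
  qed
  then have "?r\<^sup>*\<^sup>* o' x" "?r\<^sup>*\<^sup>* o' y" using assms(2,3) by blast+
  moreover have "symp ?r" by (rule sympI) (use E'_sym in blast)
  then have "symp ?r\<^sup>*\<^sup>*" by (rule symp_rtranclp)
  ultimately show ?thesis using rtranclp_trans[of ?r x o' y] sympD[of "?r\<^sup>*\<^sup>*" o' x] by blast
qed

section \<open>Degrees and colours of the reduced graph\<close>

lemma degree_large:
  assumes "big v" shows "2 \<le> D" "3 \<le> card {d. nbr d v} \<Longrightarrow> 3 \<le> D"
proof -
  have v: "v < n" "\<not> X v" using big_dest[OF assms] by auto
  let ?c = "{w. R v w}"
  have fin: "finite ?c" using fin_R[OF v] .
  have finX: "finite {x. X x \<and> E w x}" for w by (rule finite_subset[OF _ fin_E[of w]]) auto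
  have conn: "A\<^sup>*\<^sup>* x y" if "x \<in> ?c" "y \<in> ?c" for x y
  proof -
    have x: "x < n" "\<not> X x" "R x = R v" using R_cls[OF v] R_eq[OF v] that(1) by auto
    then show ?thesis using R_iff[OF x(1,2), of y] that(2) by simp
  qed
  have clo: "y \<in> ?c" if "x \<in> ?c" "A x y" for x y using R_eq[OF v, of x] A_R[OF that(2)] that(1) by simp
  have s1: "2 * card ?c \<le> (\<Sum>w\<in>?c. card {x. A w x}) + 2"
  proof (rule connected_degree_sum[OF fin])
    show "symp A" using A_sym by (rule sympI)
  qed (fact conn clo)+
  have "{d. nbr d v} \<subseteq> (\<Union>w\<in>?c. {x. X x \<and> E w x})"
  proof
    fix d assume "d \<in> {d. nbr d v}"
    then obtain h where "X d" "R v h" "E d h" by (auto simp: nbr_def)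
    then show "d \<in> (\<Union>w\<in>?c. {x. X x \<and> E w x})" using E_sym[of d h] by auto
  qed
  then have "card {d. nbr d v} \<le> card (\<Union>w\<in>?c. {x. X x \<and> E w x})"
    using fin finX by (intro card_mono) auto
  also have "\<dots> \<le> (\<Sum>w\<in>?c. card {x. X x \<and> E w x})" by (rule card_UN_le[OF fin])
  finally have s2: "card {d. nbr d v} \<le> (\<Sum>w\<in>?c. card {x. X x \<and> E w x})" .
  have "card {x. A w x} + card {x. X x \<and> E w x} \<le> D" if "w \<in> ?c" for w
  proof -
    have "\<not> X w" using R_cls[OF v] that by blast
    then have "{x. E w x} = {x. A w x} \<union> {x. X x \<and> E w x}" by (auto simp: A_def)
    moreover have "{x. A w x} \<inter> {x. X x \<and> E w x} = {}" by (auto simp: A_def)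
    moreover have "finite {x. A w x}" by (rule finite_subset[OF _ fin_E[of w]]) (auto simp: A_def)
    ultimately have "card {x. E w x} = card {x. A w x} + card {x. X x \<and> E w x}"
      using finX[of w] by (simp add: card_Un_disjoint)
    then show ?thesis using deg[of w] by simp
  qed
  then have "(\<Sum>w\<in>?c. card {x. A w x} + card {x. X x \<and> E w x}) \<le> of_nat (card ?c) * D"
    by (rule sum_bounded_above)
  \<comment> \<open>Summing degrees over the component: edges inside contribute at least
    \<open>2 * card ?c - 2\<close>, edges to \<open>X\<close> at least one per attached vertex, and
    the total is at most \<open>card ?c * D\<close>.\<close>
  then have main: "2 * card ?c + card {d. nbr d v} \<le> card ?c * D + 2"
    using s1 s2 by (simp add: sum.distrib)
  have "?c = {w. w < n \<and> R v w}" using R_cls[OF v] by auto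
  then have c3: "3 \<le> card ?c" using assms T M(2) by (simp add: big_def)
  have "{d. nbr d v} \<noteq> {}" using big_dest[OF assms] by (auto simp: alive_def)
  moreover have "finite {d. nbr d v}" by (rule finite_subset[of _ "{..<n}"]) (auto dest: nbr_less)
  ultimately have "0 < card {d. nbr d v}" by (simp add: card_gt_0_iff)
  then have n1: "1 \<le> card {d. nbr d v}" by simp
  show "2 \<le> D"
  proof (rule ccontr)
    assume "\<not> 2 \<le> D"
    then have "card ?c * D \<le> card ?c * 1" by (intro mult_le_mono2) simp
    then show False using main n1 c3 by linarith
  qed
  show "3 \<le> D" if "3 \<le> card {d. nbr d v}"
  proof (rule ccontr)
    assume "\<not> 3 \<le> D"
    then have "card ?c * D \<le> card ?c * 2" by (intro mult_le_mono2) simp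
    then show False using main that by linarith
  qed
qed

lemma fin_E': "finite {w. E' v w}"
proof (rule finite_subset[of _ "{..<n}"])
  show "{w. E' v w} \<subseteq> {..<n}" using E'_keep core_less gad_dest unfolding keep_def by blast
qed simp

text \<open>Edges from a core vertex to a large component are replaced by a single attachment to its
  path. Sending this attachment to an original neighbour \<open>\<phi> w\<close> in the same
  component injects the new neighbours into the old ones.\<close>

lemma deg_core:
  assumes "core v" shows "card {w. E' v w} \<le> D"
proof -
  define \<phi> where "\<phi> w = (if core w then w else SOME h. R w h \<and> E v h)" for w
  have cases: "core w \<and> E v w \<or> \<not> core w \<and> att v w" if "E' v w" for w
    using E'_core[OF that assms] .
  have \<phi>: "R w (\<phi> w) \<and> E v (\<phi> w)" if "\<not> core w" "att v w" for w
  proof -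
    have "\<exists>h. R w h \<and> E v h" using that(2) by (auto simp: att_def nbr_def)
    from someI_ex[OF this] show ?thesis using that(1) by (simp add: \<phi>_def)
  qed
  have att_w: "w < n" "\<not> X w" "big w" if "att v w" for w
    using gad_dest[OF att_dest(1)[OF that]] by auto
  have big\<phi>: "big (\<phi> w)" if "\<not> core w" "att v w" for w
    using \<phi>[OF that] cls_big[OF att_w(1,2)[OF that(2)]] att_w(3)[OF that(2)] by blast
  have "inj_on \<phi> {w. E' v w}"
  proof (rule inj_onI)
    fix w w' assume w: "w \<in> {w. E' v w}" "w' \<in> {w. E' v w}" "\<phi> w = \<phi> w'"
    show "w = w'"
    proof (cases "core w"; cases "core w'")
      assume c: "core w" "core w'"
      then show ?thesis using w(3) by (simp add: \<phi>_def)
    next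
      assume c: "core w" "\<not> core w'"
      then have "big w" using big\<phi>[of w'] cases[of w'] w by (simp add: \<phi>_def)
      then show ?thesis using core_not_gad(1)[OF c(1)] by simp
    next
      assume c: "\<not> core w" "core w'"
      then have "big w'" using big\<phi>[of w] cases[of w] w by (simp add: \<phi>_def)
      then show ?thesis using core_not_gad(1)[OF c(2)] by simp
    next
      assume c: "\<not> core w" "\<not> core w'"
      then have a: "att v w" "att v w'" using cases w by auto
      have r: "R w (\<phi> w)" "R w' (\<phi> w)" using \<phi>[OF c(1) a(1)] \<phi>[OF c(2) a(2)] w(3) by simp_all
      have "R w = R w'" using R_eq[OF att_w(1,2)[OF a(1)] r(1)] R_eq[OF att_w(1,2)[OF a(2)] r(2)] by simp
      then have R: "R w w'" using R_refl[OF att_w(1)[OF a(2)]] by simp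
      have "rk w = rk w'" using a cls_pos[OF att_w(1,2)[OF a(1)] R, of v] by (simp add: att_def)
      then show ?thesis using rk_inj[OF att_w(1,2)[OF a(1)] R_refl[OF att_w(1)[OF a(1)]] R] by simp
    qed
  qed
  moreover have "\<phi> ` {w. E' v w} \<subseteq> {w. E v w}"
  proof (rule image_subsetI)
    fix w assume "w \<in> {w. E' v w}"
    then show "\<phi> w \<in> {w. E v w}" using cases[of w] \<phi>[of w] by (auto simp: \<phi>_def)
  qed
  ultimately have "card {w. E' v w} \<le> card {w. E v w}" using fin_E by (rule card_inj_on_le)
  then show ?thesis using deg[of v] by linarith
qed

lemma card_le_1:
  assumes "\<And>x y. x \<in> S \<Longrightarrow> y \<in> S \<Longrightarrow> x = y" shows "finite S \<and> card S \<le> 1"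
proof (cases "S = {}")
  case False
  then obtain a where "a \<in> S" by blast
  then have "S = {a}" using assms by blast
  then show ?thesis by simp
qed simp

text \<open>A path vertex has at most one successor, one predecessor and one attachment. All three
  occur only strictly inside a path with at least three attached vertices, and then
  \<open>degree_large\<close> gives that \<open>D\<close> is at least 3.\<close>

lemma deg_gad:
  assumes g: "gad v" shows "card {w. E' v w} \<le> D"
proof -
  have v: "v < n" "\<not> X v" "big v" using gad_dest[OF g] by auto
  define up where "up = {w. gad w \<and> R v w \<and> rk w = Suc (rk v)}"
  define lo where "lo = {w. gad w \<and> R v w \<and> rk v = Suc (rk w)}"
  define ends where "ends = {d. att d v}"
  have "E' v w \<Longrightarrow> w \<in> up \<union> lo \<union> ends" for w
    using E'_gad[OF _ g, of w] unfolding up_def lo_def ends_def by blast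
  then have sub: "{w. E' v w} \<subseteq> up \<union> lo \<union> ends" by blast
  have "finite up \<and> card up \<le> 1" by (rule card_le_1) (rule rk_inj[OF v(1,2)], auto simp: up_def)
  moreover have "finite lo \<and> card lo \<le> 1" by (rule card_le_1) (rule rk_inj[OF v(1,2)], auto simp: lo_def)
  moreover have "finite ends \<and> card ends \<le> 1" by (rule card_le_1) (rule pos_inj[of _ v], auto simp: ends_def att_def)
  ultimately have up: "finite up" "card up \<le> 1" and lo: "finite lo" "card lo \<le> 1"
    and ends: "finite ends" "card ends \<le> 1" by simp_all
  have "card {w. E' v w} \<le> card (up \<union> lo \<union> ends)" using sub up lo ends by (intro card_mono) auto
  also have "\<dots> \<le> card up + card lo + card ends"
    using card_Un_le[of "up \<union> lo" ends] card_Un_le[of up lo] by linarith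
  finally have le: "card {w. E' v w} \<le> card up + card lo + card ends" .
  show ?thesis
  proof (cases "up = {} \<or> lo = {} \<or> ends = {}")
    case True
    then have "card up + card lo + card ends \<le> 2" using up lo ends by auto
    then show ?thesis using le degree_large(1)[OF v(3)] by linarith
  next
    case False
    then obtain wu wl d where w: "wu \<in> up" "wl \<in> lo" "d \<in> ends" by blast
    have d: "nbr d v" "pos d v = rk v" using w(3) by (auto simp: ends_def att_def)
    have "0 < rk v" using w(2) by (simp add: lo_def)
    then have ixd: "ix d v \<noteq> 0" and Mv: "M < rk v" using d(2) by (auto simp: pos_def split: if_splits)
    have wu: "gad wu" "R v wu" "rk wu = Suc (rk v)" using w(1) by (auto simp: up_def)
    \<comment> \<open>The successor \<open>wu\<close> has rank above \<open>M\<close>, so it belongs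
      to the path only because some attached vertex has a position at least as large.\<close>
    then obtain d' where d': "nbr d' v" "rk wu \<le> pos d' v"
      using Mv unfolding gad_def cls_nbr[OF v(1,2) wu(2)] cls_pos[OF v(1,2) wu(2)] by auto
    obtain d0 where d0: "nbr d0 v" "ix d0 v = 0" using first_nbr[of v] big_dest[OF v(3)] by metis
    have "pos d0 v = 0" using d0 by (simp add: pos_def)
    then have "pos d0 v < pos d' v" "pos d v < pos d' v" using d(2) d'(2) wu(3) by linarith+
    then have "d0 \<noteq> d'" "d \<noteq> d'" by (metis less_irrefl)+
    moreover have "d0 \<noteq> d" using ixd d0(2) by metis
    ultimately have "card {d0, d, d'} = 3" by simp
    moreover have "finite {d. nbr d v}" by (rule finite_subset[of _ "{..<n}"]) (auto dest: nbr_less)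
    then have "card {d0, d, d'} \<le> card {d. nbr d v}" using d0 d d' by (intro card_mono) auto
    ultimately have "3 \<le> card {d. nbr d v}" by simp
    then show ?thesis using degree_large(2)[OF v(3)] le up lo ends by linarith
  qed
qed

lemma deg': "card {w. E' v w} \<le> D"
proof (cases "keep v")
  case False
  then have "{w. E' v w} = {}" using E'_keep by blast
  then show ?thesis by simp
qed (use deg_core deg_gad in \<open>auto simp: keep_def\<close>)

text \<open>Ranks ignore the original colours, so path vertices are recoloured alternately, starting
  opposite to the first attached vertex; by \<open>pos_parity\<close> the other attachments
  fit.\<close>

lemma bipartite':
  obtains col' :: "nat \<Rightarrow> bool" where "\<And>u v. E' u v \<Longrightarrow> col' u \<noteq> col' v"
proof -
  define d0 where "d0 v = (SOME d. nbr d v \<and> ix d v = 0)" for v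
  have d0: "nbr (d0 v) v" "ix (d0 v) v = 0" if "gad v" for v
  proof -
    have "alive v" using gad_dest[OF that] big_dest[of v] by simp
    then have "\<exists>d. nbr d v \<and> ix d v = 0" using first_nbr[of v] by metis
    from someI_ex[OF this] show "nbr (d0 v) v" "ix (d0 v) v = 0" unfolding d0_def by blast+
  qed
  define col' where "col' v = (if gad v then col (d0 v) = odd (rk v) else col v)" for v
  have att: "col' d \<noteq> col' v" if "att d v" for d v
  proof -
    note g = att_dest(1-3)[OF that]
    have v: "v < n" "\<not> X v" using gad_dest[OF g(1)] by auto
    have "\<not> gad d" using nbr_dest(1)[OF g(2) v] gad_dest[of d] by blast
    then show ?thesis using pos_parity[OF v d0[OF g(1)] g(2)] g by (auto simp: col'_def)
  qed
  have path: "col' u \<noteq> col' v" if "gad u" "gad v" "R u v" "rk u = Suc (rk v) \<or> rk v = Suc (rk u)" for u v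
  proof -
    have u: "u < n" "\<not> X u" using gad_dest[OF that(1)] by auto
    have "d0 v = d0 u" unfolding d0_def cls_nbr[OF u that(3)] cls_ix[OF u that(3)] ..
    then show ?thesis using that by (auto simp: col'_def)
  qed
  have "col' u \<noteq> col' v" if "E' u v" for u v
    using that unfolding E'_def
  proof (elim disjE)
    assume "core u \<and> core v \<and> E u v"
    then show ?thesis using col core_not_gad by (auto simp: col'_def)
  next
    assume "att v u"
    then show ?thesis using att[of v u] by blast
  qed (use att path in blast)+
  then show ?thesis using that by blast
qed

section \<open>Equivalence of the original and the reduced graph\<close>

lemma hole_graph_old: "holes E Lab (\<lambda>c. c) {v. core v} (k + 2 * D)"
proof
  show "{v. core v} \<inter> c = {}" if "c \<in> Lab" for c using Lab_mem(2)[OF that] core_not_gad by blast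
  show "\<exists>q\<in>c. \<forall>w\<in>W. \<not> (w = q \<or> E w q \<or> (\<exists>z. E w z \<and> E z q))"
    if c: "c \<in> Lab" and W: "finite W" "card W \<le> k + 2 * D" for c W
  proof (rule roomy_card[OF _ W])
    obtain v where v: "big v" "c = {w. R v w}" using c by (auto simp: Lab_def)
    have "c = {w. w < n \<and> R v w}" using v R_cls big_dest[OF v(1)] by auto
    then show "(k + 2 * D) * (1 + D + D * D) < card c" using v(1) T M(3) by (simp add: big_def)
  qed (use fin_E deg in blast)
qed (use sym irrefl hole_edge_old connected_old in blast)+

lemma hole_graph_new: "holes E' Lab (\<lambda>c. {w\<in>c. gad w}) {v. core v} (k + 2 * D)"
proof
  show "symp E'" using E'_sym by (rule sympI)
  show "\<not> E' x x" for x using bipartite' by metis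
  show "{v. core v} \<inter> {w\<in>c. gad w} = {}" if "c \<in> Lab" for c using core_not_gad by blast
  show "c = c'" if "c \<in> Lab" "c' \<in> Lab" "x \<in> {w\<in>c. gad w}" "y \<in> {w\<in>c'. gad w}" "x = y \<or> E' x y" for c c' x y
  proof -
    have m: "x \<in> c" "y \<in> c'" "gad x" "gad y" using that by auto
    note x = Lab_mem[OF that(1) m(1)] and y = Lab_mem[OF that(2) m(2)]
    have "R x y" using that(5) E'_hole(1)[of x y] m(3,4) R_refl[OF x(3)] by auto
    then have "R y = R x" by (rule R_eq[OF x(3,4)])
    then show ?thesis by (subst x(1), subst y(1)) simp
  qed
  show "\<exists>q\<in>{w\<in>c. gad w}. \<forall>w\<in>W. \<not> (w = q \<or> E' w q \<or> (\<exists>z. E' w z \<and> E' z q))"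
    if c: "c \<in> Lab" and W: "finite W" "card W \<le> k + 2 * D" for c W
  proof (rule roomy_card[OF _ W])
    obtain v where v: "big v" "c = {w. R v w}" using c by (auto simp: Lab_def)
    then show "(k + 2 * D) * (1 + D + D * D) < card {w\<in>c. gad w}"
      using gad_class(1)[OF v(1)] M(3) by simp
  qed (use fin_E' deg' in blast)
qed (rule connected_new)

lemma subset_card: "B \<subseteq> C \<Longrightarrow> finite C \<Longrightarrow> card C \<le> m \<Longrightarrow> finite B \<and> card B \<le> m"
  using finite_subset[of B C] card_mono[of C B] by auto

text \<open>Both graphs share planets and labels, so \<open>simulate\<close> applies with the roles
  exchanged. Vertices of \<open>U\<close> are free in both, because all their neighbours lie in
  \<open>X\<close>.\<close>

lemma reach_iff:
  assumes S: "finite S" "card S \<le> k" "\<And>x. x \<in> S \<union> S' \<Longrightarrow> U x"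
  shows "(step E)\<^sup>*\<^sup>* S S' \<longleftrightarrow> (step E')\<^sup>*\<^sup>* S S'"
proof -
  interpret old: holes E Lab "\<lambda>c. c" "{v. core v}" "k + 2 * D" by (rule hole_graph_old)
  interpret new: holes E' Lab "\<lambda>c. {w\<in>c. gad w}" "{v. core v}" "k + 2 * D" by (rule hole_graph_new)
  have same: "E' x y = E x y" if "core x" "core y" for x y
    using E'_core[OF _ that(1), of y] that unfolding E'_def by blast
  have freeo: "old.free x" if "U x" for x
  proof -
    have x: "X x" using that U_less by (simp add: X_def)
    have "\<not> E x h" if "h \<in> c" "c \<in> Lab" for h c
      using Lab_mem(3,4)[OF that(2,1)] \<open>U x\<close> U_less by (auto simp: X_def)
    moreover have "core x" using x by (simp add: core_def)
    ultimately show ?thesis unfolding old.free_def old.touch_def by blast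
  qed
  have freen: "new.free x" if "U x" for x
  proof -
    have "core x" "\<forall>c\<in>Lab. \<not> (\<exists>h\<in>c. E x h)" using freeo[OF that] unfolding old.free_def old.touch_def by blast+
    then show ?thesis unfolding new.free_def new.touch_def using touch_old by blast
  qed
  have card: "card S + 2 * D \<le> k + 2 * D" using S(2) by simp
  have Un: "{v. core v} \<union> (\<Union>c\<in>Lab. c) = {v. core v} \<union> \<Union>Lab" by simp
  show ?thesis
  proof
    assume "(step E)\<^sup>*\<^sup>* S S'"
    then show "(step E')\<^sup>*\<^sup>* S S'"
    proof (rule new.simulate[where G = "\<lambda>c. c" and D = D, rotated -1])
      show "symp E" by (rule sym)
      show "E x y = E' x y" if "x \<in> {v. core v}" "y \<in> {v. core v}" for x y using same[of x y] that by simp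
      show "(\<exists>h\<in>c. E x h) = new.touch x c" if "x \<in> {v. core v}" "c \<in> Lab" for x c
        unfolding new.touch_def by (rule touch_old) (use that in simp_all)
      show "c = c'" if "c \<in> Lab" "c' \<in> Lab" "x \<in> c" "y \<in> c'" "x = y \<or> E x y" for c c' x y
        using that by (rule hole_edge_old)
      show "{v. core v} \<inter> c = {}" if "c \<in> Lab" for c by (rule old.planets[OF that])
      show "y \<in> {v. core v} \<union> (\<Union>c\<in>Lab. c)" if "x \<in> {v. core v} \<union> (\<Union>c\<in>Lab. c)" "E x y" for x y
        using closed_old that unfolding Un by blast
      show "finite {h\<in>new.HH. E' u h} \<and> card {h\<in>new.HH. E' u h} \<le> D" for u
        by (rule subset_card[OF _ fin_E' deg']) blast
      show "new.free x" if "x \<in> S \<union> S'" for x by (rule freen[OF S(3)[OF that]])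
    qed (use card S(1) in auto)
  next
    assume "(step E')\<^sup>*\<^sup>* S S'"
    then show "(step E)\<^sup>*\<^sup>* S S'"
    proof (rule old.simulate[where G = "\<lambda>c. {w\<in>c. gad w}" and D = D, rotated -1])
      show "symp E'" by (rule new.sym)
      show "E' x y = E x y" if "x \<in> {v. core v}" "y \<in> {v. core v}" for x y using same[of x y] that by simp
      show "(\<exists>h\<in>{w\<in>c. gad w}. E' x h) = old.touch x c" if "x \<in> {v. core v}" "c \<in> Lab" for x c
        unfolding old.touch_def by (rule touch_old[symmetric]) (use that in simp_all)
      show "c = c'" if "c \<in> Lab" "c' \<in> Lab" "x \<in> {w\<in>c. gad w}" "y \<in> {w\<in>c'. gad w}" "x = y \<or> E' x y" for c c' x y
        using that by (rule new.hole_edge)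
      show "{v. core v} \<inter> {w\<in>c. gad w} = {}" if "c \<in> Lab" for c by (rule new.planets[OF that])
      show "y \<in> {v. core v} \<union> (\<Union>c\<in>Lab. {w\<in>c. gad w})" if "E' x y" for x y
      proof -
        have "core y \<or> gad y" using E'_keep[OF that] by (simp add: keep_def)
        moreover have "y \<in> (\<Union>c\<in>Lab. {w\<in>c. gad w})" if "gad y"
          using Lab_big[of y] gad_dest[OF that] that by (intro UN_I[of "{w. R y w}"]) auto
        ultimately show ?thesis by blast
      qed
      show "finite {h\<in>old.HH. E u h} \<and> card {h\<in>old.HH. E u h} \<le> D" for u
        by (rule subset_card[OF _ fin_E deg]) blast
      show "old.free x" if "x \<in> S \<union> S'" for x by (rule freeo[OF S(3)[OF that]])
    qed (use card S(1) in auto)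
  qed
qed

lemma keep_less: "keep v \<Longrightarrow> v < n"
  using core_less gad_dest by (auto simp: keep_def)

lemma frontier: "card {d. X d \<and> \<not> U d} \<le> card {v. U v} * D"
  by (rule card_frontier) (fact E_less2 U_less deg)+

text \<open>Each kept vertex outside \<open>X\<close> lies in the component of some vertex of
  \<open>Z\<close>, the neighbours outside \<open>X\<close> of the frontier. Hence
  \<open>card Z * T\<close> bounds their number.\<close>

lemma card_keep: "card {v. keep v} \<le> card {v. U v} * (1 + D) + card {v. U v} * D * D * T"
proof -
  have finU: "finite {v. U v}" by (rule finite_subset[of _ "{..<n}"]) (auto dest: U_less)
  have finX: "finite {d. X d \<and> \<not> U d}" by (rule finite_subset[of _ "{..<n}"]) (auto dest: X_less)
  define Z where "Z = {h. \<not> X h \<and> (\<exists>d\<in>{d. X d \<and> \<not> U d}. E d h)}"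
  have "card Z \<le> card {w. \<exists>v\<in>{d. X d \<and> \<not> U d}. E v w}"
    by (rule card_mono) (auto simp: Z_def intro: finite_subset[of _ "{..<n}"] dest: E_less2)
  also have "\<dots> \<le> card {d. X d \<and> \<not> U d} * D" by (rule card_neighbours[OF finX deg])
  also have "\<dots> \<le> card {v. U v} * D * D" using frontier by (rule mult_le_mono1)
  finally have Z: "card Z \<le> card {v. U v} * D * D" .
  have finZ: "finite Z" by (rule finite_subset[of _ "{..<n}"]) (auto simp: Z_def dest: E_less2)
  have cls: "finite {w. R h w \<and> keep w} \<and> card {w. R h w \<and> keep w} \<le> T" if h: "h \<in> Z" for h
  proof -
    obtain d where d: "X d" "E d h" "\<not> X h" using h by (auto simp: Z_def)
    have hn: "h < n" using E_less2[OF d(2)] .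
    have al: "alive h" using d hn R_refl[OF hn] X_less[OF d(1)] by (auto simp: alive_def nbr_def)
    have fin: "finite {w. R h w \<and> keep w}" by (rule finite_subset[OF _ fin_R[OF hn d(3)]]) auto
    have "card {w. R h w \<and> keep w} \<le> T"
    proof (cases "big h")
      case True
      have "{w. R h w \<and> keep w} = {w. R h w \<and> gad w}"
        using cls_big[OF hn d(3)] True core_not_gad(1) by (auto simp: keep_def)
      then show ?thesis using gad_class(2)[OF True] by simp
    next
      case False
      have "card {w. R h w \<and> keep w} \<le> card {w. w < n \<and> R h w}"
        by (rule card_mono) (use R_cls[OF hn d(3)] in auto)
      then show ?thesis using False al by (simp add: big_def)
    qed
    then show ?thesis using fin by blast
  qed
  have cov: "{v. keep v} \<subseteq> {v. U v} \<union> {d. X d \<and> \<not> U d} \<union> (\<Union>h\<in>Z. {w. R h w \<and> keep w})"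
  proof
    fix v assume v: "v \<in> {v. keep v}"
    show "v \<in> {v. U v} \<union> {d. X d \<and> \<not> U d} \<union> (\<Union>h\<in>Z. {w. R h w \<and> keep w})"
    proof (cases "X v")
      case False
      then have al: "alive v" using v big_dest gad_dest by (auto simp: keep_def core_def)
      then obtain d where d: "nbr d v" by (auto simp: alive_def)
      have vn: "v < n" using keep_less v by simp
      obtain h where h: "R v h" "E d h" using d by (auto simp: nbr_def)
      have "R h v" using R_eq[OF vn False h(1)] R_refl[OF vn] by simp
      moreover have "h \<in> Z" using nbr_dest[OF d vn False] h(2) R_cls[OF vn False h(1)] by (auto simp: Z_def)
      ultimately show ?thesis using v by blast
    qed auto
  qed
  have "card {v. keep v} \<le> card ({v. U v} \<union> {d. X d \<and> \<not> U d} \<union> (\<Union>h\<in>Z. {w. R h w \<and> keep w}))"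
    using cov finU finX finZ cls by (intro card_mono) auto
  also have "\<dots> \<le> card {v. U v} + card {d. X d \<and> \<not> U d} + card (\<Union>h\<in>Z. {w. R h w \<and> keep w})"
    using card_Un_le[of "{v. U v} \<union> {d. X d \<and> \<not> U d}" "\<Union>h\<in>Z. {w. R h w \<and> keep w}"]
      card_Un_le[of "{v. U v}" "{d. X d \<and> \<not> U d}"] by linarith
  also have "card (\<Union>h\<in>Z. {w. R h w \<and> keep w}) \<le> (\<Sum>h\<in>Z. card {w. R h w \<and> keep w})"
    by (rule card_UN_le[OF finZ])
  also have "\<dots> \<le> of_nat (card Z) * T" by (rule sum_bounded_above) (use cls in blast)
  also have "\<dots> \<le> card {v. U v} * D * D * T" unfolding of_nat_id using Z by (rule mult_le_mono1)
  finally show ?thesis using frontier by (simp add: algebra_simps)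
qed

end

section \<open>Computing the reduced instance\<close>

definition edge_in :: "(nat \<Rightarrow> nat) \<Rightarrow> nat \<Rightarrow> nat \<Rightarrow> bool" where
  "edge_in i u v \<longleftrightarrow> u < i 0 \<and> v < i 0 \<and> i (1 + u * i 0 + v) = 1"

definition source_in :: "(nat \<Rightarrow> nat) \<Rightarrow> nat \<Rightarrow> bool" where
  "source_in i v \<longleftrightarrow> v < i 0 \<and> i (1 + i 0 * i 0 + v) = 1"

definition target_in :: "(nat \<Rightarrow> nat) \<Rightarrow> nat \<Rightarrow> bool" where
  "target_in i v \<longleftrightarrow> v < i 0 \<and> i (1 + i 0 * i 0 + i 0 + v) = 1"

definition given_in :: "(nat \<Rightarrow> nat) \<Rightarrow> nat \<Rightarrow> bool" where
  "given_in i v \<longleftrightarrow> source_in i v \<or> target_in i v"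

definition tokens_in :: "(nat \<Rightarrow> nat) \<Rightarrow> nat" where
  "tokens_in i = card {v. v < i 0 \<and> source_in i v}"

text \<open>The maximum degree expressed by counting: degrees are at most \<open>i 0\<close>, so the
  set is the initial segment below the maximum.\<close>

definition maxdeg_in :: "(nat \<Rightarrow> nat) \<Rightarrow> nat" where
  "maxdeg_in i = card {d. d < i 0 \<and> (\<exists>v<i 0. d < card {w. w < i 0 \<and> edge_in i v w})}"

text \<open>Raised to 1 for edgeless graphs because the estimates below use that it is positive; it
  is still at most \<open>\<Delta>\<close>.\<close>

definition degree_in :: "(nat \<Rightarrow> nat) \<Rightarrow> nat" where
  "degree_in i = (if maxdeg_in i = 0 then 1 else maxdeg_in i)"

text \<open>Since \<open>k + 2 * D \<le> 3 * (k * D)\<close> and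
  \<open>1 + D + D * D \<le> 3 * (D * D)\<close>, the factor 9 would provide enough room; 10 is the
  next even number, and parity is needed for the colouring.\<close>

definition path_in :: "(nat \<Rightarrow> nat) \<Rightarrow> nat" where
  "path_in i = 10 * (tokens_in i * (degree_in i * (degree_in i * degree_in i)))"

text \<open>With \<open>k\<close> tokens the factor is \<open>16 = 10 + 4 + 2\<close>: the path, two
  positions for each of at most \<open>2 * k * D\<close> frontier vertices, and the final summand 2
  in the condition on \<open>T\<close>.\<close>

definition bound_in :: "(nat \<Rightarrow> nat) \<Rightarrow> nat" where
  "bound_in i = 16 * (tokens_in i * (degree_in i * (degree_in i * degree_in i)))"

definition keep_in :: "(nat \<Rightarrow> nat) \<Rightarrow> nat \<Rightarrow> bool" where
  "keep_in i = shrink_defs.keep (i 0) (edge_in i) (given_in i) (path_in i) (bound_in i)"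

definition edge_out :: "(nat \<Rightarrow> nat) \<Rightarrow> nat \<Rightarrow> nat \<Rightarrow> bool" where
  "edge_out i = shrink_defs.E' (i 0) (edge_in i) (given_in i) (path_in i) (bound_in i)"

definition size_out :: "(nat \<Rightarrow> nat) \<Rightarrow> nat" where
  "size_out i = card {v. v < i 0 \<and> keep_in i v}"

definition rank_out :: "(nat \<Rightarrow> nat) \<Rightarrow> nat \<Rightarrow> nat" where
  "rank_out i v = card {w. w < i 0 \<and> keep_in i w \<and> w < v}"

text \<open>The sum acts as a description operator: ranks are injective on kept vertices, so at most
  one summand survives.\<close>

definition nth_out :: "(nat \<Rightarrow> nat) \<Rightarrow> nat \<Rightarrow> nat" where
  "nth_out i p = (\<Sum>v<i 0. v * of_bool (keep_in i v \<and> rank_out i v = p))"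

definition symbol_out :: "(nat \<Rightarrow> nat) \<Rightarrow> nat \<Rightarrow> nat" where
  "symbol_out i p = (if p = 0 then size_out i else if p - 1 < size_out i * size_out i
     then of_bool (edge_out i (nth_out i ((p - 1) div size_out i)) (nth_out i ((p - 1) mod size_out i)))
     else if p - 1 - size_out i * size_out i < size_out i
     then of_bool (source_in i (nth_out i (p - 1 - size_out i * size_out i)))
     else of_bool (target_in i (nth_out i (p - 1 - size_out i * size_out i - size_out i))))"

definition length_out :: "(nat \<Rightarrow> nat) \<Rightarrow> nat" where
  "length_out i = 1 + size_out i * size_out i + size_out i + size_out i"

definition move_ok :: "(nat \<Rightarrow> nat) \<Rightarrow> nat \<Rightarrow> nat \<Rightarrow> nat \<Rightarrow> bool" where
  "move_ok i m u w \<longleftrightarrow> digit (i 0) m u \<and> \<not> digit (i 0) m w \<and> edge_out i u w \<and>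
     (\<forall>x<i 0. digit (i 0) m x \<and> \<not> x = u \<longrightarrow> \<not> edge_out i w x)"

text \<open>The number \<open>z\<close> codes the pair of the vertex left and the vertex entered. A
  forbidden pair returns the state itself, so each state has the same number
  \<open>i 0 * i 0\<close> of successors.\<close>

definition move :: "(nat \<Rightarrow> nat) \<Rightarrow> nat \<Rightarrow> nat \<Rightarrow> nat" where
  "move i m z = (if move_ok i m (z div i 0) (z mod i 0)
     then m + 2 ^ min (z mod i 0) (i 0) - 2 ^ min (z div i 0) (i 0) else m)"

definition source_mask :: "(nat \<Rightarrow> nat) \<Rightarrow> nat" where
  "source_mask i = set_encode {v. v < i 0 \<and> source_in i v}"

definition target_mask :: "(nat \<Rightarrow> nat) \<Rightarrow> nat" where
  "target_mask i = set_encode {v. v < i 0 \<and> target_in i v}"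

lemmas pt_rules = ptb_conj ptb_disj ptb_not ptb_imp ptb_ex ptb_all ptb_less ptb_le ptb_eq pt_card pt_sum pt_if
  pt_add pt_diff pt_mult pt_div pt_mod pt_pow2 pt_set_encode ptb_digit pt_size pt_const pt_read

lemma ptb_edge_in:
  assumes "pt q f" "pt q g" shows "ptb q (\<lambda>e i. edge_in i (f e i) (g e i))"
  unfolding edge_in_def
  by (insert assms, intro pt_rules; (assumption | (erule pt_mono, linarith) | linarith))

lemma ptb_source_in:
  assumes "pt q f" shows "ptb q (\<lambda>e i. source_in i (f e i))"
  unfolding source_in_def
  by (insert assms, intro pt_rules; (assumption | (erule pt_mono, linarith) | linarith))

lemma ptb_target_in:
  assumes "pt q f" shows "ptb q (\<lambda>e i. target_in i (f e i))"
  unfolding target_in_def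
  by (insert assms, intro pt_rules; (assumption | (erule pt_mono, linarith) | linarith))

lemma ptb_given_in:
  assumes "pt q f" shows "ptb q (\<lambda>e i. given_in i (f e i))"
  unfolding given_in_def by (intro ptb_disj ptb_source_in ptb_target_in assms)

lemma pt_tokens_in: "pt q (\<lambda>e i. tokens_in i)"
  unfolding tokens_in_def by (intro pt_card ptb_source_in)

lemma pt_degree_in: "pt q (\<lambda>e i. degree_in i)"
  unfolding degree_in_def maxdeg_in_def
  by (intro ptb_edge_in pt_rules; (assumption | (erule pt_mono, linarith) | linarith))

lemma pt_path_in: "pt q (\<lambda>e i. path_in i)"
  unfolding path_in_def by (intro pt_mult pt_const pt_tokens_in pt_degree_in)

lemma pt_bound_in: "pt q (\<lambda>e i. bound_in i)"
  unfolding bound_in_def by (intro pt_mult pt_const pt_tokens_in pt_degree_in)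

lemmas pt_rules1 = ptb_edge_in ptb_given_in pt_path_in pt_bound_in pt_rules

lemma ptb_X:
  assumes "pt q f" shows "ptb q (\<lambda>e i. shrink_defs.X (i 0) (edge_in i) (given_in i) (f e i))"
  unfolding shrink_defs.X_def
  by (insert assms, intro pt_rules1; (assumption | (erule pt_mono, linarith) | linarith))

lemma ptb_A:
  assumes "pt q f" "pt q g"
  shows "ptb q (\<lambda>e i. shrink_defs.A (i 0) (edge_in i) (given_in i) (f e i) (g e i))"
  unfolding shrink_defs.A_def by (intro ptb_conj ptb_not ptb_edge_in ptb_X assms)

lemma ptb_even_walk:
  assumes "pt q f" "pt q g"
  shows "ptb q (\<lambda>e i. shrink_defs.even_walk (i 0) (edge_in i) (given_in i) (f e i) (g e i))"
  unfolding shrink_defs.even_walk_def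
proof (rule ptb_reach[OF _ assms])
  fix q' h h' assume "pt q' h" "pt q' h'"
  then show "ptb q' (\<lambda>e i. \<exists>z<i 0. shrink_defs.A (i 0) (edge_in i) (given_in i) (h e i) z \<and>
      shrink_defs.A (i 0) (edge_in i) (given_in i) z (h' e i))"
    by - (intro ptb_A pt_rules1; (assumption | (erule pt_mono, linarith) | linarith))
qed

lemma ptb_R:
  assumes "pt q f" "pt q g"
  shows "ptb q (\<lambda>e i. shrink_defs.R (i 0) (edge_in i) (given_in i) (f e i) (g e i))"
  unfolding shrink_defs.R_def
  by (insert assms, intro ptb_even_walk ptb_A pt_rules1; (assumption | (erule pt_mono, linarith) | linarith))

lemma ptb_nbr:
  assumes "pt q f" "pt q g"
  shows "ptb q (\<lambda>e i. shrink_defs.nbr (i 0) (edge_in i) (given_in i) (f e i) (g e i))"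
  unfolding shrink_defs.nbr_def
  by (insert assms, intro ptb_R ptb_X pt_rules1; (assumption | (erule pt_mono, linarith) | linarith))

lemma ptb_alive:
  assumes "pt q f"
  shows "ptb q (\<lambda>e i. shrink_defs.alive (i 0) (edge_in i) (given_in i) (f e i))"
  unfolding shrink_defs.alive_def
  by (insert assms, intro ptb_nbr ptb_X pt_rules1; (assumption | (erule pt_mono, linarith) | linarith))

lemma ptb_big:
  assumes "pt q f"
  shows "ptb q (\<lambda>e i. shrink_defs.big (i 0) (edge_in i) (given_in i) (bound_in i) (f e i))"
  unfolding shrink_defs.big_def
  by (insert assms, intro ptb_alive ptb_R pt_rules1; (assumption | (erule pt_mono, linarith) | linarith))

lemma pt_rk:
  assumes "pt q f"
  shows "pt q (\<lambda>e i. shrink_defs.rk (i 0) (edge_in i) (given_in i) (f e i))"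
  unfolding shrink_defs.rk_def
  by (insert assms, intro ptb_R pt_rules1; (assumption | (erule pt_mono, linarith) | linarith))

lemma pt_ix:
  assumes "pt q f" "pt q g"
  shows "pt q (\<lambda>e i. shrink_defs.ix (i 0) (edge_in i) (given_in i) (f e i) (g e i))"
  unfolding shrink_defs.ix_def
  by (insert assms, intro ptb_nbr pt_rules1; (assumption | (erule pt_mono, linarith) | linarith))

lemma ptb_differ:
  assumes "pt q f" "pt q g"
  shows "ptb q (\<lambda>e i. shrink_defs.differ (i 0) (edge_in i) (given_in i) (f e i) (g e i))"
  unfolding shrink_defs.differ_def
  by (insert assms, intro ptb_nbr pt_ix ptb_R ptb_even_walk pt_rules1;
      (assumption | (erule pt_mono, linarith) | linarith))

lemma pt_pos:
  assumes "pt q f" "pt q g"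
  shows "pt q (\<lambda>e i. shrink_defs.pos (i 0) (edge_in i) (given_in i) (path_in i) (f e i) (g e i))"
  unfolding shrink_defs.pos_def by (intro pt_if ptb_eq pt_ix pt_const pt_add pt_mult pt_path_in ptb_differ assms)

lemma ptb_gad:
  assumes "pt q f"
  shows "ptb q (\<lambda>e i. shrink_defs.gad (i 0) (edge_in i) (given_in i) (path_in i) (bound_in i) (f e i))"
  unfolding shrink_defs.gad_def
  by (insert assms, intro ptb_big pt_rk ptb_nbr pt_pos pt_rules1;
      (assumption | (erule pt_mono, linarith) | linarith))

lemma ptb_core:
  assumes "pt q f"
  shows "ptb q (\<lambda>e i. shrink_defs.core (i 0) (edge_in i) (given_in i) (bound_in i) (f e i))"
  unfolding shrink_defs.core_def by (intro ptb_disj ptb_conj ptb_not ptb_X ptb_alive ptb_big assms)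

lemma ptb_att:
  assumes "pt q f" "pt q g"
  shows "ptb q (\<lambda>e i. shrink_defs.att (i 0) (edge_in i) (given_in i) (path_in i) (bound_in i) (f e i) (g e i))"
  unfolding shrink_defs.att_def by (intro ptb_conj ptb_gad ptb_nbr ptb_eq pt_rk pt_pos assms)

lemma ptb_edge_out:
  assumes "pt q f" "pt q g" shows "ptb q (\<lambda>e i. edge_out i (f e i) (g e i))"
  unfolding edge_out_def shrink_defs.E'_def Suc_eq_plus1
  by (intro ptb_disj ptb_conj ptb_core ptb_edge_in ptb_gad ptb_R ptb_eq pt_rk ptb_att pt_add pt_const assms)

lemma ptb_keep_in:
  assumes "pt q f" shows "ptb q (\<lambda>e i. keep_in i (f e i))"
  unfolding keep_in_def shrink_defs.keep_def by (intro ptb_disj ptb_core ptb_gad assms)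

lemma pt_size_out: "pt q (\<lambda>e i. size_out i)"
  unfolding size_out_def by (intro pt_card ptb_keep_in)

lemma pt_nth_out:
  assumes "pt q f" shows "pt q (\<lambda>e i. nth_out i (f e i))"
  unfolding nth_out_def rank_out_def
  by (insert assms, intro ptb_keep_in pt_rules; (assumption | (erule pt_mono, linarith) | linarith))

lemma pt_length_out: "pt q (\<lambda>e i. length_out i)"
  unfolding length_out_def by (intro pt_add pt_mult pt_size_out pt_const)

lemma pt_symbol_out:
  assumes "pt q f" shows "pt q (\<lambda>e i. symbol_out i (f e i))"
  unfolding symbol_out_def
  by (intro pt_if ptb_eq ptb_less pt_const pt_diff pt_mult pt_div pt_mod pt_size_out ptb_edge_out
      pt_nth_out ptb_source_in ptb_target_in assms)

lemma pt_move:
  assumes "pt q f" "pt q g" shows "pt q (\<lambda>e i. move i (f e i) (g e i))"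
  unfolding move_def move_ok_def
  by (insert assms, intro ptb_edge_out pt_rules; (assumption | (erule pt_mono, linarith) | linarith))

lemma pt_source_mask: "pt q (\<lambda>e i. source_mask i)"
  unfolding source_mask_def by (intro pt_set_encode ptb_source_in)

lemma pt_target_mask: "pt q (\<lambda>e i. target_mask i)"
  unfolding target_mask_def by (intro pt_set_encode ptb_target_in)

section \<open>Kernel and solver\<close>

text \<open>Transport along an injective relabelling; it is applied to the numbering of the kept
  vertices and to its inverse.\<close>

lemma reach_image:
  assumes inj: "inj_on f V" and F: "\<And>x y. F x y \<Longrightarrow> x \<in> V \<and> y \<in> V \<and> E (f x) (f y)"
    and E: "\<And>x y. x \<in> V \<Longrightarrow> y \<in> V \<Longrightarrow> E (f x) (f y) \<Longrightarrow> F x y"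
    and A: "A \<subseteq> V" and st: "(step F)\<^sup>*\<^sup>* A B"
  shows "(step E)\<^sup>*\<^sup>* (f ` A) (f ` B)"
proof -
  from st have "B \<subseteq> V \<and> (step E)\<^sup>*\<^sup>* (f ` A) (f ` B)"
  proof (induction rule: rtranclp_induct)
    case (step B C)
    then have BV: "B \<subseteq> V" by simp
    from step(2) obtain u w where s: "indep F B" "indep F C" "u \<in> B" "w \<notin> B" "F u w" "C = insert w (B - {u})"
      unfolding step_def by blast
    have w: "w \<in> V" "E (f u) (f w)" using F[OF s(5)] by auto
    have CV: "C \<subseteq> V" using s(6) BV w by auto
    have ind: "indep E (f ` D)" if "indep F D" "D \<subseteq> V" for D
      unfolding indep_def
    proof (intro ballI notI)
      fix a b assume "a \<in> f ` D" "b \<in> f ` D" "E a b"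
      then obtain x y where xy: "x \<in> D" "y \<in> D" "E (f x) (f y)" by auto
      have "F x y" by (rule E[OF _ _ xy(3)]) (use xy that(2) in auto)
      then show False using xy that(1) unfolding indep_def by blast
    qed
    have "f w \<notin> f ` B" using inj w(1) BV s(4) by (auto dest: inj_onD)
    moreover have "f ` C = insert (f w) (f ` B - {f u})"
      using inj_on_image_set_diff[OF inj, of B "{u}"] BV s(3,6) by auto
    ultimately have "step E (f ` B) (f ` C)"
      by (intro stepI[OF ind[OF s(1) BV] ind[OF s(2) CV], of "f u" "f w"]) (use s(3) w(2) in auto)
    then show ?case using step.IH CV by auto
  qed (use A in simp)
  then show ?thesis ..
qed

text \<open>The matrix is indexed by a single number, read by \<open>div\<close> and
  \<open>mod\<close>, in the way \<open>symbol_out\<close> computes its entries.\<close>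

definition encode_with :: "nat \<Rightarrow> (nat \<Rightarrow> nat \<Rightarrow> bool) \<Rightarrow> (nat \<Rightarrow> bool) \<Rightarrow> (nat \<Rightarrow> bool) \<Rightarrow> nat list" where
  "encode_with n E S S' = n # map (\<lambda>j. of_bool (E (j div n) (j mod n))) [0..<n * n]
     @ map (\<lambda>v. of_bool (S v)) [0..<n] @ map (\<lambda>v. of_bool (S' v)) [0..<n]"

lemma concat_rows: "concat (map (\<lambda>u. map (f u) [0..<m]) [0..<k]) = map (\<lambda>j. f (j div m) (j mod m)) [0..<k * m]"
proof (induction k)
  case (Suc k)
  have "[0..<Suc k * m] = [0..<k * m] @ [k * m..<k * m + m]"
    using upt_add_eq_append[of 0 "k * m" m] by (simp add: add.commute)
  moreover have "map (\<lambda>j. f (j div m) (j mod m)) [k * m..<k * m + m] = map (f k) [0..<m]"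
    by (rule nth_equalityI) (auto simp: div_mult_self3)
  ultimately show ?case using Suc by simp
qed simp

lemma encode_eq:
  "encode I = encode_with (num_vertices I) (\<lambda>u v. (u, v) \<in> parcs (ts_graph I))
     (\<lambda>v. v \<in> ts_source I) (\<lambda>v. v \<in> ts_target I)"
  unfolding encode_def Let_def encode_with_def
  using concat_rows[of "\<lambda>u v. of_bool ((u, v) \<in> parcs (ts_graph I))"] by simp

lemma length_encode: "length (encode I) = 1 + num_vertices I * num_vertices I + num_vertices I + num_vertices I"
  by (simp add: encode_eq encode_with_def)

lemma encode_with_in:
  fixes n E S S' defines "i \<equiv> input_array (encode_with n E S S')"
  shows "i 0 = n" "u < n \<Longrightarrow> v < n \<Longrightarrow> i (1 + u * n + v) = of_bool (E u v)"
    "v < n \<Longrightarrow> i (1 + n * n + v) = of_bool (S v)" "v < n \<Longrightarrow> i (1 + n * n + n + v) = of_bool (S' v)"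
proof -
  show "i 0 = n" by (simp add: i_def input_array_def encode_with_def)
  show "i (1 + u * n + v) = of_bool (E u v)" if "u < n" "v < n"
  proof -
    have "u * n + v < n * n" using that mult_le_mono1[of "Suc u" n n] by simp
    then show ?thesis using that by (simp add: i_def input_array_def encode_with_def nth_append)
  qed
  show "v < n \<Longrightarrow> i (1 + n * n + v) = of_bool (S v)" "v < n \<Longrightarrow> i (1 + n * n + n + v) = of_bool (S' v)"
    by (auto simp: i_def input_array_def encode_with_def nth_append)
qed

text \<open>Slides preserve the number of tokens, and arcs end in vertices of the graph, so
  \<open>step\<close> loses nothing by mentioning neither.\<close>

lemma reconfigurable_iff:
  assumes ind: "independent_set G S" and fin: "finite (pverts G)" and G: "pair_wf_digraph G"
  shows "reconfigurable G S S' \<longleftrightarrow> (step (\<lambda>u v. (u, v) \<in> parcs G))\<^sup>*\<^sup>* S S'"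
proof
  let ?E = "\<lambda>u v. (u, v) \<in> parcs G"
  assume "reconfigurable G S S'"
  then obtain \<sigma> l where \<sigma>: "\<sigma> 0 = S" "\<sigma> l = S'" "\<And>i. i \<le> l \<Longrightarrow> independent_set G (\<sigma> i)"
    "\<And>i. i < l \<Longrightarrow> slide G (\<sigma> i) (\<sigma> (Suc i))"
    unfolding reconfigurable_def by blast
  have "(step ?E)\<^sup>*\<^sup>* S (\<sigma> i)" if "i \<le> l" for i
    using that
  proof (induction i)
    case (Suc i)
    have "step ?E (\<sigma> i) (\<sigma> (Suc i))"
      using \<sigma>(3)[of i] \<sigma>(3)[of "Suc i"] \<sigma>(4)[of i] Suc.prems
      unfolding step_def slide_def indep_def independent_set_def by auto
    then show ?case using Suc by simp
  qed (use \<sigma> in simp)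
  then show "(step ?E)\<^sup>*\<^sup>* S S'" using \<sigma>(2) by blast
next
  let ?E = "\<lambda>u v. (u, v) \<in> parcs G"
  assume "(step ?E)\<^sup>*\<^sup>* S S'"
  then obtain l where "(step ?E ^^ l) S S'" using rtranclp_imp_relpowp by metis
  then obtain f where f: "f 0 = S" "f l = S'" "\<And>i. i < l \<Longrightarrow> step ?E (f i) (f (Suc i))"
    unfolding relpowp_fun_conv by blast
  have inv: "independent_set G (f i) \<and> card (f i) = card S" if "i \<le> l" for i
    using that
  proof (induction i)
    case (Suc i)
    then have IH: "independent_set G (f i)" "card (f i) = card S" by auto
    obtain u w where s: "indep ?E (f (Suc i))" "u \<in> f i" "w \<notin> f i" "?E u w" "f (Suc i) = insert w (f i - {u})"
      using f(3)[of i] Suc.prems unfolding step_def by auto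
    have "finite (f i)" using IH(1) fin by (auto simp: independent_set_def intro: finite_subset)
    then have "card (f (Suc i)) = card (f i)" using s card.remove[of "f i" u] by simp
    moreover have "w \<in> pverts G" using pair_wf_digraph.in_arcsD2[OF G s(4)] .
    ultimately show ?case using IH s(1,5) by (auto simp: independent_set_def indep_def)
  qed (use f ind in simp)
  show "reconfigurable G S S'"
    unfolding reconfigurable_def
  proof (intro exI[of _ f] exI[of _ l] conjI allI impI)
    show "slide G (f i) (f (Suc i))" if "i < l" for i
      using f(3)[OF that] unfolding step_def slide_def by blast
  qed (use f inv in auto)
qed

text \<open>Once \<open>k\<close> has reached \<open>c\<close>, each further factor of
  \<open>fact\<close> is at least \<open>c\<close>; the constant pays for the smaller values. This
  removes the factor \<open>36 ^ k\<close> from the running time.\<close>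

lemma pow_le_fact: "\<exists>K. \<forall>k. c ^ k \<le> K * (fact k :: nat)"
proof -
  have "c ^ k \<le> Suc c ^ Suc c * fact k" for k
  proof (induction k)
    case (Suc k)
    show ?case
    proof (cases "Suc k \<le> c")
      case True
      have "c ^ Suc k \<le> Suc c ^ Suc k" by (intro power_mono) auto
      also have "\<dots> \<le> Suc c ^ Suc c" using True by (intro power_increasing) auto
      also have "\<dots> \<le> Suc c ^ Suc c * fact (Suc k)" using fact_ge_1[of "Suc k"] by (metis mult.right_neutral mult_le_mono2)
      finally show ?thesis .
    next
      case False
      then have "c * c ^ k \<le> Suc k * (Suc c ^ Suc c * fact k)" using Suc.IH by (intro mult_le_mono) auto
      also have "\<dots> = Suc c ^ Suc c * fact (Suc k)" unfolding fact_Suc of_nat_id by (rule mult.left_commute)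
      finally show ?thesis by simp
    qed
  qed (simp del: power_Suc)
  then show ?thesis by blast
qed

section \<open>The reduction for a given instance\<close>

locale bipartite_instance =
  fixes I :: ts_instance and \<Delta> :: nat
  assumes inst: "ts_bipartite_instance \<Delta> I" and \<Delta>: "1 \<le> \<Delta>"
begin

definition "n = num_vertices I"
definition "i = input_array (encode I)"
definition "E u v \<longleftrightarrow> (u, v) \<in> parcs (ts_graph I)"
definition "k = num_tokens I"
definition "D = degree_in i"

lemma wf: "pair_graph (ts_graph I)" "pverts (ts_graph I) = {..<n}" "independent_set (ts_graph I) (ts_source I)"
  "independent_set (ts_graph I) (ts_target I)" "card (ts_source I) = k" "card (ts_target I) = k" "1 \<le> k"
  using inst unfolding ts_bipartite_instance_def ts_instance_wf_def n_def k_def num_tokens_def by auto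

sublocale pair_graph "ts_graph I" by (rule wf(1))

lemma E_less: "E u v \<Longrightarrow> u < n \<and> v < n"
  using in_arcsD1 in_arcsD2 wf(2) unfolding E_def by blast

lemma E_sym: "symp E"
  using sym_arcs by (auto simp: E_def symp_def symmetric_def sym_def)

lemma source_less: "v \<in> ts_source I \<Longrightarrow> v < n" and target_less: "v \<in> ts_target I \<Longrightarrow> v < n"
  using wf(2-4) by (auto simp: independent_set_def)

lemma i0: "i 0 = n"
  unfolding i_def encode_eq n_def by (rule encode_with_in)

lemma edge_in: "edge_in i = E"
proof (intro ext)
  fix u v
  show "edge_in i u v = E u v"
  proof (cases "u < n \<and> v < n")
    case True
    then have "i (1 + u * n + v) = of_bool (E u v)"
      unfolding i_def encode_eq n_def E_def by (intro encode_with_in) auto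
    then show ?thesis using True by (simp add: edge_in_def i0)
  next
    case False
    then show ?thesis using E_less[of u v] unfolding edge_in_def i0 by blast
  qed
qed

lemma source_in: "source_in i v \<longleftrightarrow> v \<in> ts_source I"
proof (cases "v < n")
  case True
  then have "i (1 + n * n + v) = of_bool (v \<in> ts_source I)"
    unfolding i_def encode_eq n_def by (intro encode_with_in) auto
  then show ?thesis using True by (simp add: source_in_def i0)
qed (use source_less in \<open>auto simp: source_in_def i0\<close>)

lemma target_in: "target_in i v \<longleftrightarrow> v \<in> ts_target I"
proof (cases "v < n")
  case True
  then have "i (1 + n * n + n + v) = of_bool (v \<in> ts_target I)"
    unfolding i_def encode_eq n_def by (intro encode_with_in) auto
  then show ?thesis using True by (simp add: target_in_def i0)
qed (use target_less in \<open>auto simp: target_in_def i0\<close>)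

lemma tokens_in: "tokens_in i = k"
proof -
  have "{v. v < i 0 \<and> source_in i v} = ts_source I" using source_less by (auto simp: i0 source_in)
  then show ?thesis by (simp add: tokens_in_def wf)
qed

lemma degree: "card {w. E v w} \<le> D" "D \<le> \<Delta>" "1 \<le> D"
proof -
  have set: "{w. w < n \<and> E v w} = {w. E v w}" for v using E_less by auto
  have d\<Delta>: "card {w. E v w} \<le> \<Delta>" for v
  proof (cases "v < n")
    case True
    then have "v \<in> pverts (ts_graph I)" using wf(2) by simp
    then have le: "out_degree (with_proj (ts_graph I)) v \<le> \<Delta>"
      using inst unfolding ts_bipartite_instance_def max_degree_le_def by blast
    have "out_arcs (with_proj (ts_graph I)) v = Pair v ` {w. E v w}"
      by (auto simp: out_arcs_def E_def)
    then have "out_degree (with_proj (ts_graph I)) v = card {w. E v w}"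
      by (simp add: out_degree_def card_image inj_on_def)
    then show ?thesis using le by simp
  next
    case False
    then have "{w. E v w} = {}" using E_less by auto
    then show ?thesis by simp
  qed
  define S where "S = {d. d < n \<and> (\<exists>v<n. d < card {w. E v w})}"
  have S: "maxdeg_in i = card S" unfolding maxdeg_in_def i0 edge_in set S_def ..
  have finS: "finite S" by (simp add: S_def)
  have "S \<subseteq> {..<\<Delta>}" using d\<Delta> less_le_trans by (auto simp: S_def)
  then have "card S \<le> card {..<\<Delta>}" by (intro card_mono) auto
  then show "D \<le> \<Delta>" using \<Delta> S by (simp add: D_def degree_in_def)
  show "1 \<le> D" by (simp add: D_def degree_in_def)
  have "card {w. E v w} \<le> card S"
  proof (cases "v < n")
    case True
    have "{w. E v w} \<subseteq> {..<n}" using E_less by blast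
    then have "card {w. E v w} \<le> card {..<n}" by (rule card_mono[OF finite_lessThan])
    then have "card {w. E v w} \<le> n" by simp
    have "{..<card {w. E v w}} \<subseteq> S"
    proof
      fix d assume d: "d \<in> {..<card {w. E v w}}"
      then have "d < n" using \<open>card {w. E v w} \<le> n\<close> by simp
      then show "d \<in> S" unfolding S_def using d True by blast
    qed
    then have "card {..<card {w. E v w}} \<le> card S" by (rule card_mono[OF finS])
    then show ?thesis by simp
  next
    case False
    then have "{w. E v w} = {}" using E_less by auto
    then show ?thesis by simp
  qed
  then show "card {w. E v w} \<le> D" using S by (simp add: D_def degree_in_def)
qed

lemma col_exists: "\<exists>col :: nat \<Rightarrow> bool. \<forall>u v. E u v \<longrightarrow> col u \<noteq> col v"
proof -
  obtain A B where AB: "A \<inter> B = {}" "\<forall>(u, w)\<in>parcs (ts_graph I). (u \<in> A \<and> w \<in> B) \<or> (u \<in> B \<and> w \<in> A)"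
    using inst unfolding ts_bipartite_instance_def bipartite_def by blast
  show ?thesis by (rule exI[of _ "\<lambda>v. v \<in> A"]) (use AB in \<open>auto simp: E_def\<close>)
qed

text \<open>Used in the proof alone; the program sees colours only through
  \<open>even_walk\<close>.\<close>

definition "col = (SOME col :: nat \<Rightarrow> bool. \<forall>u v. E u v \<longrightarrow> col u \<noteq> col v)"

lemma col: "E u v \<Longrightarrow> col u \<noteq> col v"
  using someI_ex[OF col_exists] unfolding col_def by blast

definition "U v \<longleftrightarrow> v \<in> ts_source I \<or> v \<in> ts_target I"

lemma given_in: "given_in i = U"
  by (auto simp: given_in_def source_in target_in U_def fun_eq_iff)

lemma U_less: "U v \<Longrightarrow> v < n"
  using source_less target_less by (auto simp: U_def)

lemma card_U: "card {v. U v} \<le> 2 * k"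
proof -
  have "{v. U v} = ts_source I \<union> ts_target I" by (auto simp: U_def)
  then show ?thesis using card_Un_le[of "ts_source I" "ts_target I"] wf(5,6) by simp
qed

lemma path_in: "path_in i = 10 * (k * D ^ 3)" and bound_in: "bound_in i = 16 * (k * D ^ 3)"
  by (simp_all add: path_in_def bound_in_def tokens_in D_def power3_eq_cube)

lemma powers: "k \<le> k * D ^ 3" "k * D \<le> k * D ^ 3" "1 \<le> k * D ^ 3"
proof -
  have "1 \<le> D ^ 3" "D \<le> D ^ 3" using degree(3) by (auto intro: one_le_power self_le_power)
  then show "k \<le> k * D ^ 3" "k * D \<le> k * D ^ 3" by simp_all
  then show "1 \<le> k * D ^ 3" using wf(7) by linarith
qed

sublocale shrink n E U "path_in i" "bound_in i" D k col
proof
  show "symp E" by (rule E_sym)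
  show "u < n" if "E u v" for u v using E_less[OF that] by simp
  show "v < n" if "U v" for v by (rule U_less[OF that])
  show "col u \<noteq> col v" if "E u v" for u v by (rule col[OF that])
  show "card {w. E v w} \<le> D" for v by (rule degree)
  show "even (path_in i)" by (simp add: path_in)
  show "1 \<le> path_in i" using powers by (simp add: path_in)
  have "(k + 2 * D) * (1 + D + D * D) \<le> (3 * (k * D)) * (3 * (D * D))"
  proof (rule mult_le_mono)
    have "k \<le> k * D" "D \<le> k * D" using degree(3) wf(7) by simp_all
    then show "k + 2 * D \<le> 3 * (k * D)" by linarith
    have "1 \<le> D * D" "D \<le> D * D" using degree(3) by simp_all
    then show "1 + D + D * D \<le> 3 * (D * D)" by linarith
  qed
  also have "\<dots> = 9 * (k * D ^ 3)" by (simp add: power3_eq_cube)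
  finally show "(k + 2 * D) * (1 + D + D * D) \<le> path_in i" by (simp add: path_in)
  have "card {d. shrink_defs.X n E U d \<and> \<not> U d} \<le> card {v. U v} * D"
    by (rule shrink_defs.card_frontier) (use E_less U_less degree(1) in auto)
  also have "\<dots> \<le> 2 * k * D" using card_U by (rule mult_le_mono1)
  also have "2 * k * D \<le> 2 * (k * D ^ 3)" using powers(2) by simp
  finally show "path_in i + 2 * card {d. shrink_defs.X n E U d \<and> \<not> U d} + 2 \<le> bound_in i"
    using powers(3) unfolding path_in bound_in by linarith
qed

lemma keep_in: "keep_in i = keep"
  by (simp add: keep_in_def i0 edge_in given_in)

lemma edge_out: "edge_out i = E'"
  by (simp add: edge_out_def i0 edge_in given_in)

definition "V = {v. keep v}"

lemma V: "finite V" "V \<subseteq> {..<n}"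
  using keep_less finite_subset[of V "{..<n}"] by (auto simp: V_def)

lemma size_out: "size_out i = card V"
proof -
  have "{v. v < n \<and> keep v} = V" using V by (auto simp: V_def)
  then show ?thesis by (simp add: size_out_def i0 keep_in)
qed

lemma card_V: "card V \<le> 36 * (k ^ 2 * D ^ 5)" "card V \<le> n"
proof -
  have D: "1 \<le> D" by (rule degree)
  have "card V \<le> card {v. U v} * (1 + D) + card {v. U v} * D * D * bound_in i"
    unfolding V_def by (rule card_keep)
  also have "\<dots> \<le> 2 * k * (1 + D) + 2 * k * D * D * bound_in i"
    using card_U by (intro add_mono mult_le_mono) auto
  also have "2 * k * D * D * bound_in i = 32 * (k ^ 2 * D ^ 5)"
    unfolding bound_in by (simp add: power_numeral_reduce power2_eq_square)
  also have "2 * k * (1 + D) \<le> 4 * (k ^ 2 * D ^ 5)"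
  proof -
    have "k * (1 + D) \<le> k ^ 2 * (2 * D ^ 5)"
    proof (rule mult_le_mono)
      show "k \<le> k ^ 2" using wf(7) by (simp add: power2_eq_square)
      have "1 \<le> D ^ 5" "D \<le> D ^ 5" using D by (auto intro: one_le_power self_le_power)
      then show "1 + D \<le> 2 * D ^ 5" by linarith
    qed
    then show ?thesis by simp
  qed
  finally show "card V \<le> 36 * (k ^ 2 * D ^ 5)" by simp
  show "card V \<le> n" using card_mono[OF _ V(2)] by simp
qed

lemma fits_encode: "fits_input (encode I) (input_size I + 1)"
proof -
  have n: "n \<le> input_size I" unfolding input_size_def length_encode n_def by simp
  have "x < 2 ^ (input_size I + 1)" if "x \<in> set (encode I)" for x
  proof -
    have "x \<le> n \<or> x \<le> 1" using that unfolding encode_eq encode_with_def n_def by auto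
    moreover have "1 \<le> input_size I" unfolding input_size_def length_encode by simp
    ultimately have "x \<le> input_size I + 1" using n by linarith
    then show ?thesis by (rule nat_less_pow2)
  qed
  moreover have "2 \<le> input_size I + 1" unfolding input_size_def length_encode by simp
  moreover have "length (encode I) < 2 ^ (input_size I + 1)"
    by (rule nat_less_pow2) (simp add: input_size_def)
  moreover have "input_array (encode I) 0 \<le> input_size I + 1" using i0 n unfolding i_def by simp
  ultimately show ?thesis unfolding fits_input_def by blast
qed

end

lemma computes_within_mono:
  assumes "computes_within c xs ys b" "b \<le> b'" shows "computes_within c xs ys b'"
proof -
  obtain t s where e: "exec c (initial_store xs) t s" "t \<le> b" "output_of s = ys"
    using assms(1) unfolding computes_within_def by blast
  have "t \<le> b'" using e(2) assms(2) by (rule le_trans)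
  then show ?thesis unfolding computes_within_def using e(1,3) by blast
qed

section \<open>The reduced instance and its encoding\<close>

context bipartite_instance
begin

lemma rank_bij_V: "bij_betw (rank_out i) V {..<card V}"
proof -
  have "rank_out i v = card {w\<in>V. w < v}" for v
  proof -
    have "{w. w < n \<and> keep w \<and> w < v} = {w\<in>V. w < v}" using keep_less by (auto simp: V_def)
    then show ?thesis by (simp add: rank_out_def i0 keep_in)
  qed
  then have "rank_out i = (\<lambda>v. card {w\<in>V. w < v})" by (rule ext)
  then show ?thesis using rank_bij[OF V(1)] by simp
qed

abbreviation "\<nu> \<equiv> nth_out i"

lemma nth_rank:
  assumes "v \<in> V" shows "\<nu> (rank_out i v) = v"
proof -
  have "keep x \<and> rank_out i x = rank_out i v \<longleftrightarrow> x = v" for x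
    using assms bij_betw_imp_inj_on[OF rank_bij_V] by (auto simp: V_def dest: inj_onD)
  then have "\<nu> (rank_out i v) = (\<Sum>x<n. x * of_bool (x = v))"
    by (simp add: nth_out_def i0 keep_in)
  also have "\<dots> = (\<Sum>x<n. if x = v then v else 0)" by (rule sum.cong) auto
  also have "\<dots> = v" using assms V(2) by auto
  finally show ?thesis .
qed

lemma nth_V:
  assumes "p < card V" shows "\<nu> p \<in> V" "rank_out i (\<nu> p) = p"
proof -
  have "p \<in> rank_out i ` V" using bij_betw_imp_surj_on[OF rank_bij_V] assms by simp
  then obtain v where v: "v \<in> V" "p = rank_out i v" by auto
  then show "\<nu> p \<in> V" "rank_out i (\<nu> p) = p" using nth_rank by simp_all
qed

lemma nth_bij: "bij_betw \<nu> {..<card V} V"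
proof (rule bij_betw_byWitness[where f' = "rank_out i"])
  show "\<nu> ` {..<card V} \<subseteq> V" using nth_V(1) by auto
  show "rank_out i ` V \<subseteq> {..<card V}" using bij_betw_imp_surj_on[OF rank_bij_V] by simp
qed (use nth_V(2) nth_rank in auto)

definition edge_J where "edge_J p q \<longleftrightarrow> p < card V \<and> q < card V \<and> E' (\<nu> p) (\<nu> q)"

definition preimage :: "nat set \<Rightarrow> nat set" where "preimage S = {p. p < card V \<and> \<nu> p \<in> S}"

text \<open>The kept vertices are renumbered in increasing order, as an instance must use an initial
  segment of the numbers.\<close>

definition J :: ts_instance where
  "J = \<lparr>ts_graph = \<lparr>pverts = {..<card V}, parcs = {(p, q). edge_J p q}\<rparr>,
     ts_source = preimage (ts_source I), ts_target = preimage (ts_target I)\<rparr>"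

lemma given_V: "U v \<Longrightarrow> v \<in> V"
  using U_less by (auto simp: V_def keep_def core_def X_def)

lemma image_preimage:
  assumes "\<And>v. v \<in> S \<Longrightarrow> U v" shows "\<nu> ` preimage S = S" "card (preimage S) = card S" "preimage S = rank_out i ` S"
proof -
  have SV: "S \<subseteq> V" using assms given_V by blast
  show eq: "preimage S = rank_out i ` S"
  proof (intro set_eqI iffI)
    fix p assume "p \<in> preimage S"
    then have "p < card V" "\<nu> p \<in> S" by (auto simp: preimage_def)
    then show "p \<in> rank_out i ` S" using nth_V(2)[of p] by (intro image_eqI[of _ _ "\<nu> p"]) auto
  next
    fix p assume "p \<in> rank_out i ` S"
    then obtain v where v: "v \<in> S" "p = rank_out i v" by auto
    then have "v \<in> V" using SV by blast
    then show "p \<in> preimage S" using v nth_rank bij_betw_apply[OF rank_bij_V] by (auto simp: preimage_def)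
  qed
  have "inj_on (rank_out i) S" using inj_on_subset[OF bij_betw_imp_inj_on[OF rank_bij_V] SV] .
  then show "card (preimage S) = card S" unfolding eq by (rule card_image)
  show "\<nu> ` preimage S = S" unfolding eq image_image using nth_rank SV by force
qed

lemma edge_J_iff:
  assumes "x \<in> V" "y \<in> V" shows "edge_J (rank_out i x) (rank_out i y) \<longleftrightarrow> E' x y"
  using assms bij_betw_apply[OF rank_bij_V] by (auto simp: edge_J_def nth_rank)

lemma E'_V: "E' x y \<Longrightarrow> x \<in> V \<and> y \<in> V"
  using E'_keep by (simp add: V_def)

text \<open>Given vertices are core vertices, and between core vertices \<open>E'\<close> has no
  edges beyond those of \<open>E\<close>.\<close>

lemma indep_E':
  assumes "independent_set (ts_graph I) S" "\<And>v. v \<in> S \<Longrightarrow> U v" shows "indep E' S"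
  unfolding indep_def
proof (intro ballI notI)
  fix u w assume uw: "u \<in> S" "w \<in> S" "E' u w"
  have c: "core u" "core w" using uw(1,2) assms(2) U_less by (auto simp: core_def X_def)
  then have "E u w" using E'_core[OF uw(3) c(1)] by blast
  then show False using assms(1) uw(1,2) by (simp add: independent_set_def E_def)
qed

lemma independent_J:
  assumes "independent_set (ts_graph I) S" "\<And>v. v \<in> S \<Longrightarrow> U v"
  shows "independent_set (ts_graph J) (preimage S)"
  using indep_E'[OF assms] by (auto simp: independent_set_def indep_def J_def preimage_def edge_J_def)

lemma source_U: "v \<in> ts_source I \<Longrightarrow> U v" and target_U: "v \<in> ts_target I \<Longrightarrow> U v"
  by (simp_all add: U_def)

lemma E'_irrefl: "\<not> E' x x"
  using bipartite' by metis

lemma graph_J: "pair_graph (ts_graph J)"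
proof
  show "finite (pverts (ts_graph J))" by (simp add: J_def)
  show "finite (parcs (ts_graph J))"
    by (rule finite_subset[of _ "{..<card V} \<times> {..<card V}"]) (auto simp: J_def edge_J_def)
  show "symmetric (with_proj (ts_graph J))"
    unfolding symmetric_def using E'_sym by (auto simp: J_def edge_J_def sym_def)
qed (use E'_irrefl in \<open>auto simp: J_def edge_J_def\<close>)

lemma instance_J: "ts_bipartite_instance \<Delta> J"
  unfolding ts_bipartite_instance_def ts_instance_wf_def
proof (intro conjI)
  show "pair_graph (ts_graph J)" by (rule graph_J)
  show "pverts (ts_graph J) = {..<num_vertices J}" by (simp add: num_vertices_def J_def)
  show "independent_set (ts_graph J) (ts_source J)"
    using independent_J[OF wf(3) source_U] by (simp add: J_def)
  show "independent_set (ts_graph J) (ts_target J)"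
    using independent_J[OF wf(4) target_U] by (simp add: J_def)
  show "card (ts_source J) = card (ts_target J)"
    using image_preimage(2)[OF source_U] image_preimage(2)[OF target_U] wf(5,6) by (simp add: J_def)
  show "1 \<le> num_tokens J"
    using image_preimage(2)[OF source_U] wf(5,7) by (simp add: J_def num_tokens_def)
  obtain col' :: "nat \<Rightarrow> bool" where col': "\<And>u v. E' u v \<Longrightarrow> col' u \<noteq> col' v" using bipartite' by metis
  show "bipartite (ts_graph J)"
    unfolding bipartite_def
  proof (intro exI conjI)
    let ?A = "{p. p < card V \<and> col' (\<nu> p)}" and ?B = "{p. p < card V \<and> \<not> col' (\<nu> p)}"
    show "?A \<union> ?B = pverts (ts_graph J)" by (auto simp: J_def)
    show "?A \<inter> ?B = {}" by auto
    show "\<forall>(u, w)\<in>parcs (ts_graph J). u \<in> ?A \<and> w \<in> ?B \<or> u \<in> ?B \<and> w \<in> ?A"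
      using col' by (auto simp: J_def edge_J_def)
  qed
  show "max_degree_le (ts_graph J) \<Delta>"
    unfolding max_degree_le_def
  proof
    fix p assume "p \<in> pverts (ts_graph J)"
    have "out_arcs (with_proj (ts_graph J)) p = Pair p ` {q. edge_J p q}"
      by (auto simp: out_arcs_def J_def)
    then have "out_degree (with_proj (ts_graph J)) p = card {q. edge_J p q}"
      by (simp add: out_degree_def card_image inj_on_def)
    also have "\<dots> \<le> card {w. E' (\<nu> p) w}"
    proof (rule card_inj_on_le[OF _ _ fin_E'])
      show "inj_on \<nu> {q. edge_J p q}"
        by (rule inj_on_subset[OF bij_betw_imp_inj_on[OF nth_bij]]) (auto simp: edge_J_def)
    qed (auto simp: edge_J_def)
    also have "\<dots> \<le> \<Delta>" using deg'[of "\<nu> p"] degree(2) by (rule le_trans)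
    finally show "out_degree (with_proj (ts_graph J)) p \<le> \<Delta>" .
  qed
qed

lemma yes_I: "ts_yes I \<longleftrightarrow> (step E')\<^sup>*\<^sup>* (ts_source I) (ts_target I)"
proof -
  have fin: "finite (pverts (ts_graph I))" using wf(2) by simp
  have g: "pair_wf_digraph (ts_graph I)" by unfold_locales
  have "finite (ts_source I)" by (rule finite_subset[of _ "{..<n}"]) (auto dest: source_less)
  then have "(step E)\<^sup>*\<^sup>* (ts_source I) (ts_target I) \<longleftrightarrow> (step E')\<^sup>*\<^sup>* (ts_source I) (ts_target I)"
    by (rule reach_iff) (use wf(5) in \<open>auto simp: U_def\<close>)
  moreover have "(\<lambda>u v. (u, v) \<in> parcs (ts_graph I)) = E" by (simp add: E_def fun_eq_iff)
  ultimately show ?thesis unfolding ts_yes_def using reconfigurable_iff[OF wf(3) fin g] by simp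
qed

lemma yes_J: "ts_yes J \<longleftrightarrow> ts_yes I"
proof -
  have fin: "finite (pverts (ts_graph J))" by (simp add: J_def)
  have g: "pair_wf_digraph (ts_graph J)" using graph_J
    by (simp add: pair_graph_def pair_digraph_def pair_fin_digraph_def)
  have ind: "independent_set (ts_graph J) (ts_source J)"
    using independent_J[OF wf(3) source_U] by (simp add: J_def)
  have "(\<lambda>u v. (u, v) \<in> parcs (ts_graph J)) = edge_J" by (simp add: J_def fun_eq_iff)
  then have "ts_yes J \<longleftrightarrow> (step edge_J)\<^sup>*\<^sup>* (preimage (ts_source I)) (preimage (ts_target I))"
    unfolding ts_yes_def using reconfigurable_iff[OF ind fin g] by (simp add: J_def)
  also have "\<dots> \<longleftrightarrow> (step E')\<^sup>*\<^sup>* (ts_source I) (ts_target I)"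
  proof
    assume r: "(step edge_J)\<^sup>*\<^sup>* (preimage (ts_source I)) (preimage (ts_target I))"
    have "(step E')\<^sup>*\<^sup>* (\<nu> ` preimage (ts_source I)) (\<nu> ` preimage (ts_target I))"
      by (rule reach_image[OF bij_betw_imp_inj_on[OF nth_bij] _ _ _ r]) (auto simp: edge_J_def preimage_def)
    then show "(step E')\<^sup>*\<^sup>* (ts_source I) (ts_target I)"
      using image_preimage(1)[OF source_U] image_preimage(1)[OF target_U] by simp
  next
    assume r: "(step E')\<^sup>*\<^sup>* (ts_source I) (ts_target I)"
    have "(step edge_J)\<^sup>*\<^sup>* (rank_out i ` ts_source I) (rank_out i ` ts_target I)"
      by (rule reach_image[OF bij_betw_imp_inj_on[OF rank_bij_V] _ _ _ r])
        (use E'_V edge_J_iff given_V source_U in auto)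
    then show "(step edge_J)\<^sup>*\<^sup>* (preimage (ts_source I)) (preimage (ts_target I))"
      using image_preimage(3)[OF source_U] image_preimage(3)[OF target_U] by simp
  qed
  also have "\<dots> \<longleftrightarrow> ts_yes I" by (rule yes_I[symmetric])
  finally show ?thesis .
qed

lemma encode_J: "encode J = map (symbol_out i) [0..<length_out i]"
proof (rule nth_equalityI)
  let ?m = "card V"
  have enc: "encode J = encode_with ?m edge_J (\<lambda>p. p \<in> preimage (ts_source I)) (\<lambda>p. p \<in> preimage (ts_target I))"
    unfolding encode_eq by (simp add: J_def num_vertices_def)
  show "length (encode J) = length (map (symbol_out i) [0..<length_out i])"
    by (simp add: enc encode_with_def length_out_def size_out)
  fix p assume "p < length (encode J)"
  then have p: "p < 1 + ?m * ?m + ?m + ?m" by (simp add: enc encode_with_def)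
  have "encode J ! p = symbol_out i p"
  proof (cases "p = 0")
    case True
    then show ?thesis by (simp add: enc encode_with_def symbol_out_def size_out)
  next
    case False
    then obtain j where j: "p = Suc j" using not0_implies_Suc by blast
    consider "j < ?m * ?m" | "\<not> j < ?m * ?m" "j - ?m * ?m < ?m" | "\<not> j < ?m * ?m" "\<not> j - ?m * ?m < ?m" by blast
    then show ?thesis
    proof cases
      case 1
      then have "0 < ?m" by (cases "?m = 0") auto
      then have "j div ?m < ?m" "j mod ?m < ?m" using 1 by (simp_all add: less_mult_imp_div_less)
      then show ?thesis using 1 j
        by (simp add: enc encode_with_def symbol_out_def size_out nth_append edge_out edge_J_def)
    next
      case 2
      then show ?thesis using j
        by (simp add: enc encode_with_def symbol_out_def size_out nth_append source_in preimage_def)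
    next
      case 3
      then have "j - ?m * ?m - ?m < ?m" using p j by linarith
      then show ?thesis using 3 j
        by (simp add: enc encode_with_def symbol_out_def size_out nth_append target_in preimage_def)
    qed
  qed
  moreover have "p < length_out i" using p by (simp add: length_out_def size_out)
  then have "map (symbol_out i) [0..<length_out i] ! p = symbol_out i p" by simp
  ultimately show "encode J ! p = map (symbol_out i) [0..<length_out i] ! p" by metis
qed

text \<open>The reduced graph uses a subset of the original vertices, so its encoding is no longer
  than the input; \<open>output_program\<close> requires such a bound.\<close>

lemma length_out_le: "length_out i \<le> input_size I"
proof -
  have "card V * card V \<le> n * n" using card_V(2) by (intro mult_le_mono)
  then show ?thesis using card_V(2) unfolding length_out_def size_out input_size_def length_encode n_def[symmetric] by linarith
qed

lemma size_J: "num_vertices J \<le> 36 * (k ^ 2 * \<Delta> ^ 5)"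
proof -
  have "D ^ 5 \<le> \<Delta> ^ 5" using degree(2) by (rule power_mono) simp
  then have "36 * (k ^ 2 * D ^ 5) \<le> 36 * (k ^ 2 * \<Delta> ^ 5)" by (intro mult_le_mono2)
  with card_V(1) have "card V \<le> 36 * (k ^ 2 * \<Delta> ^ 5)" by (rule le_trans)
  then show ?thesis by (simp add: num_vertices_def J_def)
qed

section \<open>Searching the independent sets of the reduced graph\<close>

lemma move_encode:
  assumes Q: "Q \<subseteq> {..<n}" and ind: "indep E' Q" and z: "z < n * n"
  shows "move i (set_encode Q) z = set_encode Q \<or> (\<exists>B. step E' Q B \<and> move i (set_encode Q) z = set_encode B)"
proof (cases "move_ok i (set_encode Q) (z div n) (z mod n)")
  case False
  then show ?thesis by (simp add: move_def i0)
next
  case True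
  define u w where "u = z div n" and "w = z mod n"
  have fin: "finite Q" using Q finite_subset by blast
  have dig: "digit n (set_encode Q) x \<longleftrightarrow> x \<in> Q" for x using Q fin by (auto simp: digit_def)
  have uw: "u \<in> Q" "w \<notin> Q" "E' u w" "\<And>x. x \<in> Q \<Longrightarrow> x \<noteq> u \<Longrightarrow> \<not> E' w x"
    using True Q unfolding move_ok_def i0 dig edge_out u_def w_def by auto
  let ?B = "insert w (Q - {u})"
  have wn: "w < n" "u < n" using E'_V[OF uw(3)] V(2) by auto
  have "indep E' ?B"
    unfolding indep_def
  proof (intro ballI notI)
    fix x y assume xy: "x \<in> ?B" "y \<in> ?B" "E' x y"
    show False
    proof (cases "x = w"; cases "y = w")
      assume "x = w" "y = w"
      then show False using xy(3) E'_irrefl by blast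
    next
      assume "x = w" "y \<noteq> w"
      then show False using xy uw(4)[of y] by blast
    next
      assume "x \<noteq> w" "y = w"
      then show False using xy uw(4)[of x] E'_sym[OF xy(3)] by blast
    next
      assume "x \<noteq> w" "y \<noteq> w"
      then show False using xy ind unfolding indep_def by blast
    qed
  qed
  then have "step E' Q ?B" using ind uw by (intro stepI[of E' Q ?B u w]) auto
  moreover have "set_encode Q = 2 ^ u + set_encode (Q - {u})"
    using set_encode_insert[of "Q - {u}" u] fin uw(1) by (simp add: insert_absorb)
  then have "set_encode Q + 2 ^ w - 2 ^ u = set_encode ?B"
    using fin uw(2) by (simp add: set_encode_insert)
  then have "move i (set_encode Q) z = set_encode ?B"
    using True wn by (simp add: move_def i0 u_def[symmetric] w_def[symmetric] min_def)
  ultimately show ?thesis by blast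
qed

lemma step_move:
  assumes Q: "Q \<subseteq> {..<n}" and st: "step E' Q B"
  shows "B \<subseteq> {..<n}" "\<exists>z<n * n. move i (set_encode Q) z = set_encode B"
proof -
  obtain u w where s: "indep E' Q" "indep E' B" "u \<in> Q" "w \<notin> Q" "E' u w" "B = insert w (Q - {u})"
    using st unfolding step_def by blast
  have fin: "finite Q" using Q finite_subset by blast
  have wn: "w < n" "u < n" using E'_V[OF s(5)] V(2) by auto
  then show Bn: "B \<subseteq> {..<n}" using Q s(6) by auto
  have dig: "digit n (set_encode Q) x \<longleftrightarrow> x \<in> Q" for x using Q fin by (auto simp: digit_def)
  have z: "(u * n + w) div n = u" "(u * n + w) mod n = w" using wn by simp_all
  have "\<not> E' w x" if "x \<in> Q" "x \<noteq> u" for x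
    using that s(2,6) unfolding indep_def by auto
  then have "move_ok i (set_encode Q) u w"
    unfolding move_ok_def i0 dig edge_out using s(3-5) by blast
  moreover have "set_encode Q = 2 ^ u + set_encode (Q - {u})"
    using set_encode_insert[of "Q - {u}" u] fin s(3) by (simp add: insert_absorb)
  then have "set_encode Q + 2 ^ w - 2 ^ u = set_encode B"
    using fin s(4,6) by (simp add: set_encode_insert)
  ultimately have "move i (set_encode Q) (u * n + w) = set_encode B"
    using wn by (simp add: move_def i0 z min_def)
  moreover have "u * n + w < n * n" using wn mult_le_mono1[of "Suc u" n n] by simp
  ultimately show "\<exists>z<n * n. move i (set_encode Q) z = set_encode B" by blast
qed

text \<open>The search takes place in the reduced graph but keeps the original vertex names, so the
  kernel need not be written out first.\<close>

definition "masks = {x. (\<lambda>x y. \<exists>z<n * n. y = move i x z)\<^sup>*\<^sup>* (source_mask i) x}"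

lemma masks_eq: "masks = set_encode ` {Q. (step E')\<^sup>*\<^sup>* (ts_source I) Q}"
proof -
  have src: "source_mask i = set_encode (ts_source I)"
    unfolding source_mask_def i0 source_in using source_less by (intro arg_cong[where f = set_encode]) auto
  let ?r = "\<lambda>x y. \<exists>z<n * n. y = move i x z"
  have Sn: "ts_source I \<subseteq> {..<n}" using source_less by auto
  have sub: "Q \<subseteq> {..<n} \<and> indep E' Q \<and> ?r\<^sup>*\<^sup>* (source_mask i) (set_encode Q)"
    if "(step E')\<^sup>*\<^sup>* (ts_source I) Q" for Q
    using that
  proof (induction rule: rtranclp_induct)
    case base
    then show ?case using Sn indep_E'[OF wf(3) source_U] src by simp
  next
    case (step Q B)
    then have Q: "Q \<subseteq> {..<n}" "?r\<^sup>*\<^sup>* (source_mask i) (set_encode Q)" by auto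
    obtain z where z: "z < n * n" "move i (set_encode Q) z = set_encode B" using step_move(2)[OF Q(1) step(2)] by blast
    have "?r (set_encode Q) (set_encode B)" using z by (intro exI[of _ z]) simp
    with Q(2) have "?r\<^sup>*\<^sup>* (source_mask i) (set_encode B)" by (rule rtranclp.rtrancl_into_rtrancl)
    then show ?case using step_move(1)[OF Q(1) step(2)] step(2) by (simp add: step_def)
  qed
  have "\<exists>Q. x = set_encode Q \<and> (step E')\<^sup>*\<^sup>* (ts_source I) Q" if "?r\<^sup>*\<^sup>* (source_mask i) x" for x
    using that
  proof (induction rule: rtranclp_induct)
    case base
    then show ?case using src by (intro exI[of _ "ts_source I"]) simp
  next
    case (step x y)
    then obtain Q z where Q: "x = set_encode Q" "(step E')\<^sup>*\<^sup>* (ts_source I) Q" "z < n * n" "y = move i x z" by blast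
    have "Q \<subseteq> {..<n}" "indep E' Q" using sub[OF Q(2)] by auto
    from move_encode[OF this Q(3)] show ?case
    proof
      assume "move i (set_encode Q) z = set_encode Q"
      then show ?thesis using Q by (intro exI[of _ Q]) simp
    next
      assume "\<exists>B. step E' Q B \<and> move i (set_encode Q) z = set_encode B"
      then obtain B where B: "step E' Q B" "move i (set_encode Q) z = set_encode B" by blast
      have "(step E')\<^sup>*\<^sup>* (ts_source I) B" using Q(2) B(1) by (rule rtranclp.rtrancl_into_rtrancl)
      then show ?thesis using Q B by (intro exI[of _ B]) simp
    qed
  qed
  then show ?thesis using sub unfolding masks_def by blast
qed

lemma reachable_sets:
  assumes "(step E')\<^sup>*\<^sup>* (ts_source I) Q" shows "Q \<subseteq> V" "card Q = k"
proof -
  have "Q \<subseteq> V \<and> card Q = k"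
    using assms
  proof (induction rule: rtranclp_induct)
    case base
    then show ?case using wf(5) source_U given_V by auto
  next
    case (step Q B)
    then obtain u w where s: "u \<in> Q" "w \<notin> Q" "E' u w" "B = insert w (Q - {u})" unfolding step_def by blast
    have Q: "Q \<subseteq> V" "card Q = k" using step.IH by auto
    have "finite Q" using Q(1) V(1) finite_subset by blast
    then have "card B = card Q" using s card.remove[of Q u] by simp
    then show ?case using Q s E'_V[OF s(3)] by auto
  qed
  then show "Q \<subseteq> V" "card Q = k" by auto
qed

lemma masks_bounds:
  "masks \<subseteq> {..<2 ^ (input_size I + 1)}" "card masks \<le> card V choose k" "target_mask i \<in> masks \<longleftrightarrow> ts_yes I"
proof -
  have n: "n \<le> input_size I + 1" unfolding input_size_def length_encode n_def by simp
  show "masks \<subseteq> {..<2 ^ (input_size I + 1)}"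
  proof
    fix x assume "x \<in> masks"
    then obtain Q where Q: "x = set_encode Q" "(step E')\<^sup>*\<^sup>* (ts_source I) Q" unfolding masks_eq by auto
    then have "Q \<subseteq> {..<n}" using reachable_sets(1) V(2) by blast
    then have "x < 2 ^ n" unfolding Q(1) by (rule set_encode_less)
    also have "(2::nat) ^ n \<le> 2 ^ (input_size I + 1)" using n by (rule power_increasing) simp
    finally show "x \<in> {..<2 ^ (input_size I + 1)}" by simp
  qed
  have sub: "masks \<subseteq> set_encode ` {Q. Q \<subseteq> V \<and> card Q = k}"
    unfolding masks_eq using reachable_sets by blast
  have fin: "finite {Q. Q \<subseteq> V \<and> card Q = k}" by (rule finite_subset[of _ "Pow V"]) (use V(1) in auto)
  have "card masks \<le> card (set_encode ` {Q. Q \<subseteq> V \<and> card Q = k})" using sub fin by (intro card_mono) auto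
  also have "\<dots> \<le> card {Q. Q \<subseteq> V \<and> card Q = k}" by (rule card_image_le[OF fin])
  also have "\<dots> = card V choose k" by (rule n_subsets[OF V(1)])
  finally show "card masks \<le> card V choose k" .
  have tgt: "target_mask i = set_encode (ts_target I)"
    unfolding target_mask_def i0 target_in using target_less by (intro arg_cong[where f = set_encode]) auto
  have finT: "finite (ts_target I)" by (rule finite_subset[of _ "{..<n}"]) (auto dest: target_less)
  have "set_encode (ts_target I) = set_encode Q \<longleftrightarrow> ts_target I = Q" if "(step E')\<^sup>*\<^sup>* (ts_source I) Q" for Q
    using reachable_sets(1)[OF that] V(1) finT by (intro set_encode_eq) (auto intro: finite_subset)
  then show "target_mask i \<in> masks \<longleftrightarrow> ts_yes I"
    unfolding masks_eq yes_I tgt by auto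
qed

text \<open>Unordered sets are counted, hence a division by \<open>fact k\<close>, against which
  \<open>36 ^ k\<close> is cancelled up to the constant \<open>C\<close>.\<close>

lemma choose_bound:
  assumes C: "\<forall>k. 36 ^ k \<le> C * (fact k :: nat)"
  shows "card V choose k \<le> C * (k ^ (2 * k) * \<Delta> ^ (5 * k))"
proof -
  have "card V \<le> 36 * (k ^ 2 * \<Delta> ^ 5)" using size_J by (simp add: num_vertices_def J_def)
  then have "card V ^ k \<le> (36 * (k ^ 2 * \<Delta> ^ 5)) ^ k" by (rule power_mono) simp
  also have "\<dots> = 36 ^ k * (k ^ (2 * k) * \<Delta> ^ (5 * k))" by (simp add: power_mult_distrib power_mult)
  also have "\<dots> \<le> C * fact k * (k ^ (2 * k) * \<Delta> ^ (5 * k))" using C by (intro mult_le_mono1) blast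
  finally have "(card V choose k) * fact k \<le> C * fact k * (k ^ (2 * k) * \<Delta> ^ (5 * k))"
    using binomial_fact_pow[of "card V" k] by linarith
  then have "(card V choose k) * fact k \<le> (C * (k ^ (2 * k) * \<Delta> ^ (5 * k))) * fact k" by (simp only: ac_simps)
  then show ?thesis by (simp only: mult_le_cancel2) simp
qed

end

theorem theorem12:
  shows "(\<exists>kernel f. is_kernel kernel f \<and>
            (\<exists>C::nat. \<forall>k \<ge> 1. \<forall>\<Delta> \<ge> 1. f k \<Delta> \<le> C * (k ^ 2 * \<Delta> ^ 5))) \<and>
         (\<exists>solver. solves_in_ostar_time solver (\<lambda>k \<Delta>. k ^ (2 * k) * \<Delta> ^ (5 * k)))"
proof
  have poly: "poly ([:1, 1:] ^ m) x = (x + 1) ^ m" for m and x :: nat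
    by (simp add: poly_power)
  have "pt 4 (\<lambda>e i. symbol_out i (e 3))" by (intro pt_symbol_out pt_var) simp
  from output_program[OF pt_length_out this] obtain kernel m where kernel:
    "\<And>xs b. fits_input xs b \<Longrightarrow> length_out (input_array xs) \<le> b \<Longrightarrow> computes_within kernel xs
      (map (symbol_out (input_array xs)) [0..<length_out (input_array xs)]) (b ^ m)"
    by blast
  have "is_kernel kernel (\<lambda>k \<Delta>. 36 * (k ^ 2 * \<Delta> ^ 5))"
    unfolding is_kernel_def
  \<comment> \<open>The polynomial \<open>(x + 1) ^ m\<close> arises because
    \<open>input_size I + 1\<close> serves as the bound \<open>b\<close> of
    \<open>fits_input\<close>.\<close>
  proof (intro exI[of _ "[:1, 1:] ^ m"] allI impI)
    fix \<Delta> :: nat and I assume "1 \<le> \<Delta>" "ts_bipartite_instance \<Delta> I"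
    then interpret bipartite_instance I \<Delta> by unfold_locales
    have "computes_within kernel (encode I) (encode J) (poly ([:1, 1:] ^ m) (input_size I))"
      unfolding encode_J poly i_def
      by (rule kernel[OF fits_encode]) (use length_out_le in \<open>simp add: i_def\<close>)
    then show "\<exists>J. computes_within kernel (encode I) (encode J) (poly ([:1, 1:] ^ m) (input_size I)) \<and>
        ts_bipartite_instance \<Delta> J \<and> ts_yes J = ts_yes I \<and> num_vertices J \<le> 36 * ((num_tokens I)\<^sup>2 * \<Delta> ^ 5)"
      using instance_J yes_J size_J unfolding k_def by blast
  qed
  then show "\<exists>kernel f. is_kernel kernel f \<and> (\<exists>C::nat. \<forall>k \<ge> 1. \<forall>\<Delta> \<ge> 1. f k \<Delta> \<le> C * (k ^ 2 * \<Delta> ^ 5))"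
    by blast
next
  have poly: "poly ([:C:] * [:1, 1:] ^ m) x = C * (x + 1) ^ m" for m C and x :: nat
    by (simp add: poly_power)
  obtain C where C: "\<forall>k. 36 ^ k \<le> C * (fact k :: nat)" using pow_le_fact[of 36] by blast
  \<comment> \<open>A state has \<open>i 0 * i 0\<close> successors, one for each pair of a vertex
    to leave and a vertex to enter.\<close>
  have p: "pt 3 (\<lambda>e i. i 0 * i 0)" "pt 4 (\<lambda>e i. source_mask i)" "pt 8 (\<lambda>e i. target_mask i)"
    "pt 9 (\<lambda>e i. move i (e 8) (e 7))"
    by (intro pt_mult pt_size pt_source_mask pt_target_mask pt_move pt_var; simp)+
  from search_program[OF p] obtain solver m where solver:
    "\<And>xs b i M. fits_input xs b \<Longrightarrow> i = input_array xs \<Longrightarrow> 1 \<le> i 0 * i 0 \<Longrightarrow> i 0 * i 0 \<le> b \<Longrightarrow>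
      M = {x. (\<lambda>x y. \<exists>z<i 0 * i 0. y = move i x z)\<^sup>*\<^sup>* (source_mask i) x} \<Longrightarrow> M \<subseteq> {..<2 ^ b} \<Longrightarrow>
      computes_within solver xs [of_bool (target_mask i \<in> M)] (b ^ m * card M)"
    by blast
  have "solves_in_ostar_time solver (\<lambda>k \<Delta>. k ^ (2 * k) * \<Delta> ^ (5 * k))"
    unfolding solves_in_ostar_time_def
  proof (intro exI[of _ "[:C:] * [:1, 1:] ^ m"] allI impI)
    fix \<Delta> :: nat and I assume "1 \<le> \<Delta>" "ts_bipartite_instance \<Delta> I"
    then interpret bipartite_instance I \<Delta> by unfold_locales
    let ?b = "input_size I + 1"
    have "ts_source I \<noteq> {}" using wf(5,7) by auto
    then have "1 \<le> n" using source_less by fastforce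
    then have n: "1 \<le> i 0 * i 0" "i 0 * i 0 \<le> ?b"
      unfolding i0 input_size_def length_encode n_def by auto
    have "computes_within solver (encode I) [of_bool (target_mask i \<in> masks)] (?b ^ m * card masks)"
      by (rule solver[OF fits_encode i_def n _ masks_bounds(1)]) (simp add: masks_def i0)
    moreover have "?b ^ m * card masks \<le> ?b ^ m * (C * (k ^ (2 * k) * \<Delta> ^ (5 * k)))"
      using le_trans[OF masks_bounds(2) choose_bound[OF C]] by (rule mult_le_mono2)
    then have "?b ^ m * card masks \<le> poly ([:C:] * [:1, 1:] ^ m) (input_size I) * (k ^ (2 * k) * \<Delta> ^ (5 * k))"
      unfolding poly by (simp only: ac_simps)
    ultimately show "computes_within solver (encode I) [of_bool (ts_yes I)]
        (poly ([:C:] * [:1, 1:] ^ m) (input_size I) * (num_tokens I ^ (2 * num_tokens I) * \<Delta> ^ (5 * num_tokens I)))"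
      unfolding masks_bounds(3) k_def by (rule computes_within_mono)
  qed
  then show "\<exists>solver. solves_in_ostar_time solver (\<lambda>k \<Delta>. k ^ (2 * k) * \<Delta> ^ (5 * k))" by blast
qed

end
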